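(* For each $n\in\mathbb N^*$ and $\Delta t>0$, the explicit Euler approximation $\widetilde\Phi^n=(I-\Delta t A)^n\Phi(0,\cdot)$ of $\Phi'+A\Phi=0$ satisfies $$\bigl\|\widetilde\Phi^n\bigr\|_{\mathcal E}^2=\sum_{k=1}^\infty\bigl(1+\omega_k^2\Delta t^2\bigr)^n\bigl|\langle\Phi(0,\cdot),\phi_k\rangle_{\mathcal E}\bigr|^2 .$$ In particular, for any $\Phi(0,\cdot)\ne0$, the numerical energy grows without bound, i.e. $\|\widetilde\Phi^n\|_{\mathcal E}\to\infty$ as $n\to\infty$. Moreover, for each $n\in\mathbb N^*$ and $\Delta t>0$, the formal explicit Euler operator $(I-\Delta tA)^n$ is unbounded on $\mathcal E$.
   Context: $\Omega=(0,1)^N$, $\alpha\ge0$ real, $\mathbb N^*=\{1,2,\dots\}$. $\mathcal E=H_0^1(\Omega)\times L^2(\Omega)$ (complex-valued functions) with inner product $\langle(u_1,z_1),(u_2,z_2)\rangle_{\mathcal E}=\int_\Omega(\nabla u_1\cdot\overline{\nabla u_2}+\alpha u_1\overline{u_2})dx+\int_\Omega z_1\overline{z_2}\,dx$. The operator $A$ has domain $D(A)=(H^2(\Omega)\cap H_0^1(\Omega))\times H_0^1(\Omega)$ and $A(u,z)=(-z,-\Delta u+\alpha u)$; it is skew-adjoint. It has an orthonormal basis of eigenfunctions of $\mathcal E$, namely, for $k\in(\mathbb N^* )^N$, $\phi_k^\pm=2^{-1/2}(e_k/\lambda_k^\pm,\,-e_k)$ with eigenvalues $\lambda_k^\pm=\pm\mathbf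 i\sqrt{\pi^2\sum_jk_j^2+\alpha}$, where $e_k(x)=2^{N/2}\prod_j\sin(k_j\pi x_j)$. These are enumerated as a single sequence $(\lambda_k,\phi_k)_{k\in\mathbb N^*}$ (multi-indices ordered by increasing $\sum_jk_j^2$, ties lexicographically, each contributing first its $+$ and then its $-$ branch), and one writes $\lambda_k=\mathbf i\omega_k$, $\omega_k\in\mathbb R$. For a function $h$ on the spectrum of $A$, $h(A)\Psi:=\sum_{k}h(\lambda_k)\langle\Psi,\phi_k\rangle_{\mathcal E}\phi_k$, and $\|h(A)\|=\sup_k|h(\lambda_k)|$; the powers $(I-\Delta tA)^n$ are understood in this sense, with $\|h(A)\Psi\|_{\mathcal E}=+\infty$ when the series $\sum_k|h(\lambda_k)|^2|\langle\Psi,\phi_k\rangle_{\mathcal E}|^2$ diverges. $\Phi(0,\cdot)\in\mathcal E$ is the initial datum. *)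

theory Defs
  imports "HOL-Analysis.Analysis"
begin

text \<open>
  The space dimension \<open>N \<ge> 1\<close> is \<open>CARD('n)\<close>. Elements of the function spaces below are
  represented by functions on all of \<open>real ^ 'n\<close>; only their values on the cube matter, and two
  functions stand for the same element when they agree almost everywhere there.
\<close>

type_synonym 'n cfun = "real ^ 'n \<Rightarrow> complex"
type_synonym 'n state = "'n cfun \<times> 'n cfun"

definition Omega :: "(real ^ 'n::finite) set" where
  "Omega = {x. \<forall>i. 0 < x $ i \<and> x $ i < 1}"


section \<open>Sobolev spaces on the cube\<close>

definition L2 :: "'n::finite cfun set" where
  "L2 = {u. u \<in> borel_measurable (lebesgue_on Omega) \<and>
            integrable (lebesgue_on Omega) (\<lambda>x. (cmod (u x))\<^sup>2)}"

definition pderiv_at :: "'n::finite \<Rightarrow> 'n cfun \<Rightarrow> 'n cfun" where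
  "pderiv_at i f = (\<lambda>x. frechet_derivative f (at x) (axis i 1))"

primrec Ck :: "nat \<Rightarrow> 'n::finite cfun \<Rightarrow> bool" where
  "Ck 0 f \<longleftrightarrow> continuous_on UNIV f"
| "Ck (Suc m) f \<longleftrightarrow> (\<forall>x. f differentiable (at x)) \<and> (\<forall>i. Ck m (pderiv_at i f))"

definition test_functions :: "'n::finite cfun set" where
  "test_functions = {f. (\<forall>m. Ck m f) \<and> compact (closure {x. f x \<noteq> 0}) \<and>
                        closure {x. f x \<noteq> 0} \<subseteq> Omega}"

definition weak_pderiv :: "'n::finite \<Rightarrow> 'n cfun \<Rightarrow> 'n cfun \<Rightarrow> bool" where
  "weak_pderiv i u g \<longleftrightarrow> u \<in> L2 \<and> g \<in> L2 \<and>
     (\<forall>f \<in> test_functions.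
        (LINT x|lebesgue_on Omega. u x * pderiv_at i f x) = - (LINT x|lebesgue_on Omega. g x * f x))"

definition H1 :: "'n::finite cfun set" where
  "H1 = {u \<in> L2. \<forall>i. \<exists>g. weak_pderiv i u g}"

text \<open>The weak partial derivative is determined up to null sets; a representative is chosen.\<close>

definition wD :: "'n::finite \<Rightarrow> 'n cfun \<Rightarrow> 'n cfun" where
  "wD i u = (SOME g. weak_pderiv i u g)"

definition H1_norm :: "'n::finite cfun \<Rightarrow> real" where
  "H1_norm u = sqrt ((LINT x|lebesgue_on Omega. (cmod (u x))\<^sup>2) +
                     (\<Sum>i\<in>UNIV. LINT x|lebesgue_on Omega. (cmod (wD i u x))\<^sup>2))"

definition H10 :: "'n::finite cfun set" where
  "H10 = {u \<in> H1. \<exists>f. (\<forall>m. f m \<in> test_functions) \<and>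
                      (\<lambda>m::nat. H1_norm (\<lambda>x. f m x - u x)) \<longlonglongrightarrow> 0}"

definition H2 :: "'n::finite cfun set" where
  "H2 = {u \<in> H1. \<forall>i. wD i u \<in> H1}"


section \<open>The energy space and the wave operator\<close>

definition energy_space :: "'n::finite state set" where
  "energy_space = H10 \<times> L2"

definition inner_E :: "real \<Rightarrow> 'n::finite state \<Rightarrow> 'n state \<Rightarrow> complex" where
  "inner_E \<alpha> \<Phi> \<Psi> =
     (LINT x|lebesgue_on Omega. (\<Sum>i\<in>UNIV. wD i (fst \<Phi>) x * cnj (wD i (fst \<Psi>) x)) +
                                of_real \<alpha> * fst \<Phi> x * cnj (fst \<Psi> x)) +
     (LINT x|lebesgue_on Omega. snd \<Phi> x * cnj (snd \<Psi> x))"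

definition norm_E :: "real \<Rightarrow> 'n::finite state \<Rightarrow> real" where
  "norm_E \<alpha> \<Phi> = sqrt (Re (inner_E \<alpha> \<Phi> \<Phi>))"

definition zero_E :: "'n::finite state \<Rightarrow> bool" where
  "zero_E \<Phi> \<longleftrightarrow> (AE x in lebesgue_on Omega. fst \<Phi> x = 0 \<and> snd \<Phi> x = 0)"

definition dom_A :: "'n::finite state set" where
  "dom_A = (H2 \<inter> H10) \<times> H10"

definition op_A :: "real \<Rightarrow> 'n::finite state \<Rightarrow> 'n state" where
  "op_A \<alpha> \<Phi> = ((\<lambda>x. - snd \<Phi> x),
               (\<lambda>x. - (\<Sum>i\<in>UNIV. wD i (wD i (fst \<Phi>)) x) + of_real \<alpha> * fst \<Phi> x))"


section \<open>Eigenpairs and their enumeration\<close>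

text \<open>A mode is a multi-index with positive entries together with a sign, \<open>True\<close> for \<open>+\<close>.\<close>

type_synonym 'n mode = "(nat ^ 'n) \<times> bool"

definition modes :: "'n::finite mode set" where
  "modes = {(k, s). \<forall>i. 1 \<le> k $ i}"

definition sqsum :: "nat ^ 'n::finite \<Rightarrow> nat" where
  "sqsum k = (\<Sum>i\<in>UNIV. (k $ i)\<^sup>2)"

definition eigfun :: "nat ^ 'n::finite \<Rightarrow> 'n cfun" where
  "eigfun k = (\<lambda>x. of_real (2 powr (real CARD('n) / 2) *
                             (\<Prod>i\<in>UNIV. sin (real (k $ i) * pi * x $ i))))"

definition mode_omega :: "real \<Rightarrow> 'n::finite mode \<Rightarrow> real" where
  "mode_omega \<alpha> p = (if snd p then 1 else - 1) * sqrt (pi\<^sup>2 * real (sqsum (fst p)) + \<alpha>)"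

definition mode_state :: "real \<Rightarrow> 'n::finite mode \<Rightarrow> 'n state" where
  "mode_state \<alpha> p =
     ((\<lambda>x. of_real (1 / sqrt 2) * (eigfun (fst p) x / (\<i> * of_real (mode_omega \<alpha> p)))),
      (\<lambda>x. of_real (1 / sqrt 2) * (- eigfun (fst p) x)))"

definition lex_less :: "(nat, 'n::{finite,linorder}) vec \<Rightarrow> (nat, 'n) vec \<Rightarrow> bool" where
  "lex_less k l \<longleftrightarrow> (\<exists>i. k $ i < l $ i \<and> (\<forall>j<i. k $ j = l $ j))"

definition mode_less :: "'n::{finite,linorder} mode \<Rightarrow> 'n mode \<Rightarrow> bool" where
  "mode_less p q \<longleftrightarrow>
     sqsum (fst p) < sqsum (fst q) \<or>
     sqsum (fst p) = sqsum (fst q) \<and> lex_less (fst p) (fst q) \<or>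
     fst p = fst q \<and> snd p \<and> \<not> snd q"

text \<open>The mode of position \<open>j \<ge> 1\<close>; every mode has only finitely many predecessors.\<close>

definition nth_mode :: "nat \<Rightarrow> 'n::{finite,linorder} mode" where
  "nth_mode j = (THE p. p \<in> modes \<and> card {q \<in> modes. mode_less q p} + 1 = j)"

definition omega :: "real \<Rightarrow> 'n::{finite,linorder} itself \<Rightarrow> nat \<Rightarrow> real" where
  "omega \<alpha> _ j = mode_omega \<alpha> (nth_mode j :: 'n mode)"

definition lam :: "real \<Rightarrow> 'n::{finite,linorder} itself \<Rightarrow> nat \<Rightarrow> complex" where
  "lam \<alpha> N j = \<i> * of_real (omega \<alpha> N j)"

definition phi :: "real \<Rightarrow> nat \<Rightarrow> 'n::{finite,linorder} state" where
  "phi \<alpha> j = mode_state \<alpha> (nth_mode j)"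


section \<open>Functional calculus\<close>

text \<open>
  \<open>h(A)\<close> is defined through the spectral resolution of \<open>op_A\<close>: each \<open>phi \<alpha> j\<close> lies in \<open>dom_A\<close> and
  is an eigenvector of \<open>op_A \<alpha>\<close> with eigenvalue \<open>lam \<alpha> TYPE('n) j\<close>. The sum of the series is
  taken in the energy norm, hence is determined up to null sets; a representative is chosen.
\<close>

definition fc_sums :: "real \<Rightarrow> (complex \<Rightarrow> complex) \<Rightarrow> 'n::{finite,linorder} state \<Rightarrow> 'n state \<Rightarrow> bool"
  where
  "fc_sums \<alpha> h \<Psi> S \<longleftrightarrow> S \<in> energy_space \<and>
     (\<lambda>m. norm_E \<alpha>
        ((\<lambda>x. (\<Sum>j=1..m. h (lam \<alpha> TYPE('n) j) * inner_E \<alpha> \<Psi> (phi \<alpha> j) * fst (phi \<alpha> j) x) - fst S x),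
         (\<lambda>x. (\<Sum>j=1..m. h (lam \<alpha> TYPE('n) j) * inner_E \<alpha> \<Psi> (phi \<alpha> j) * snd (phi \<alpha> j) x) - snd S x)))
     \<longlonglongrightarrow> 0"

definition fc :: "real \<Rightarrow> (complex \<Rightarrow> complex) \<Rightarrow> 'n::{finite,linorder} state \<Rightarrow> 'n state" where
  "fc \<alpha> h \<Psi> = (SOME S. fc_sums \<alpha> h \<Psi> S)"

definition fc_domain :: "real \<Rightarrow> (complex \<Rightarrow> complex) \<Rightarrow> 'n::{finite,linorder} state set" where
  "fc_domain \<alpha> h = {\<Psi> \<in> energy_space.
     summable (\<lambda>j. (cmod (h (lam \<alpha> TYPE('n) (Suc j))))\<^sup>2 *
                   (cmod (inner_E \<alpha> \<Psi> (phi \<alpha> (Suc j))))\<^sup>2)}"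

text \<open>The norm of \<open>h(A) \<Psi>\<close> for \<open>\<Psi>\<close> in the energy space, infinite outside the domain of \<open>h(A)\<close>.\<close>

definition fc_norm :: "real \<Rightarrow> (complex \<Rightarrow> complex) \<Rightarrow> 'n::{finite,linorder} state \<Rightarrow> ennreal" where
  "fc_norm \<alpha> h \<Psi> = (if \<Psi> \<in> fc_domain \<alpha> h then ennreal (norm_E \<alpha> (fc \<alpha> h \<Psi>)) else \<infinity>)"

definition fc_opnorm :: "real \<Rightarrow> 'n::{finite,linorder} itself \<Rightarrow> (complex \<Rightarrow> complex) \<Rightarrow> ennreal" where
  "fc_opnorm \<alpha> N h = (SUP j\<in>{1..}. ennreal (cmod (h (lam \<alpha> N j))))"

definition fc_bounded :: "real \<Rightarrow> 'n::{finite,linorder} itself \<Rightarrow> (complex \<Rightarrow> complex) \<Rightarrow> bool" where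
  "fc_bounded \<alpha> N h \<longleftrightarrow>
     (\<exists>C. \<forall>\<Psi> :: 'n state. \<Psi> \<in> fc_domain \<alpha> h \<longrightarrow> norm_E \<alpha> (fc \<alpha> h \<Psi>) \<le> C * norm_E \<alpha> \<Psi>)"

text \<open>The function whose value at \<open>A\<close> is the \<open>n\<close>-step propagator \<open>(I - dt A)^n\<close>.\<close>

definition euler :: "real \<Rightarrow> nat \<Rightarrow> complex \<Rightarrow> complex" where
  "euler dt n z = (1 - of_real dt * z) ^ n"

end

theory Submission
  imports Defs "HOL-Computational_Algebra.Polynomial" "HOL-Real_Asymp.Real_Asymp"
begin

text \<open>
  The operator \<open>A\<close> is diagonal in the family \<open>phi \<alpha> j\<close>, with purely imaginary eigenvalues
  \<open>\<i> \<omega>\<^sub>j\<close>. On such an eigenvalue the Euler symbol \<open>h z = (1 - dt z) ^ n\<close> has modulus squared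
  \<open>(1 + \<omega>\<^sub>j\<^sup>2 dt\<^sup>2) ^ n\<close>, so the energy identity is Parseval's identity for \<open>h(A) \<Phi>\<close>
  (\<open>fc_norm_sq\<close>, \<open>euler_lam\<close>). Every \<open>\<omega>\<^sub>j\<close> is nonzero, hence a single nonzero coefficient of \<open>\<Phi>\<close>
  already forces exponential growth in \<open>n\<close>; and the \<open>\<omega>\<^sub>j\<close> are unbounded, hence \<open>h(A)\<close> expands the
  unit vectors \<open>phi \<alpha> j\<close> by arbitrarily large factors.

  What has to be proved from the definitions of the Sobolev spaces is therefore that the family is
  orthonormal, that no nonzero state is orthogonal to all of it, and that an orthogonal series with
  square-summable coefficients converges in the energy norm to an element of \<open>H10 \<times> L2\<close>.

  Completeness (\<open>sines_complete\<close>). The square-integrable functions orthogonal to all sine products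
  form a space that is stable under multiplication by \<open>cos (\<pi> x\<^sub>j)\<close>, because
  \<open>2 cos t sin (k t) = sin ((k + 1) t) + sin ((k - 1) t)\<close>. The functions \<open>cos (\<pi> x\<^sub>j)\<close> separate
  the points of the closed cube, so by Stone and Weierstrass the space is stable under all
  continuous multipliers, and a function \<open>h\<close> in it satisfies \<open>\<integral> f h e = 0\<close> for all continuous \<open>f\<close>,
  where \<open>e\<close> is the ground state, which is positive on the open cube. Hence \<open>h = 0\<close>.

  Sobolev spaces. Cutting the sines off smoothly near the faces of the cube approximates each
  sine product by test functions, together with its first derivatives
  (\<open>eigfun_test_approximation\<close>). This puts the sine products into \<open>H10\<close>, and combined with
  completeness it shows that test functions separate square-integrable functions, so that weak
  derivatives are unique. Integration by parts rests on the fact that a derivative of a compactly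
  supported function has integral zero, which follows from translation invariance of Lebesgue
  measure (\<open>divergence_compact_support\<close>). It yields the Poincare inequality, with which \<open>H10\<close> is
  complete for the gradient norm, also when \<open>\<alpha> = 0\<close>.

  Orthonormality. Integrating by parts, the coefficient of a state \<open>(u, z)\<close> on the mode \<open>(k, \<plusminus>)\<close> is
  \<open>(\<i> \<omega> \<integral> u e\<^sub>k - \<integral> z e\<^sub>k) / sqrt 2\<close> (\<open>inner_E_mode\<close>), so that orthonormality and completeness in
  the energy space both reduce to those of the sine products in \<open>L2\<close>.
\<close>

section \<open>Square-integrable functions on the cube\<close>

lemma Omega_eq_box: "(Omega :: (real ^ 'n::finite) set) = box 0 1"
  by (auto simp: Omega_def mem_box_cart)

lemma open_Omega [simp]: "open (Omega :: (real ^ 'n::finite) set)"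
  by (simp add: Omega_eq_box open_box)

lemma Omega_borel [measurable, simp]: "Omega \<in> sets borel"
  by (simp add: Omega_eq_box)

lemma Omega_lebesgue [simp]: "Omega \<in> sets lebesgue"
  by (simp add: Omega_eq_box)

lemma space_Omega [simp]: "space (lebesgue_on Omega) = Omega"
  by simp

lemma prob_Omega: "emeasure (lebesgue_on (Omega :: (real ^ 'n::finite) set)) Omega = 1"
proof -
  have "((1::real^'n) \<bullet> b) = 1" if "b \<in> Basis" for b
    using that by (auto simp: Basis_vec_def inner_axis)
  then have "emeasure lborel (box 0 (1::real^'n)) = 1"
    by (subst emeasure_lborel_box) (auto simp: inner_simps)
  then show ?thesis
    by (simp add: emeasure_restrict_space Omega_eq_box)
qed

lemma finite_measure_Omega [simp]: "finite_measure (lebesgue_on (Omega :: (real ^ 'n::finite) set))"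
  by (rule finite_measureI) (simp only: space_Omega prob_Omega, simp)

lemma borel_imp_Omega_measurable:
  "f \<in> borel_measurable borel \<Longrightarrow> f \<in> borel_measurable (lebesgue_on Omega)"
  by (simp add: borel_measurable_if_I measurable_completion measurable_restrict_space1)

definition L2norm :: "'n::finite cfun \<Rightarrow> real" where
  "L2norm u = sqrt (LINT x|lebesgue_on Omega. (cmod (u x))\<^sup>2)"

lemma L2D:
  assumes "u \<in> L2"
  shows "u \<in> borel_measurable (lebesgue_on Omega)" "integrable (lebesgue_on Omega) (\<lambda>x. (cmod (u x))\<^sup>2)"
  using assms by (auto simp: L2_def)

lemma L2norm_nonneg [simp]: "0 \<le> L2norm u"
  by (simp add: L2norm_def)

lemma L2norm_sq: "(L2norm u)\<^sup>2 = (LINT x|lebesgue_on Omega. (cmod (u x))\<^sup>2)"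
  by (simp add: L2norm_def)

lemma L2norm_nn: "u \<in> L2 \<Longrightarrow>
    (\<integral>\<^sup>+x. (ennreal (cmod (u x)))\<^sup>2 \<partial>lebesgue_on Omega) = ennreal ((L2norm u)\<^sup>2)"
  by (simp add: L2norm_sq L2D nn_integral_eq_integral ennreal_power)

lemma L2_bounded:
  assumes "u \<in> borel_measurable (lebesgue_on Omega)" "\<And>x. x \<in> Omega \<Longrightarrow> cmod (u x) \<le> B"
  shows "u \<in> L2"
proof -
  interpret finite_measure "lebesgue_on Omega" by simp
  have "integrable (lebesgue_on Omega) (\<lambda>x. (cmod (u x))\<^sup>2)"
    by (rule integrable_const_bound[of _ "B\<^sup>2"])
       (use assms in \<open>auto intro!: AE_I2 power_mono\<close>)
  with assms show ?thesis by (simp add: L2_def)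
qed

lemma L2_mult_bounded:
  assumes "u \<in> L2" "b \<in> borel_measurable (lebesgue_on Omega)" "\<And>x. x \<in> Omega \<Longrightarrow> cmod (b x) \<le> B"
  shows "(\<lambda>x. b x * u x) \<in> L2"
proof -
  note [measurable] = L2D(1)[OF assms(1)] assms(2)
  have "integrable (lebesgue_on Omega) (\<lambda>x. (cmod (b x * u x))\<^sup>2)"
    by (rule Bochner_Integration.integrable_bound[OF integrable_mult_right[OF L2D(2)[OF assms(1)], of "B\<^sup>2"]])
       (auto simp: norm_mult power_mult_distrib intro!: AE_I2 mult_right_mono power_mono assms(3))
  then show ?thesis by (simp add: L2_def)
qed

lemma L2_cmult: "u \<in> L2 \<Longrightarrow> (\<lambda>x. c * u x) \<in> L2"
  by (rule L2_mult_bounded[where B="cmod c"]) auto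

lemma L2_add:
  assumes "u \<in> L2" "v \<in> L2"
  shows "(\<lambda>x. u x + v x) \<in> L2"
proof -
  note [measurable] = L2D(1)[OF assms(1)] L2D(1)[OF assms(2)]
  have "(cmod (u x + v x))\<^sup>2 \<le> 2 * (cmod (u x))\<^sup>2 + 2 * (cmod (v x))\<^sup>2" for x
  proof -
    have "(cmod (u x + v x))\<^sup>2 \<le> (cmod (u x) + cmod (v x))\<^sup>2"
      by (simp add: power_mono norm_triangle_ineq)
    also have "\<dots> \<le> 2 * (cmod (u x))\<^sup>2 + 2 * (cmod (v x))\<^sup>2"
      using sum_squares_bound[of "cmod (u x)" "cmod (v x)"] by (simp add: power2_sum)
    finally show ?thesis .
  qed
  then have "integrable (lebesgue_on Omega) (\<lambda>x. (cmod (u x + v x))\<^sup>2)"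
    using L2D(2)[OF assms(1)] L2D(2)[OF assms(2)]
    by (intro Bochner_Integration.integrable_bound[where g="\<lambda>x. (cmod (u x + v x))\<^sup>2" and
          f="\<lambda>x. 2 * (cmod (u x))\<^sup>2 + 2 * (cmod (v x))\<^sup>2"]) (auto intro!: AE_I2)
  then show ?thesis by (simp add: L2_def)
qed

lemma L2_diff: "u \<in> L2 \<Longrightarrow> v \<in> L2 \<Longrightarrow> (\<lambda>x. u x - v x) \<in> L2"
  using L2_add[OF _ L2_cmult[of v "-1"], of u] by simp

lemma L2_uminus: "u \<in> L2 \<Longrightarrow> (\<lambda>x. - u x) \<in> L2"
  using L2_cmult[of u "-1"] by simp

lemma L2_cnj: "u \<in> L2 \<Longrightarrow> (\<lambda>x. cnj (u x)) \<in> L2"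
  by (auto simp: L2_def intro: borel_measurable_continuous_on[OF continuous_on_cnj])

lemma L2_mult_integrable:
  assumes "u \<in> L2" "v \<in> L2"
  shows "integrable (lebesgue_on Omega) (\<lambda>x. u x * v x)"
proof -
  note [measurable] = L2D(1)[OF assms(1)] L2D(1)[OF assms(2)]
  have "cmod (u x * v x) \<le> (cmod (u x))\<^sup>2 + (cmod (v x))\<^sup>2" for x
  proof -
    have "2 * (cmod (u x) * cmod (v x)) \<le> (cmod (u x))\<^sup>2 + (cmod (v x))\<^sup>2"
      using sum_squares_bound[of "cmod (u x)" "cmod (v x)"] by simp
    moreover have "0 \<le> cmod (u x) * cmod (v x)" by simp
    ultimately show ?thesis unfolding norm_mult by linarith
  qed
  then show ?thesis
    using L2D(2)[OF assms(1)] L2D(2)[OF assms(2)]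
    by (intro Bochner_Integration.integrable_bound[where g="\<lambda>x. u x * v x" and
          f="\<lambda>x. (cmod (u x))\<^sup>2 + (cmod (v x))\<^sup>2"]) (auto intro!: AE_I2)
qed

lemma L2_integrable: "u \<in> L2 \<Longrightarrow> integrable (lebesgue_on Omega) u"
  using L2_mult_integrable[OF _ L2_bounded[of "\<lambda>_. 1" 1]] by simp

lemma L2_Cauchy_Schwarz_abs:
  assumes "u \<in> L2" "v \<in> L2"
  shows "(LINT x|lebesgue_on Omega. cmod (u x) * cmod (v x)) \<le> L2norm u * L2norm v"
proof -
  note [measurable] = L2D(1)[OF assms(1)] L2D(1)[OF assms(2)]
  let ?I = "LINT x|lebesgue_on Omega. cmod (u x) * cmod (v x)"
  have int: "integrable (lebesgue_on Omega) (\<lambda>x. cmod (u x) * cmod (v x))"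
    using integrable_norm[OF L2_mult_integrable[OF assms]] by (simp add: norm_mult)
  have "(\<integral>\<^sup>+x. ennreal (cmod (u x)) * ennreal (cmod (v x)) \<partial>lebesgue_on Omega) = ennreal ?I"
    using int by (simp add: ennreal_mult'[symmetric] nn_integral_eq_integral)
  with Cauchy_Schwarz_nn_integral[of "\<lambda>x. ennreal (cmod (u x))" "lebesgue_on Omega" "\<lambda>x. ennreal (cmod (v x))"]
  have "ennreal (?I\<^sup>2) \<le> ennreal ((L2norm u * L2norm v)\<^sup>2)"
    unfolding L2norm_nn[OF assms(1)] L2norm_nn[OF assms(2)]
    by (simp add: ennreal_power ennreal_mult'[symmetric] power_mult_distrib)
  then have "?I\<^sup>2 \<le> (L2norm u * L2norm v)\<^sup>2" by (simp add: ennreal_le_iff)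
  then show ?thesis by (rule power2_le_imp_le) simp
qed

lemma L2_Cauchy_Schwarz:
  assumes "u \<in> L2" "v \<in> L2"
  shows "cmod (LINT x|lebesgue_on Omega. u x * v x) \<le> L2norm u * L2norm v"
  using integral_norm_bound[of "lebesgue_on Omega" "\<lambda>x. u x * v x"] L2_Cauchy_Schwarz_abs[OF assms]
  by (simp add: norm_mult)

lemma L2norm_cmult: "L2norm (\<lambda>x. c * u x) = cmod c * L2norm u"
  by (simp add: L2norm_def norm_mult power_mult_distrib real_sqrt_mult)

lemma L2norm_triangle:
  assumes "u \<in> L2" "v \<in> L2"
  shows "L2norm (\<lambda>x. u x + v x) \<le> L2norm u + L2norm v"
proof -
  note int = L2D(2)[OF assms(1)] L2D(2)[OF assms(2)]
    integrable_norm[OF L2_mult_integrable[OF assms], unfolded norm_mult]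
  have "(L2norm (\<lambda>x. u x + v x))\<^sup>2 \<le>
      (LINT x|lebesgue_on Omega. (cmod (u x))\<^sup>2 + 2 * (cmod (u x) * cmod (v x)) + (cmod (v x))\<^sup>2)"
    unfolding L2norm_sq
  proof (rule integral_mono[OF L2D(2)[OF L2_add[OF assms]]])
    fix x
    have "(cmod (u x + v x))\<^sup>2 \<le> (cmod (u x) + cmod (v x))\<^sup>2"
      by (simp add: power_mono norm_triangle_ineq)
    then show "(cmod (u x + v x))\<^sup>2 \<le> (cmod (u x))\<^sup>2 + 2 * (cmod (u x) * cmod (v x)) + (cmod (v x))\<^sup>2"
      by (simp add: power2_sum)
  qed (use int in simp)
  also have "\<dots> = (L2norm u)\<^sup>2 + 2 * (LINT x|lebesgue_on Omega. cmod (u x) * cmod (v x)) + (L2norm v)\<^sup>2"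
    using int by (simp add: L2norm_sq)
  also have "\<dots> \<le> (L2norm u + L2norm v)\<^sup>2"
    using L2_Cauchy_Schwarz_abs[OF assms] by (simp add: power2_sum)
  finally show ?thesis by (rule power2_le_imp_le) simp
qed

lemma L2norm_minus_commute: "L2norm (\<lambda>x. u x - v x) = L2norm (\<lambda>x. v x - u x)"
  by (simp add: L2norm_def norm_minus_commute)

lemma L2norm_triangle_diff:
  assumes "u \<in> L2" "v \<in> L2" "w \<in> L2"
  shows "L2norm (\<lambda>x. u x - w x) \<le> L2norm (\<lambda>x. u x - v x) + L2norm (\<lambda>x. v x - w x)"
  using L2norm_triangle[OF L2_diff[OF assms(1,2)] L2_diff[OF assms(2,3)]] by simp

lemma L2norm_reverse_triangle:
  assumes "u \<in> L2" "v \<in> L2"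
  shows "\<bar>L2norm u - L2norm v\<bar> \<le> L2norm (\<lambda>x. u x - v x)"
  using L2norm_triangle[OF L2_diff[OF assms] assms(2)] L2norm_triangle[OF L2_diff[OF assms(2,1)] assms(1)]
  by (simp add: L2norm_minus_commute[of u v] abs_le_iff)

lemma L2norm_cong_AE:
  assumes "u \<in> borel_measurable (lebesgue_on Omega)" "v \<in> borel_measurable (lebesgue_on Omega)"
    "AE x in lebesgue_on Omega. u x = v x"
  shows "L2norm u = L2norm v"
  unfolding L2norm_def
  by (intro arg_cong[where f=sqrt] integral_cong_AE) (use assms in auto)

lemma L2norm_tendsto:
  assumes "\<And>m. u m \<in> L2" "v \<in> L2" "(\<lambda>m. L2norm (\<lambda>x. u m x - v x)) \<longlonglongrightarrow> 0"
  shows "(\<lambda>m. L2norm (u m)) \<longlonglongrightarrow> L2norm v"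
proof (rule LIM_zero_cancel, rule Lim_null_comparison[OF _ assms(3)])
  show "\<forall>\<^sub>F m in sequentially. norm (L2norm (u m) - L2norm v) \<le> L2norm (\<lambda>x. u m x - v x)"
    using L2norm_reverse_triangle[OF assms(1,2)] by simp
qed

lemma L2_integral_tendsto:
  assumes "\<And>m. u m \<in> L2" "v \<in> L2" "w \<in> L2" "(\<lambda>m. L2norm (\<lambda>x. u m x - v x)) \<longlonglongrightarrow> 0"
  shows "(\<lambda>m. LINT x|lebesgue_on Omega. u m x * w x) \<longlonglongrightarrow> (LINT x|lebesgue_on Omega. v x * w x)"
proof (rule LIM_zero_cancel, rule Lim_null_comparison)
  show "(\<lambda>m. L2norm (\<lambda>x. u m x - v x) * L2norm w) \<longlonglongrightarrow> 0"
    using tendsto_mult_left_zero[OF assms(4)] .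
  have "cmod ((LINT x|lebesgue_on Omega. u m x * w x) - (LINT x|lebesgue_on Omega. v x * w x))
      \<le> L2norm (\<lambda>x. u m x - v x) * L2norm w" for m
    using L2_Cauchy_Schwarz[OF L2_diff[OF assms(1,2)] assms(3), of m] assms(1-3)
    by (simp add: left_diff_distrib L2_mult_integrable)
  then show "\<forall>\<^sub>F m in sequentially. norm ((LINT x|lebesgue_on Omega. u m x * w x) -
      (LINT x|lebesgue_on Omega. v x * w x)) \<le> L2norm (\<lambda>x. u m x - v x) * L2norm w"
    by simp
qed

lemma L2_dominated_convergence:
  fixes u :: "nat \<Rightarrow> 'n::finite cfun"
  assumes "\<And>m. u m \<in> borel_measurable (lebesgue_on Omega)" "v \<in> borel_measurable (lebesgue_on Omega)"
    "\<And>m x. x \<in> Omega \<Longrightarrow> cmod (u m x) \<le> B" "\<And>x. x \<in> Omega \<Longrightarrow> (\<lambda>m. u m x) \<longlonglongrightarrow> v x"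
  shows "(\<lambda>m. L2norm (\<lambda>x. u m x - v x)) \<longlonglongrightarrow> 0"
proof -
  interpret finite_measure "lebesgue_on Omega" by simp
  note [measurable] = assms(1,2)
  have vB: "cmod (v x) \<le> B" if "x \<in> Omega" for x
    using LIMSEQ_le_const2[OF tendsto_norm[OF assms(4)[OF that]]] assms(3)[OF that] by blast
  have "(\<lambda>m. LINT x|lebesgue_on Omega. (cmod (u m x - v x))\<^sup>2) \<longlonglongrightarrow> (LINT x|lebesgue_on (Omega :: (real^'n) set). 0)"
  proof (rule integral_dominated_convergence[where w="\<lambda>_::real^'n. (2*B)\<^sup>2"])
    show "AE x in lebesgue_on Omega. (\<lambda>m. (cmod (u m x - v x))\<^sup>2) \<longlonglongrightarrow> 0"
    proof (rule AE_I2)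
      fix x :: "real^'n" assume "x \<in> space (lebesgue_on Omega)"
      then have "(\<lambda>m. u m x - v x) \<longlonglongrightarrow> 0"
        using assms(4)[of x] by (simp add: LIM_zero)
      from tendsto_power[OF tendsto_norm[OF this], of 2] show "(\<lambda>m. (cmod (u m x - v x))\<^sup>2) \<longlonglongrightarrow> 0"
        by simp
    qed
    show "AE x in lebesgue_on Omega. norm ((cmod (u m x - v x))\<^sup>2) \<le> (2*B)\<^sup>2" for m
    proof (rule AE_I2)
      fix x :: "real^'n" assume "x \<in> space (lebesgue_on Omega)"
      then have x: "x \<in> Omega" by simp
      have "cmod (u m x - v x) \<le> 2 * B"
        using norm_triangle_ineq4[of "u m x" "v x"] assms(3)[OF x, of m] vB[OF x] by linarith
      then show "norm ((cmod (u m x - v x))\<^sup>2) \<le> (2*B)\<^sup>2"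
        by (metis norm_ge_zero norm_power real_norm_def abs_norm_cancel power_mono)
    qed
  qed auto
  from tendsto_real_sqrt[OF this] show ?thesis by (simp add: L2norm_def)
qed

text \<open>
  A subsequence with \<open>L2norm\<close>-increments below \<open>2\<^sup>-\<^sup>k\<close> has summable increments in \<open>L\<^sup>1\<close>, because
  the cube has measure 1; hence it converges almost everywhere. Fatou's lemma then bounds the
  distance of the whole sequence to the pointwise limit.
\<close>

lemma L2_complete:
  fixes u :: "nat \<Rightarrow> 'n::finite cfun"
  assumes L: "\<And>m. u m \<in> L2"
    and C: "\<And>e. e > 0 \<Longrightarrow> \<exists>K. \<forall>m\<ge>K. \<forall>l\<ge>K. L2norm (\<lambda>x. u m x - u l x) < e"
  shows "\<exists>v\<in>L2. (\<lambda>m. L2norm (\<lambda>x. u m x - v x)) \<longlonglongrightarrow> 0"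
proof -
  let ?M = "lebesgue_on (Omega :: (real^'n) set)"
  interpret finite_measure ?M by simp
  note [measurable] = L2D(1)[OF L]
  have one: "(\<lambda>_::real^'n. 1) \<in> L2" by (rule L2_bounded[of _ 1]) auto
  have one': "L2norm (\<lambda>_::real^'n. 1) = 1"
    using prob_Omega by (simp add: L2norm_def measure_def)
  have "\<forall>k. \<exists>K. \<forall>m\<ge>K. \<forall>l\<ge>K. L2norm (\<lambda>x. u m x - u l x) < (1/2)^k"
    using C by simp
  then obtain K where K: "\<And>k m l. m \<ge> K k \<Longrightarrow> l \<ge> K k \<Longrightarrow> L2norm (\<lambda>x. u m x - u l x) < (1/2)^k"
    by metis
  \<comment> \<open>Adding \<open>k\<close> makes the subsequence exceed every prescribed index.\<close>
  define s where "s k = k + (\<Sum>j\<le>k. K j)" for k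
  have sK: "s k \<ge> K k" for k
    unfolding s_def using member_le_sum[of k "{..k}" K] by simp
  have sS: "s k \<le> s (Suc k)" for k by (simp add: s_def)
  define d where "d k x = u (s (Suc k)) x - u (s k) x" for k x
  have [measurable]: "d k \<in> borel_measurable ?M" for k unfolding d_def by measurable
  have dL: "d k \<in> L2" for k unfolding d_def by (intro L2_diff L)
  have dn: "(\<integral>\<^sup>+x. ennreal (cmod (d k x)) \<partial>?M) \<le> ennreal ((1/2)^k)" for k
  proof -
    have "(\<integral>\<^sup>+x. ennreal (cmod (d k x)) \<partial>?M) = ennreal (LINT x|?M. cmod (d k x))"
      using L2_integrable[OF dL] by (simp add: nn_integral_eq_integral)
    also have "(LINT x|?M. cmod (d k x)) \<le> L2norm (d k)"
      using L2_Cauchy_Schwarz_abs[OF dL one, of k] one' by simp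
    also have "L2norm (d k) \<le> (1/2)^k"
      using K[of k "s (Suc k)" "s k"] sK[of k] sS[of k] by (simp add: d_def[abs_def] less_imp_le)
    finally show ?thesis by (simp add: ennreal_leI)
  qed
  have "(\<integral>\<^sup>+x. (\<Sum>k. ennreal (cmod (d k x))) \<partial>?M) = (\<Sum>k. \<integral>\<^sup>+x. ennreal (cmod (d k x)) \<partial>?M)"
    by (rule nn_integral_suminf) simp
  also have "\<dots> \<le> (\<Sum>k. ennreal ((1/2)^k))"
    by (intro suminf_le dn) auto
  also have "\<dots> = ennreal (\<Sum>k. (1/2)^k)"
    by (rule suminf_ennreal2) (auto intro: summable_geometric)
  also have "\<dots> < \<infinity>" by simp
  finally have "AE x in ?M. (\<Sum>k. ennreal (cmod (d k x))) \<noteq> \<infinity>"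
    by (intro nn_integral_PInf_AE) auto
  then have conv: "AE x in ?M. convergent (\<lambda>k. u (s k) x)"
  proof (rule AE_mp, intro AE_I2 impI)
    fix x assume "(\<Sum>k. ennreal (cmod (d k x))) \<noteq> \<infinity>"
    then have "summable (\<lambda>k. cmod (d k x))"
      by (intro summable_suminf_not_top) (auto simp: top_ennreal_def)
    then have "summable (\<lambda>k. d k x)" by (rule summable_norm_cancel)
    then have "convergent (\<lambda>n. \<Sum>k<n. d k x)" by (simp add: summable_iff_convergent)
    then have "convergent (\<lambda>n. u (s n) x - u (s 0) x)"
      unfolding d_def using sum_lessThan_telescope[of "\<lambda>k. u (s k) x"] by simp
    then have "convergent (\<lambda>n. (u (s n) x - u (s 0) x) + u (s 0) x)"
      by (intro convergent_add convergent_const)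
    then show "convergent (\<lambda>k. u (s k) x)" by simp
  qed
  define v where "v x = lim (\<lambda>k. u (s k) x)" for x
  have [measurable]: "v \<in> borel_measurable ?M" unfolding v_def by measurable
  have lim: "AE x in ?M. (\<lambda>k. u (s k) x) \<longlonglongrightarrow> v x"
    using conv by eventually_elim (simp add: v_def convergent_LIMSEQ_iff)
  have Fatou: "(\<integral>\<^sup>+x. ennreal ((cmod (u m x - v x))\<^sup>2) \<partial>?M) \<le> ennreal (e\<^sup>2)"
    if "e > 0" and mK: "\<And>l. l \<ge> N \<Longrightarrow> L2norm (\<lambda>x. u m x - u l x) < e" for m e N
  proof -
    have "(\<integral>\<^sup>+x. ennreal ((cmod (u m x - v x))\<^sup>2) \<partial>?M)
        = (\<integral>\<^sup>+x. liminf (\<lambda>k. ennreal ((cmod (u m x - u (s k) x))\<^sup>2)) \<partial>?M)"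
    proof (rule nn_integral_cong_AE, use lim in eventually_elim)
      fix x assume "(\<lambda>k. u (s k) x) \<longlonglongrightarrow> v x"
      then have "(\<lambda>k. ennreal ((cmod (u m x - u (s k) x))\<^sup>2)) \<longlonglongrightarrow> ennreal ((cmod (u m x - v x))\<^sup>2)"
        by (intro tendsto_ennrealI tendsto_intros)
      then show "ennreal ((cmod (u m x - v x))\<^sup>2) = liminf (\<lambda>k. ennreal ((cmod (u m x - u (s k) x))\<^sup>2))"
        using lim_imp_Liminf[OF sequentially_bot] by metis
    qed
    also have "\<dots> \<le> liminf (\<lambda>k. \<integral>\<^sup>+x. ennreal ((cmod (u m x - u (s k) x))\<^sup>2) \<partial>?M)"
      by (rule nn_integral_liminf) simp
    also have "\<dots> \<le> ennreal (e\<^sup>2)"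
    proof (rule Liminf_le)
      have "(\<integral>\<^sup>+x. ennreal ((cmod (u m x - u (s k) x))\<^sup>2) \<partial>?M) \<le> ennreal (e\<^sup>2)" if "k \<ge> N" for k
      proof -
        have "s k \<ge> N" using that by (simp add: s_def)
        then have "L2norm (\<lambda>x. u m x - u (s k) x) \<le> e" using mK by (simp add: less_imp_le)
        then show ?thesis
          by (subst nn_integral_eq_integral)
             (auto simp: L2norm_sq[symmetric] intro!: L2D L2_diff L ennreal_leI power_mono)
      qed
      then show "\<forall>\<^sub>F k in sequentially. (\<integral>\<^sup>+x. ennreal ((cmod (u m x - u (s k) x))\<^sup>2) \<partial>?M) \<le> ennreal (e\<^sup>2)"
        unfolding eventually_sequentially by blast
    qed simp
    finally show ?thesis .
  qed
  have diffL: "(\<lambda>x. u m x - v x) \<in> L2 \<and> L2norm (\<lambda>x. u m x - v x) \<le> e"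
    if "e > 0" and mK: "\<And>l. l \<ge> N \<Longrightarrow> L2norm (\<lambda>x. u m x - u l x) < e" for m e N
  proof
    have F: "(\<integral>\<^sup>+x. ennreal ((cmod (u m x - v x))\<^sup>2) \<partial>?M) \<le> ennreal (e\<^sup>2)"
      using Fatou[of e N m] that by blast
    have "integrable ?M (\<lambda>x. (cmod (u m x - v x))\<^sup>2)"
      using le_less_trans[OF F] by (intro integrableI_bounded) auto
    then show L': "(\<lambda>x. u m x - v x) \<in> L2" by (simp add: L2_def)
    have "ennreal ((L2norm (\<lambda>x. u m x - v x))\<^sup>2) \<le> ennreal (e\<^sup>2)"
      using F L2norm_nn[OF L'] by (simp add: ennreal_power)
    then have "(L2norm (\<lambda>x. u m x - v x))\<^sup>2 \<le> e\<^sup>2" by simp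
    then show "L2norm (\<lambda>x. u m x - v x) \<le> e"
      by (rule power2_le_imp_le) (use \<open>e > 0\<close> in simp)
  qed
  have vL: "v \<in> L2"
  proof -
    have "(\<lambda>x. u (K 0) x - v x) \<in> L2"
      using diffL[of 1 "K 0" "K 0"] K[of 0 "K 0"] by simp
    from L2_diff[OF L[of "K 0"] this] show ?thesis by simp
  qed
  moreover have "(\<lambda>m. L2norm (\<lambda>x. u m x - v x)) \<longlonglongrightarrow> 0"
  proof (rule LIMSEQ_I)
    fix r :: real assume "r > 0"
    then obtain N where N: "\<And>m l. m \<ge> N \<Longrightarrow> l \<ge> N \<Longrightarrow> L2norm (\<lambda>x. u m x - u l x) < r/2"
      using C[of "r/2"] by auto
    have "norm (L2norm (\<lambda>x. u m x - v x) - 0) < r" if "m \<ge> N" for m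
      using diffL[of "r/2" N m] N[OF that] \<open>r > 0\<close> by fastforce
    then show "\<exists>N. \<forall>m\<ge>N. norm (L2norm (\<lambda>x. u m x - v x) - 0) < r" by blast
  qed
  ultimately show ?thesis by blast
qed

section \<open>A smooth cut-off on the unit interval\<close>

primrec times_diff :: "nat \<Rightarrow> (real \<Rightarrow> real) \<Rightarrow> bool" where
  "times_diff 0 f \<longleftrightarrow> True"
| "times_diff (Suc m) f \<longleftrightarrow> (\<exists>f'. (\<forall>t. (f has_real_derivative f' t) (at t)) \<and> times_diff m f')"

definition smooth :: "(real \<Rightarrow> real) \<Rightarrow> bool" where
  "smooth f \<longleftrightarrow> (\<forall>m. times_diff m f)"

lemma times_diff_SucI:
  "(\<And>t. (f has_real_derivative f' t) (at t)) \<Longrightarrow> times_diff m f' \<Longrightarrow> times_diff (Suc m) f"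
  by auto

lemma times_diff_SucE:
  assumes "times_diff (Suc m) f"
  obtains f' where "\<And>t. (f has_real_derivative f' t) (at t)" "times_diff m f'"
  using assms by auto

lemma times_diff_SucD: "times_diff (Suc m) f \<Longrightarrow> times_diff m f"
proof (induction m arbitrary: f)
  case (Suc m)
  obtain f' where f': "\<And>t. (f has_real_derivative f' t) (at t)" "times_diff (Suc m) f'"
    by (rule times_diff_SucE[OF Suc.prems]) (rule that)
  show ?case by (rule times_diff_SucI[OF f'(1) Suc.IH[OF f'(2)]])
qed simp

lemma times_diff_add: "times_diff m f \<Longrightarrow> times_diff m g \<Longrightarrow> times_diff m (\<lambda>t. f t + g t)"
proof (induction m arbitrary: f g)
  case (Suc m)
  obtain f' where f': "\<And>t. (f has_real_derivative f' t) (at t)" "times_diff m f'"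
    by (rule times_diff_SucE[OF Suc.prems(1)]) (rule that)
  obtain g' where g': "\<And>t. (g has_real_derivative g' t) (at t)" "times_diff m g'"
    by (rule times_diff_SucE[OF Suc.prems(2)]) (rule that)
  show ?case by (rule times_diff_SucI[OF DERIV_add[OF f'(1) g'(1)] Suc.IH[OF f'(2) g'(2)]])
qed simp

lemma times_diff_mult: "times_diff m f \<Longrightarrow> times_diff m g \<Longrightarrow> times_diff m (\<lambda>t. f t * g t)"
proof (induction m arbitrary: f g)
  case (Suc m)
  obtain f' where f': "\<And>t. (f has_real_derivative f' t) (at t)" "times_diff m f'"
    by (rule times_diff_SucE[OF Suc.prems(1)]) (rule that)
  obtain g' where g': "\<And>t. (g has_real_derivative g' t) (at t)" "times_diff m g'"
    by (rule times_diff_SucE[OF Suc.prems(2)]) (rule that)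
  have "times_diff m (\<lambda>t. f' t * g t + g' t * f t)"
    by (rule times_diff_add[OF Suc.IH[OF f'(2) times_diff_SucD[OF Suc.prems(2)]]
          Suc.IH[OF g'(2) times_diff_SucD[OF Suc.prems(1)]]])
  then show ?case by (rule times_diff_SucI[OF DERIV_mult[OF f'(1) g'(1)]])
qed simp

lemma times_diff_const: "times_diff m (\<lambda>t. c)"
proof (induction m arbitrary: c)
  case (Suc m)
  show ?case
    unfolding times_diff.simps(2)
    by (rule exI[of _ "\<lambda>t. 0"]) (auto intro!: Suc derivative_eq_intros)
qed simp

lemma times_diff_affine: "times_diff m f \<Longrightarrow> times_diff m (\<lambda>t. f (a * t + b))"
proof (induction m arbitrary: f)
  case (Suc m)
  then obtain f' where d: "\<forall>t. (f has_real_derivative f' t) (at t)" "times_diff m f'" by auto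
  have "((\<lambda>t. f (a * t + b)) has_real_derivative f' (a * t + b) * a) (at t)" for t
    by (rule DERIV_chain2[of f]) (use d in \<open>auto intro!: derivative_eq_intros\<close>)
  moreover have "times_diff m (\<lambda>t. f' (a * t + b) * a)"
    by (intro times_diff_mult times_diff_const Suc.IH d)
  ultimately show ?case unfolding times_diff.simps(2)
    by (intro exI[of _ "\<lambda>t. f' (a * t + b) * a"]) auto
qed simp

lemma times_diff_sin_cos: "times_diff m sin \<and> times_diff m cos"
proof (induction m)
  case (Suc m)
  have "times_diff m (\<lambda>t. (-1) * sin t)" by (intro times_diff_mult times_diff_const conjunct1[OF Suc])
  moreover have "(cos has_real_derivative (-1) * sin t) (at t)" for t :: real
    using DERIV_cos[of t] by simp
  ultimately have "times_diff (Suc m) cos"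
    unfolding times_diff.simps(2) by (intro exI[of _ "\<lambda>t. (-1) * sin t"] conjI allI)
  moreover have "times_diff (Suc m) sin"
    unfolding times_diff.simps(2) by (intro exI[of _ cos] conjI allI DERIV_sin conjunct2[OF Suc])
  ultimately show ?case by blast
qed simp

lemma smooth_mult: "smooth f \<Longrightarrow> smooth g \<Longrightarrow> smooth (\<lambda>t. f t * g t)"
  unfolding smooth_def by (intro allI times_diff_mult) auto

lemma smooth_affine: "smooth f \<Longrightarrow> smooth (\<lambda>t. f (a * t + b))"
  unfolding smooth_def by (intro allI times_diff_affine) auto

lemma smooth_sin: "smooth sin"
  by (simp add: smooth_def times_diff_sin_cos)

lemma smooth_has_deriv: "smooth f \<Longrightarrow> (f has_real_derivative deriv f t) (at t)"
proof -
  assume "smooth f"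
  then have "times_diff (Suc 0) f" unfolding smooth_def ..
  then obtain f' where "\<forall>t. (f has_real_derivative f' t) (at t)" by auto
  then show ?thesis using DERIV_imp_deriv by metis
qed

lemma smooth_deriv: assumes "smooth f" shows "smooth (deriv f)"
  unfolding smooth_def
proof
  fix m
  obtain f' where d: "\<forall>t. (f has_real_derivative f' t) (at t)" "times_diff m f'"
    using assms[unfolded smooth_def, rule_format, of "Suc m"] by auto
  then have "deriv f = f'" by (auto intro: DERIV_imp_deriv)
  with d show "times_diff m (deriv f)" by simp
qed

lemma smooth_continuous: "smooth f \<Longrightarrow> continuous_on S f"
  by (intro continuous_at_imp_continuous_on ballI DERIV_isCont[OF smooth_has_deriv])

text \<open>
  The family of all derivatives of the flat function \<open>exp (- 1 / t)\<close>: it is closed under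
  differentiation, which makes each member smooth.
\<close>

definition flat_poly :: "real poly \<Rightarrow> real \<Rightarrow> real" where
  "flat_poly p t = (if t > 0 then poly p (1 / t) * exp (- (1 / t)) else 0)"

definition flat :: "real \<Rightarrow> real" where "flat = flat_poly 1"

lemma tendsto_poly_exp: "((\<lambda>y. poly p y * exp (- y)) \<longlongrightarrow> (0::real)) at_top"
proof -
  have "((\<lambda>y. \<Sum>i\<le>degree p. coeff p i * (y ^ i / exp y)) \<longlongrightarrow> (\<Sum>i\<le>degree p. coeff p i * (0::real))) at_top"
    by (intro tendsto_intros tendsto_power_div_exp_0)
  moreover have "(\<lambda>y. \<Sum>i\<le>degree p. coeff p i * (y ^ i / exp y)) = (\<lambda>y. poly p y * exp (- y))"
    by (simp add: poly_altdef sum_distrib_right exp_minus divide_inverse mult.assoc)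
  ultimately show ?thesis by simp
qed

text \<open>
  With \<open>y = 1 / t\<close> one has \<open>d/dt = - y\<^sup>2 d/dy\<close>, whence the factor \<open>[:0,0,1:]\<close>. At the origin the
  difference quotient is again of the form polynomial times \<open>exp (- y)\<close> with \<open>y\<close> tending to infinity.
\<close>

lemma flat_poly_deriv:
  "(flat_poly p has_real_derivative flat_poly ([:0,0,1:] * (p - pderiv p)) t) (at t)"
proof (cases t "0::real" rule: linorder_cases)
  case less
  have "((\<lambda>_. 0) has_real_derivative 0) (at t)" by simp
  then have "(flat_poly p has_real_derivative 0) (at t)"
    by (rule has_field_derivative_transform_within_open[of _ _ _ "{..<0}"])
       (use less in \<open>auto simp: flat_poly_def\<close>)
  then show ?thesis using less by (simp add: flat_poly_def)
next
  case greater
  have "((\<lambda>t. poly p (1 / t) * exp (- (1 / t))) has_real_derivative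
     poly (pderiv p) (1/t) * (- (1 / t\<^sup>2)) * exp (- (1 / t)) + poly p (1/t) * (exp (- (1 / t)) * (1 / t\<^sup>2))) (at t)"
    using greater by (auto intro!: derivative_eq_intros simp: power2_eq_square)
  also have "poly (pderiv p) (1/t) * (- (1 / t\<^sup>2)) * exp (- (1 / t)) + poly p (1/t) * (exp (- (1 / t)) * (1 / t\<^sup>2))
     = flat_poly ([:0,0,1:] * (p - pderiv p)) t"
    using greater by (simp add: flat_poly_def power2_eq_square algebra_simps)
  finally show ?thesis
    by (rule has_field_derivative_transform_within_open[of _ _ _ "{0<..}"])
       (use greater in \<open>auto simp: flat_poly_def\<close>)
next
  case equal
  have "((\<lambda>h. poly [:0,1:] (inverse h) * poly p (inverse h) * exp (- inverse h)) \<longlongrightarrow> (0::real)) (at_right 0)"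
    using filterlim_compose[OF tendsto_poly_exp[of "[:0,1:] * p"] filterlim_inverse_at_top_right]
    by (simp add: mult.assoc)
  then have "((\<lambda>h. (flat_poly p h - flat_poly p 0) / h) \<longlongrightarrow> 0) (at_right 0)"
    by (rule filterlim_cong[THEN iffD1, rotated -1, OF _ refl refl])
       (auto simp: eventually_at_filter flat_poly_def field_simps)
  moreover have "((\<lambda>h. (flat_poly p h - flat_poly p 0) / h) \<longlongrightarrow> 0) (at_left 0)"
    by (rule tendsto_eventually) (auto simp: eventually_at_filter flat_poly_def)
  ultimately have "((\<lambda>h. (flat_poly p h - flat_poly p 0) / h) \<longlongrightarrow> 0) (at 0)"
    by (simp add: filterlim_at_split)
  then show ?thesis using equal by (simp add: DERIV_def flat_poly_def)
qed

lemma smooth_flat: "smooth flat"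
proof -
  have "times_diff m (flat_poly p)" for m p
    by (induction m arbitrary: p) (use flat_poly_deriv in \<open>auto\<close>)
  then show ?thesis by (simp add: smooth_def flat_def)
qed

lemma deriv_flat: "deriv flat = flat_poly [:0,0,1:]"
  using flat_poly_deriv[of 1] by (auto simp: flat_def intro!: DERIV_imp_deriv)

lemma flat_bounds: "0 \<le> flat t" "flat t \<le> 1"
  by (auto simp: flat_def flat_poly_def)

lemma flat_eq_0: "t \<le> 0 \<Longrightarrow> flat t = 0"
  by (simp add: flat_def flat_poly_def)

text \<open>
  As \<open>m\<close> grows, \<open>cut m\<close> increases to 1 on the open unit interval, while its support stays at
  distance \<open>1 / m\<close> from the end points. Convergence is only pointwise.
\<close>

definition cut :: "nat \<Rightarrow> real \<Rightarrow> real" where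
  "cut m t = flat (real m * t - 1) * flat (real m * (1 - t) - 1)"

lemma smooth_cut: "smooth (cut m)"
proof -
  have "cut m = (\<lambda>t. flat (real m * t + (-1)) * flat ((- real m) * t + (real m - 1)))"
    by (auto simp: cut_def algebra_simps)
  then show ?thesis by (simp only:) (intro smooth_mult smooth_affine smooth_flat)
qed

lemma cut_bounds: "0 \<le> cut m t" "cut m t \<le> 1"
  by (auto simp: cut_def flat_bounds intro!: mult_le_one)

lemma cut_eq_0:
  assumes "m > 0" "cut m t \<noteq> 0" shows "1 / m < t" "t < 1 - 1 / m"
proof -
  from assms have "real m * t - 1 > 0" "real m * (1 - t) - 1 > 0"
    unfolding cut_def by (metis flat_eq_0 mult_zero_left mult_zero_right not_le)+
  with assms show "1 / m < t" "t < 1 - 1 / m" by (simp_all add: field_simps)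
qed

lemma deriv_cut:
  "(cut m has_real_derivative m * deriv flat (real m * t - 1) * flat (real m * (1 - t) - 1)
      - flat (real m * t - 1) * (m * deriv flat (real m * (1 - t) - 1))) (at t)"
proof -
  have 1: "((\<lambda>t. flat (real m * t - 1)) has_real_derivative deriv flat (real m * t - 1) * m) (at t)"
    by (rule DERIV_chain2[OF smooth_has_deriv[OF smooth_flat]]) (auto intro!: derivative_eq_intros)
  have 2: "((\<lambda>t. flat (real m * (1 - t) - 1)) has_real_derivative deriv flat (real m * (1 - t) - 1) * (- m)) (at t)"
    by (rule DERIV_chain2[OF smooth_has_deriv[OF smooth_flat]]) (auto intro!: derivative_eq_intros)
  show ?thesis unfolding cut_def[abs_def]
    by (rule DERIV_cong[OF DERIV_mult[OF 1 2]]) (simp add: algebra_simps)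
qed

text \<open>
  At \<open>s = m t - 1\<close> the second bound reads \<open>m t flat' (m t - 1) \<le> 3\<close>: the derivative of the cut-off
  blows up no faster than the inverse distance to the end point, where a sine vanishes linearly.
\<close>

lemma deriv_flat_bound: "0 \<le> deriv flat s" "(s + 1) * deriv flat s \<le> 3"
proof -
  show "0 \<le> deriv flat s" by (simp add: deriv_flat flat_poly_def)
  show "(s + 1) * deriv flat s \<le> 3"
  proof (cases "s > 0")
    case True
    define y where "y = 1 / s"
    have y: "y > 0" using True by (simp add: y_def)
    have "1 + y + y\<^sup>2 / 2 \<le> exp y" using exp_lower_Taylor_quadratic[of y] y by simp
    then have "y + y\<^sup>2 \<le> 3 * exp y" using y zero_le_power2[of y] by linarith
    then have "(y + y\<^sup>2) * exp (-y) \<le> 3" by (simp add: exp_minus field_simps)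
    moreover have "(s + 1) * deriv flat s = (y + y\<^sup>2) * exp (-y)"
      using True by (simp add: deriv_flat flat_poly_def y_def field_simps power2_eq_square)
    ultimately show ?thesis by simp
  qed (simp add: deriv_flat flat_poly_def)
qed

lemma cut_tendsto:
  assumes "0 < t" "t < 1"
  shows "(\<lambda>m. cut m t) \<longlonglongrightarrow> 1"
proof -
  have *: "(\<lambda>m. flat (real m * s - 1)) \<longlonglongrightarrow> 1" if "s > 0" for s
  proof -
    have "(\<lambda>m. exp (- (1 / (real m * s - 1)))) \<longlonglongrightarrow> 1" using that by real_asymp
    moreover have "\<forall>\<^sub>F m in sequentially. real m > 1 / s"
      by (rule eventually_mono[OF eventually_gt_at_top[of "nat \<lceil>1/s\<rceil>"]]) linarith
    then have "\<forall>\<^sub>F m in sequentially. exp (- (1 / (real m * s - 1))) = flat (real m * s - 1)"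
      by eventually_elim (use that in \<open>simp add: flat_def flat_poly_def field_simps\<close>)
    ultimately show ?thesis by (rule Lim_transform_eventually)
  qed
  show ?thesis unfolding cut_def
    using tendsto_mult[OF *[of t] *[of "1 - t"]] assms by simp
qed

lemma deriv_flat_scaled_tendsto:
  assumes "s > 0" shows "(\<lambda>m. real m * deriv flat (real m * s - 1)) \<longlonglongrightarrow> 0"
proof -
  have "(\<lambda>m. real m * (1 / (real m * s - 1))\<^sup>2) \<longlonglongrightarrow> 0" using assms by real_asymp
  then show ?thesis
  proof (rule Lim_null_comparison[rotated], intro always_eventually allI)
    fix m
    show "norm (real m * deriv flat (real m * s - 1)) \<le> real m * (1 / (real m * s - 1))\<^sup>2"
      by (auto simp: deriv_flat flat_poly_def abs_mult power2_eq_square intro!: divide_right_mono mult_left_le)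
  qed
qed

section \<open>Differential calculus of Ck functions\<close>

lemma has_derivative_pderiv_at:
  "f differentiable (at x) \<Longrightarrow> (f has_derivative frechet_derivative f (at x)) (at x)"
  by (simp add: frechet_derivative_works)

lemma pderiv_at_eq:
  "(\<And>x. (f has_derivative f' x) (at x)) \<Longrightarrow> pderiv_at i f = (\<lambda>x. f' x (axis i 1))"
  unfolding pderiv_at_def by (metis frechet_derivative_at)

lemma Ck_SucI:
  assumes "\<And>x. (f has_derivative f' x) (at x)" "\<And>i. Ck m (\<lambda>x. f' x (axis i 1))"
  shows "Ck (Suc m) f"
  using assms by (auto simp: pderiv_at_eq[OF assms(1)] differentiable_def)

lemma Ck_Suc_has_derivative:
  "Ck (Suc m) f \<Longrightarrow> (f has_derivative frechet_derivative f (at x)) (at x)"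
  by (simp add: has_derivative_pderiv_at)

lemma Ck_Suc_continuous: "Ck (Suc m) f \<Longrightarrow> continuous_on S f"
  by (simp add: differentiable_imp_continuous_within continuous_at_imp_continuous_on)

lemma Ck_Suc_pderiv: "Ck (Suc m) f \<Longrightarrow> Ck m (pderiv_at i f)"
  by simp

lemma pderiv_at_add:
  assumes "Ck (Suc m) f" "Ck (Suc m) g"
  shows "pderiv_at i (\<lambda>x. f x + g x) = (\<lambda>x. pderiv_at i f x + pderiv_at i g x)"
  by (subst pderiv_at_eq[OF has_derivative_add[OF Ck_Suc_has_derivative[OF assms(1)] Ck_Suc_has_derivative[OF assms(2)]]])
     (simp add: pderiv_at_def)

lemma pderiv_at_cmult:
  assumes "Ck (Suc m) f"
  shows "pderiv_at i (\<lambda>x. c * f x) = (\<lambda>x. c * pderiv_at i f x)"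
  by (subst pderiv_at_eq[OF has_derivative_mult_right[OF Ck_Suc_has_derivative[OF assms(1)]]])
     (simp add: pderiv_at_def)

lemma pderiv_at_mult:
  assumes "Ck (Suc m) f" "Ck (Suc m) g"
  shows "pderiv_at i (\<lambda>x. f x * g x) = (\<lambda>x. f x * pderiv_at i g x + pderiv_at i f x * g x)"
  by (subst pderiv_at_eq[OF has_derivative_mult[OF Ck_Suc_has_derivative[OF assms(1)] Ck_Suc_has_derivative[OF assms(2)]]])
     (simp add: pderiv_at_def)

lemma pderiv_at_cnj:
  assumes "Ck (Suc m) f"
  shows "pderiv_at i (\<lambda>x. cnj (f x)) = (\<lambda>x. cnj (pderiv_at i f x))"
  by (subst pderiv_at_eq[OF has_derivative_cnj[OF Ck_Suc_has_derivative[OF assms(1)]]])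
     (simp add: pderiv_at_def)

lemma Ck_add: "Ck m f \<Longrightarrow> Ck m g \<Longrightarrow> Ck m (\<lambda>x. f x + g x)"
proof (induction m arbitrary: f g)
  case (Suc m)
  have "Ck m (pderiv_at i (\<lambda>x. f x + g x))" for i
    unfolding pderiv_at_add[OF Suc.prems] by (intro Suc.IH Ck_Suc_pderiv Suc.prems)
  with Suc.prems show ?case by simp
qed (simp add: continuous_on_add)

lemma Ck_cmult: "Ck m f \<Longrightarrow> Ck m (\<lambda>x. c * f x)"
proof (induction m arbitrary: f)
  case (Suc m)
  have "Ck m (pderiv_at i (\<lambda>x. c * f x))" for i
    unfolding pderiv_at_cmult[OF Suc.prems] by (intro Suc.IH Ck_Suc_pderiv Suc.prems)
  with Suc.prems show ?case by simp
qed (simp add: continuous_on_mult_left)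

lemma C1_mult:
  assumes "Ck (Suc 0) f" "Ck (Suc 0) g" shows "Ck (Suc 0) (\<lambda>x. f x * g x)"
proof -
  have "continuous_on UNIV (\<lambda>x. f x * pderiv_at i g x + pderiv_at i f x * g x)" for i
    using assms Ck_Suc_continuous[OF assms(1)] Ck_Suc_continuous[OF assms(2)]
    by (intro continuous_intros) auto
  with assms show ?thesis by (auto simp: pderiv_at_mult[OF assms])
qed

lemma C1_cnj:
  assumes "Ck (Suc 0) f" shows "Ck (Suc 0) (\<lambda>x. cnj (f x))"
  unfolding Ck.simps
proof (intro conjI allI)
  fix x i
  show "(\<lambda>x. cnj (f x)) differentiable at x"
    using has_derivative_cnj[OF Ck_Suc_has_derivative[OF assms]] by (auto simp: differentiable_def)
  show "continuous_on UNIV (pderiv_at i (\<lambda>x. cnj (f x)))"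
    unfolding pderiv_at_cnj[OF assms] using assms by (intro continuous_intros) auto
qed

section \<open>Products of functions of one variable\<close>

definition separable :: "('n::finite \<Rightarrow> real \<Rightarrow> real) \<Rightarrow> 'n cfun" where
  "separable a x = of_real (\<Prod>i\<in>UNIV. a i (x $ i))"

text \<open>
  Partial derivatives of a product of one-variable functions are again of that form, with one factor
  differentiated; smoothness of all orders and formulas for iterated derivatives follow from this.
\<close>

lemma separable_has_derivative:
  assumes "\<And>i. smooth (a i)"
  shows "(separable a has_derivative (\<lambda>h. \<Sum>i\<in>UNIV. of_real (h $ i) * separable (a(i := deriv (a i))) x)) (at x)"
proof -
  have 1: "((\<lambda>x. a i (x $ i)) has_derivative (\<lambda>h. deriv (a i) (x $ i) * h $ i)) (at x)" for i
  proof -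
    have "((\<lambda>x. x $ i) has_derivative (\<lambda>h. h $ i)) (at x)"
      by (rule bounded_linear.has_derivative[OF bounded_linear_vec_nth has_derivative_ident])
    moreover have "(a i has_derivative (\<lambda>t. deriv (a i) (x $ i) * t)) (at (x $ i))"
      using smooth_has_deriv[OF assms] by (simp add: has_field_derivative_def)
    ultimately show ?thesis by (rule has_derivative_compose)
  qed
  have "(separable a has_derivative (\<lambda>h. of_real (\<Sum>i\<in>UNIV. (deriv (a i) (x $ i) * h $ i) * (\<Prod>j\<in>UNIV - {i}. a j (x $ j))))) (at x)"
    unfolding separable_def[abs_def]
    by (intro has_derivative_of_real has_derivative_prod 1)
  moreover have "(\<lambda>h. of_real (\<Sum>i\<in>UNIV. (deriv (a i) (x $ i) * h $ i) * (\<Prod>j\<in>UNIV - {i}. a j (x $ j)))) =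
     (\<lambda>h. \<Sum>i\<in>UNIV. of_real (h $ i) * separable (a(i := deriv (a i))) x)"
  proof
    fix h
    have "(\<Prod>j\<in>UNIV. (a(i := deriv (a i))) j (x $ j)) = deriv (a i) (x $ i) * (\<Prod>j\<in>UNIV - {i}. a j (x $ j))" for i
      by (subst prod.remove[of _ i]) (auto intro!: prod.cong)
    then show "of_real (\<Sum>i\<in>UNIV. (deriv (a i) (x $ i) * h $ i) * (\<Prod>j\<in>UNIV - {i}. a j (x $ j))) =
      (\<Sum>i\<in>UNIV. complex_of_real (h $ i) * separable (a(i := deriv (a i))) x)"
      unfolding separable_def of_real_sum
      by (intro sum.cong refl) (simp add: mult_ac)
  qed
  ultimately show ?thesis by simp
qed

lemma pderiv_separable:
  assumes "\<And>i. smooth (a i)"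
  shows "pderiv_at j (separable a) = separable (a(j := deriv (a j)))"
proof
  fix x
  have "pderiv_at j (separable a) x = (\<Sum>i\<in>UNIV. of_real (axis j 1 $ i) * separable (a(i := deriv (a i))) x)"
    by (simp add: pderiv_at_eq[OF separable_has_derivative[OF assms]])
  also have "\<dots> = (\<Sum>i\<in>UNIV. if j = i then separable (a(i := deriv (a i))) x else 0)"
    by (intro sum.cong) (auto simp: axis_def)
  also have "\<dots> = separable (a(j := deriv (a j))) x" by simp
  finally show "pderiv_at j (separable a) x = separable (a(j := deriv (a j))) x" .
qed

lemma smooth_upd: "(\<And>i. smooth (a i)) \<Longrightarrow> smooth ((a(j := deriv (a j))) i)"
  by (simp add: smooth_deriv)

lemma Ck_separable:
  assumes "\<And>i. smooth (a i)" shows "Ck m (separable a)"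
  using assms
proof (induction m arbitrary: a)
  case 0
  have "continuous_on UNIV (\<lambda>x::real^'a. a i (x $ i))" for i
    by (rule continuous_on_compose2[OF smooth_continuous[OF 0, of UNIV]]) (auto intro: continuous_intros)
  then show ?case by (simp add: separable_def[abs_def] continuous_on_prod continuous_on_of_real)
next
  case (Suc m)
  have "Ck m (pderiv_at j (separable a))" for j
    unfolding pderiv_separable[OF Suc.prems] by (intro Suc.IH smooth_upd Suc.prems)
  moreover have "separable a differentiable at x" for x
    using separable_has_derivative[of a x] Suc.prems by (blast intro: differentiableI)
  ultimately show ?case by simp
qed

section \<open>Test functions\<close>

lemma continuous_imp_Omega_measurable:
  "continuous_on UNIV f \<Longrightarrow> f \<in> borel_measurable (lebesgue_on Omega)"
  for f :: "real^'n::finite \<Rightarrow> 'b::topological_space"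
  by (rule borel_imp_Omega_measurable[OF borel_measurable_continuous_onI])

lemma Omega_subset_cbox: "Omega \<subseteq> cbox 0 (1 :: real^'n::finite)"
  by (auto simp: Omega_def mem_box_cart less_imp_le)

lemma continuous_bounded_Omega:
  fixes g :: "'n::finite cfun"
  assumes "continuous_on UNIV g"
  obtains B where "\<And>x. x \<in> Omega \<Longrightarrow> cmod (g x) \<le> B"
proof -
  have "bounded (g ` cbox 0 1)"
    by (intro compact_imp_bounded compact_continuous_image continuous_on_subset[OF assms]) auto
  then obtain B where "\<forall>y\<in>g ` cbox 0 1. norm y \<le> B" by (auto simp: bounded_iff)
  with Omega_subset_cbox that show ?thesis by blast
qed

lemma continuous_L2:
  assumes "continuous_on UNIV g" shows "g \<in> L2"
proof -
  obtain B where "\<And>x. x \<in> Omega \<Longrightarrow> cmod (g x) \<le> B"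
    by (rule continuous_bounded_Omega[OF assms]) (rule that)
  then show ?thesis by (intro L2_bounded continuous_imp_Omega_measurable assms)
qed

lemma L2_mult_continuous:
  assumes "continuous_on UNIV g" "u \<in> L2" shows "(\<lambda>x. g x * u x) \<in> L2"
proof -
  obtain B where "\<And>x. x \<in> Omega \<Longrightarrow> cmod (g x) \<le> B"
    by (rule continuous_bounded_Omega[OF assms(1)]) (rule that)
  then show ?thesis by (intro L2_mult_bounded continuous_imp_Omega_measurable assms)
qed

lemma test_functionsI:
  assumes "\<And>m. Ck m f" "compact K" "K \<subseteq> Omega" "\<And>x. x \<notin> K \<Longrightarrow> f x = 0"
  shows "f \<in> test_functions"
proof -
  have sub: "closure {x. f x \<noteq> 0} \<subseteq> K"
    using assms(2,4) by (intro closure_minimal compact_imp_closed) auto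
  then have "compact (closure {x. f x \<noteq> 0})"
    using compact_Int_closed[OF assms(2) closed_closure, of "{x. f x \<noteq> 0}"] by (simp add: Int_absorb1)
  with sub assms show ?thesis by (auto simp: test_functions_def)
qed

lemma test_functionsE:
  assumes "f \<in> test_functions"
  obtains K where "compact K" "K \<subseteq> Omega" "\<And>x. x \<notin> K \<Longrightarrow> f x = 0"
  using assms closure_subset[of "{x. f x \<noteq> 0}"] unfolding test_functions_def by blast

lemma test_Ck: "f \<in> test_functions \<Longrightarrow> Ck m f"
  by (simp add: test_functions_def)

lemma test_continuous: "f \<in> test_functions \<Longrightarrow> continuous_on S f"
  by (rule Ck_Suc_continuous[OF test_Ck])

lemma test_add:
  assumes "f \<in> test_functions" "g \<in> test_functions"
  shows "(\<lambda>x. f x + g x) \<in> test_functions"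
proof -
  obtain K where K: "compact K" "K \<subseteq> Omega" "\<And>x. x \<notin> K \<Longrightarrow> f x = 0"
    by (rule test_functionsE[OF assms(1)]) (rule that)
  obtain L where L: "compact L" "L \<subseteq> Omega" "\<And>x. x \<notin> L \<Longrightarrow> g x = 0"
    by (rule test_functionsE[OF assms(2)]) (rule that)
  show ?thesis
    by (rule test_functionsI[of _ "K \<union> L"]) (use K L assms in \<open>auto intro: Ck_add test_Ck compact_Un\<close>)
qed

lemma test_cmult:
  assumes "f \<in> test_functions" shows "(\<lambda>x. c * f x) \<in> test_functions"
proof -
  obtain K where K: "compact K" "K \<subseteq> Omega" "\<And>x. x \<notin> K \<Longrightarrow> f x = 0"
    by (rule test_functionsE[OF assms(1)]) (rule that)
  show ?thesis
    by (rule test_functionsI[of _ K]) (use K assms in \<open>auto intro: Ck_cmult test_Ck\<close>)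
qed

lemma pderiv_at_zero_outside:
  assumes "closed K" "\<And>x. x \<notin> K \<Longrightarrow> f x = 0" "x \<notin> K"
  shows "pderiv_at i f x = 0"
proof -
  have "((\<lambda>_. 0) has_derivative (\<lambda>_. 0)) (at x)" by simp
  then have "(f has_derivative (\<lambda>_. 0)) (at x)"
    by (rule has_derivative_transform_within_open[of _ _ _ _ "- K"]) (use assms in auto)
  then show ?thesis unfolding pderiv_at_def by (metis frechet_derivative_at)
qed

lemma test_pderiv_L2: "f \<in> test_functions \<Longrightarrow> pderiv_at i f \<in> L2"
  using test_Ck[of f "Suc 0"] by (auto intro: continuous_L2)

lemma test_L2: "f \<in> test_functions \<Longrightarrow> f \<in> L2"
  by (intro continuous_L2 test_continuous)

section \<open>Integration by parts\<close>

lemma integral_Omega_eq_lborel: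
  fixes D :: "'n::finite cfun"
  assumes "continuous_on UNIV D" "\<And>x. x \<notin> Omega \<Longrightarrow> D x = 0"
  shows "(LINT x|lebesgue_on Omega. D x) = (LINT x|lborel. D x)"
proof -
  have "(LINT x|lebesgue_on Omega. D x) = (LINT x|lebesgue. indicator Omega x *\<^sub>R D x)"
    by (rule integral_restrict_space) simp
  also have "(\<lambda>x. indicator Omega x *\<^sub>R D x) = D"
    using assms(2) by (auto simp: indicator_def)
  also have "(LINT x|lebesgue. D x) = (LINT x|lborel. D x)"
    using borel_measurable_continuous_onI[OF assms(1)] by (intro integral_completion) simp
  finally show ?thesis .
qed

lemma integrable_lborel_compact_support:
  fixes F :: "'n::finite cfun"
  assumes "continuous_on UNIV F" "compact K" "\<And>x. x \<notin> K \<Longrightarrow> F x = 0"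
  shows "integrable lborel F"
proof -
  have "integrable lborel (\<lambda>x. indicator K x *\<^sub>R F x)"
    by (intro borel_integrable_compact assms(2) continuous_on_subset[OF assms(1)]) auto
  also have "(\<lambda>x. indicator K x *\<^sub>R F x) = F" using assms(3) by (auto simp: indicator_def)
  finally show ?thesis .
qed

text \<open>
  By translation invariance of Lebesgue measure the difference quotients of \<open>F\<close> in direction \<open>i\<close>
  have integral zero. They are bounded by the maximum of the derivative and vanish outside a fixed
  ball, so dominated convergence carries this over to the derivative.
\<close>

lemma divergence_compact_support:
  fixes F :: "'n::finite cfun"
  assumes C: "Ck (Suc 0) F" and K: "compact K" "K \<subseteq> Omega" "\<And>x. x \<notin> K \<Longrightarrow> F x = 0"
  shows "(LINT x|lebesgue_on Omega. pderiv_at i F x) = 0"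
proof -
  define D where "D = pderiv_at i F"
  define e :: "real^'n" where "e = axis i 1"
  define h where "h m = 1 / real (Suc m)" for m
  have h: "0 < h m" "h m \<le> 1" for m by (auto simp: h_def)
  have h0: "h \<longlonglongrightarrow> 0" unfolding h_def by real_asymp
  have e1: "norm e = 1" by (simp add: e_def)
  have contD: "continuous_on UNIV D" using C by (simp add: D_def)
  have contF: "continuous_on S F" for S using C by (rule Ck_Suc_continuous)
  have D0: "D x = 0" if "x \<notin> K" for x
    unfolding D_def by (rule pderiv_at_zero_outside[OF compact_imp_closed[OF K(1)] K(3) that])
  have "bounded (D ` K)"
    by (intro compact_imp_bounded compact_continuous_image continuous_on_subset[OF contD] K) auto
  then obtain B' where B': "\<forall>y\<in>D ` K. norm y \<le> B'" by (auto simp: bounded_iff)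
  define B where "B = max B' 0"
  have B: "cmod (D x) \<le> B" for x
    using B' D0[of x] by (cases "x \<in> K") (auto simp: B_def intro: max.coboundedI1 max.coboundedI2)
  obtain r where r: "K \<subseteq> cball 0 r"
    using compact_imp_bounded[OF K(1)] by (auto simp: bounded_iff subset_iff)
  define q where "q m x = (F (x + h m *\<^sub>R e) - F x) /\<^sub>R h m" for m x
  have der: "(F has_derivative frechet_derivative F (at x)) (at x)" for x
    using C by (rule Ck_Suc_has_derivative)
  have De: "frechet_derivative F (at x) e = D x" for x by (simp add: D_def e_def pderiv_at_def)
  have intF: "integrable lborel F"
    by (rule integrable_lborel_compact_support[OF contF K(1,3)])
  have shift: "integrable lborel (\<lambda>x. F (x + c))" "(LINT x|lborel. F (x + c)) = (LINT x|lborel. F x)" for c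
  proof -
    have "integrable (distr lborel borel ((+) c)) F" using intF by (simp add: lborel_distr_plus)
    then show "integrable lborel (\<lambda>x. F (x + c))"
      by (subst (asm) integrable_distr_eq) (auto simp: add.commute borel_measurable_continuous_onI[OF contF])
    have "(LINT x|lborel. F x) = (LINT x|distr lborel borel ((+) c). F x)" by (simp add: lborel_distr_plus)
    also have "\<dots> = (LINT x|lborel. F (x + c))"
      by (subst integral_distr) (auto simp: add.commute borel_measurable_continuous_onI[OF contF])
    finally show "(LINT x|lborel. F (x + c)) = (LINT x|lborel. F x)" by simp
  qed
  have q0: "(LINT x|lborel. q m x) = 0" for m
    unfolding q_def using shift intF by simp
  have "(\<lambda>m. LINT x|lborel. q m x) \<longlonglongrightarrow> (LINT x|lborel. D x)"
  proof (rule integral_dominated_convergence[where w="\<lambda>x. indicator (cball 0 (r + 1)) x *\<^sub>R B"])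
    show "D \<in> borel_measurable lborel" using borel_measurable_continuous_onI[OF contD] by simp
    have [measurable]: "F \<in> borel_measurable borel" by (rule borel_measurable_continuous_onI[OF contF])
    show "q m \<in> borel_measurable lborel" for m unfolding q_def[abs_def] by simp
    show "integrable lborel (\<lambda>x::real^'n. indicator (cball 0 (r + 1)) x *\<^sub>R B)"
      by (rule borel_integrable_compact) auto
    show "AE x in lborel. (\<lambda>m. q m x) \<longlonglongrightarrow> D x"
    proof (rule AE_I2)
      fix x
      have "((\<lambda>k. norm (F (x + k) - F x - frechet_derivative F (at x) k) / norm k) \<longlongrightarrow> 0) (at 0)"
        using der[of x] by (simp add: has_derivative_at)
      moreover have "filterlim (\<lambda>m. h m *\<^sub>R e) (at 0) sequentially"
      proof -
        have "(\<lambda>m. h m *\<^sub>R e) \<longlonglongrightarrow> 0 *\<^sub>R e" by (intro tendsto_intros h0)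
        then show ?thesis using h e1 by (auto simp: filterlim_at less_imp_neq[THEN not_sym])
      qed
      ultimately have "(\<lambda>m. norm (F (x + h m *\<^sub>R e) - F x - frechet_derivative F (at x) (h m *\<^sub>R e)) / norm (h m *\<^sub>R e)) \<longlonglongrightarrow> 0"
        by (rule filterlim_compose)
      moreover have "norm (F (x + h m *\<^sub>R e) - F x - frechet_derivative F (at x) (h m *\<^sub>R e)) / norm (h m *\<^sub>R e) = norm (q m x - D x)" for m
      proof -
        have "frechet_derivative F (at x) (h m *\<^sub>R e) = h m *\<^sub>R D x"
          using linear_scale[OF has_derivative_linear[OF der]] De by simp
        moreover have "q m x - D x = (F (x + h m *\<^sub>R e) - F x - h m *\<^sub>R D x) /\<^sub>R h m"
          using h(1)[of m] by (simp add: q_def scaleR_diff_right)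
        ultimately show ?thesis using h(1)[of m] e1 by (simp add: divide_inverse mult.commute)
      qed
      ultimately have "(\<lambda>m. norm (q m x - D x)) \<longlonglongrightarrow> 0" by simp
      then show "(\<lambda>m. q m x) \<longlonglongrightarrow> D x" by (simp add: tendsto_norm_zero_iff LIM_zero_iff)
    qed
    show "AE x in lborel. norm (q m x) \<le> indicator (cball 0 (r + 1)) x *\<^sub>R B" for m
    proof (rule AE_I2)
      fix x :: "real^'n"
      show "norm (q m x) \<le> indicator (cball 0 (r + 1)) x *\<^sub>R B"
      proof (cases "x \<in> cball 0 (r + 1)")
        case False
        then have nx: "norm x > r + 1" by simp
        have "norm x \<le> norm (x + h m *\<^sub>R e) + h m"
          using norm_triangle_ineq4[of "x + h m *\<^sub>R e" "h m *\<^sub>R e"] h(1)[of m] e1 by simp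
        then have "x + h m *\<^sub>R e \<notin> K" "x \<notin> K" using nx h(2)[of m] r by (auto simp: subset_iff)
        then have "q m x = 0" by (simp add: q_def K(3))
        then show ?thesis using False by simp
      next
        case True
        have "norm (F (x + h m *\<^sub>R e) - F (x + 0 *\<^sub>R e)) \<le> B * norm (h m - 0)"
        proof (rule differentiable_bound[of "{0..1}" "\<lambda>t. F (x + t *\<^sub>R e)" "\<lambda>t s. s *\<^sub>R D (x + t *\<^sub>R e)"])
          fix t :: real
          have "((\<lambda>t. x + t *\<^sub>R e) has_derivative (\<lambda>s. s *\<^sub>R e)) (at t)"
            by (auto intro!: derivative_eq_intros)
          from has_derivative_compose[OF this der]
          have "((\<lambda>t. F (x + t *\<^sub>R e)) has_derivative (\<lambda>s. frechet_derivative F (at (x + t *\<^sub>R e)) (s *\<^sub>R e))) (at t)" .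
          then have "((\<lambda>t. F (x + t *\<^sub>R e)) has_derivative (\<lambda>s. s *\<^sub>R D (x + t *\<^sub>R e))) (at t)"
            using linear_scale[OF has_derivative_linear[OF der]] De by simp
          then show "((\<lambda>t. F (x + t *\<^sub>R e)) has_derivative (\<lambda>s. s *\<^sub>R D (x + t *\<^sub>R e))) (at t within {0..1})"
            by (rule has_derivative_at_withinI)
          show "onorm (\<lambda>s. s *\<^sub>R D (x + t *\<^sub>R e)) \<le> B"
          proof (rule onorm_le)
            fix s :: real
            show "norm (s *\<^sub>R D (x + t *\<^sub>R e)) \<le> B * norm s"
              using mult_left_mono[OF B[of "x + t *\<^sub>R e"] abs_ge_zero[of s]] by (simp add: mult.commute)
          qed
        qed (use h[of m] in auto)
        then have "norm (q m x) \<le> B"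
          using h(1)[of m] unfolding q_def norm_scaleR by (simp add: field_simps)
        then show ?thesis using True by simp
      qed
    qed
  qed
  then have "(LINT x|lborel. D x) = 0" by (simp add: q0 LIMSEQ_const_iff)
  then show ?thesis
    using integral_Omega_eq_lborel[OF contD] D0 K(2) by (auto simp: D_def)
qed

lemma integration_by_parts:
  assumes g: "Ck (Suc 0) g" and f: "f \<in> test_functions"
  shows "(LINT x|lebesgue_on Omega. g x * pderiv_at i f x) = - (LINT x|lebesgue_on Omega. pderiv_at i g x * f x)"
proof -
  obtain K where K: "compact K" "K \<subseteq> Omega" "\<And>x. x \<notin> K \<Longrightarrow> f x = 0"
    by (rule test_functionsE[OF f]) (rule that)
  have L: "g \<in> L2" "pderiv_at i g \<in> L2"
    using Ck_Suc_continuous[OF g] g by (auto intro: continuous_L2)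
  have "0 = (LINT x|lebesgue_on Omega. pderiv_at i (\<lambda>x. g x * f x) x)"
    by (rule divergence_compact_support[symmetric, OF C1_mult[OF g test_Ck[OF f]] K(1,2)]) (simp add: K)
  also have "\<dots> = (LINT x|lebesgue_on Omega. g x * pderiv_at i f x) + (LINT x|lebesgue_on Omega. pderiv_at i g x * f x)"
    unfolding pderiv_at_mult[OF g test_Ck[OF f]]
    by (intro Bochner_Integration.integral_add L2_mult_integrable L test_pderiv_L2 test_L2 f)
  finally show ?thesis by (simp add: eq_neg_iff_add_eq_0)
qed

section \<open>Sine products and their approximation by test functions\<close>

definition sines :: "nat ^ 'n::finite \<Rightarrow> 'n \<Rightarrow> real \<Rightarrow> real" where
  "sines k i t = sin (real (k $ i) * pi * t)"

definition cut_sines :: "nat \<Rightarrow> nat ^ 'n::finite \<Rightarrow> 'n \<Rightarrow> real \<Rightarrow> real" where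
  "cut_sines m k i t = cut (Suc m) t * sines k i t"

definition eig_const :: "'n::finite itself \<Rightarrow> complex" where
  "eig_const _ = of_real (2 powr (real CARD('n) / 2))"

lemma eigfun_separable: "eigfun k = (\<lambda>x. eig_const TYPE('n) * separable (sines k) x)" for k :: "nat ^ 'n::finite"
  by (simp add: eigfun_def separable_def sines_def eig_const_def)

lemma smooth_sines: "smooth (sines k i)"
  using smooth_affine[OF smooth_sin, of "real (k $ i) * pi" 0] by (simp add: sines_def[abs_def])

lemma smooth_cut_sines: "smooth (cut_sines m k i)"
  unfolding cut_sines_def[abs_def] by (intro smooth_mult smooth_cut smooth_sines)

lemma deriv_sines: "deriv (sines k i) = (\<lambda>t. real (k $ i) * pi * cos (real (k $ i) * pi * t))"
  by (rule ext, rule DERIV_imp_deriv)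
     (auto simp: sines_def[abs_def] intro!: derivative_eq_intros)

lemma deriv_deriv_sines: "deriv (deriv (sines k i)) = (\<lambda>t. - (pi * real (k $ i))\<^sup>2 * sines k i t)"
  unfolding deriv_sines
  by (rule ext, rule DERIV_imp_deriv)
     (auto simp: sines_def power2_eq_square intro!: derivative_eq_intros)

lemma separable_scale: "separable (a(j := (\<lambda>t. c * a j t))) x = of_real c * separable a x"
proof -
  have "(\<Prod>i\<in>UNIV. (a(j := (\<lambda>t. c * a j t))) i (x $ i)) = c * (\<Prod>i\<in>UNIV. a i (x $ i))"
    by (subst (1 2) prod.remove[of _ j]) (auto intro!: prod.cong)
  then show ?thesis by (simp add: separable_def)
qed

lemma eigfun_Ck: "Ck m (eigfun k)"
  unfolding eigfun_separable by (intro Ck_cmult Ck_separable smooth_sines)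

lemma eigfun_continuous: "continuous_on S (eigfun k)"
  by (rule Ck_Suc_continuous[OF eigfun_Ck])

lemma eigfun_L2: "eigfun k \<in> L2"
  by (intro continuous_L2 eigfun_continuous)

lemma pderiv_eigfun_Ck: "Ck m (pderiv_at j (eigfun k))"
  using eigfun_Ck[of "Suc m" k] by simp

lemma pderiv_eigfun_L2: "pderiv_at j (eigfun k) \<in> L2"
  using pderiv_eigfun_Ck[of 0 j k] by (intro continuous_L2) simp

lemma pderiv_eigfun: "pderiv_at j (eigfun k) = (\<lambda>x. eig_const TYPE('n) * separable ((sines k)(j := deriv (sines k j))) x)"
  for k :: "nat ^ 'n::finite"
  unfolding eigfun_separable pderiv_at_cmult[OF Ck_separable[OF smooth_sines]]
  by (simp only: pderiv_separable[OF smooth_sines])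

lemma pderiv_pderiv_eigfun:
  "pderiv_at j (pderiv_at j (eigfun k)) = (\<lambda>x. - (of_real ((pi * real (k $ j))\<^sup>2)) * eigfun k x)"
proof -
  let ?a = "(sines k)(j := deriv (sines k j))"
  have s: "smooth (?a i)" for i by (intro smooth_upd smooth_sines)
  have "?a(j := deriv (?a j)) = (sines k)(j := (\<lambda>t. - (pi * real (k $ j))\<^sup>2 * sines k j t))"
    by (simp add: deriv_deriv_sines)
  then have D: "pderiv_at j (separable ?a) = (\<lambda>x. of_real (- (pi * real (k $ j))\<^sup>2) * separable (sines k) x)"
    unfolding pderiv_separable[OF s] by (simp only:) (rule ext, rule separable_scale)
  then show ?thesis
    unfolding pderiv_eigfun pderiv_at_cmult[OF Ck_separable[OF s]] D
    by (simp add: eigfun_separable mult_ac)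
qed

lemma eigfun_real: "cnj (eigfun k x) = eigfun k x"
  by (simp add: eigfun_def)

lemma pderiv_eigfun_real: "cnj (pderiv_at j (eigfun k) x) = pderiv_at j (eigfun k) x"
  by (simp add: pderiv_eigfun eig_const_def separable_def)

text \<open>
  The bounds may depend on the factor but not on \<open>m\<close>, so their product dominates. Using one factor
  that is a derivative, the same statement covers convergence of the partial derivatives.
\<close>

lemma separable_L2_tendsto:
  fixes b :: "'n::finite \<Rightarrow> real \<Rightarrow> real"
  assumes cont: "\<And>m i. continuous_on UNIV (a m i)" "\<And>i. continuous_on UNIV (b i)"
    and bound: "\<And>i. \<exists>B. \<forall>m t. 0 < t \<longrightarrow> t < 1 \<longrightarrow> \<bar>a m i t\<bar> \<le> B"
    and lim: "\<And>i t. 0 < t \<Longrightarrow> t < 1 \<Longrightarrow> (\<lambda>m. a m i t) \<longlonglongrightarrow> b i t"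
  shows "(\<lambda>m. L2norm (\<lambda>x. separable (a m) x - separable b x)) \<longlonglongrightarrow> 0"
proof -
  obtain B where B: "\<And>i m t. 0 < t \<Longrightarrow> t < 1 \<Longrightarrow> \<bar>a m i t\<bar> \<le> B i" using bound by metis
  have ms: "separable c \<in> borel_measurable (lebesgue_on Omega)" if "\<And>i. continuous_on UNIV (c i)" for c :: "'n \<Rightarrow> real \<Rightarrow> real"
  proof (rule continuous_imp_Omega_measurable)
    have "continuous_on UNIV (\<lambda>x::real^'n. c i (x $ i))" for i
      by (rule continuous_on_compose2[OF that[of i]]) (auto intro: continuous_intros)
    then show "continuous_on UNIV (separable c)"
      by (simp add: separable_def[abs_def] continuous_on_prod continuous_on_of_real)
  qed
  show ?thesis
  proof (rule L2_dominated_convergence[where B="\<Prod>i\<in>UNIV. B i"])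
    show "cmod (separable (a m) x) \<le> (\<Prod>i\<in>UNIV. B i)" if "x \<in> Omega" for m x
      using that unfolding separable_def norm_of_real abs_prod
      by (intro prod_mono) (auto simp: Omega_def intro!: B)
    show "(\<lambda>m. separable (a m) x) \<longlonglongrightarrow> separable b x" if "x \<in> Omega" for x
      using that unfolding separable_def by (intro tendsto_of_real tendsto_prod lim) (auto simp: Omega_def)
  qed (intro ms cont)+
qed

lemma abs_sin_reflect: "\<bar>sin (real k * pi * t)\<bar> = \<bar>sin (real k * pi * (1 - t))\<bar>"
proof -
  have "sin (real k * pi * (1 - t)) = sin (real k * pi) * cos (real k * pi * t) - cos (real k * pi) * sin (real k * pi * t)"
    by (simp add: right_diff_distrib sin_diff)
  also have "\<dots> = - ((-1) ^ k) * sin (real k * pi * t)"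
    by (simp add: cos_npi mult.commute)
  finally show ?thesis by (simp add: abs_mult power_abs)
qed

lemma deriv_cut_sines:
  "deriv (cut_sines m k i) t = deriv (cut (Suc m)) t * sines k i t + cut (Suc m) t * deriv (sines k i) t"
proof (rule DERIV_imp_deriv)
  show "(cut_sines m k i has_real_derivative
     deriv (cut (Suc m)) t * sines k i t + cut (Suc m) t * deriv (sines k i) t) (at t)"
    using DERIV_mult[OF smooth_has_deriv[OF smooth_cut[of "Suc m"], of t] smooth_has_deriv[OF smooth_sines[of k i], of t]]
    by (simp add: cut_sines_def[abs_def] mult.commute)
qed

text \<open>
  The derivative of the cut-off is of order \<open>m\<close> near the end points, but there the sine is at most
  its slope times the distance. Each of the two ends contributes at most 3 slopes, and the
  term with the differentiated sine at most one more.
\<close>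

lemma deriv_cut_sines_bound:
  assumes "0 < t" "t < 1"
  shows "\<bar>deriv (cut_sines m k i) t\<bar> \<le> 7 * (real (k $ i) * pi)"
proof -
  let ?M = "real (Suc m)" and ?K = "real (k $ i) * pi"
  have abs_le: "\<bar>sines k i t\<bar> \<le> ?K * t" "\<bar>sines k i t\<bar> \<le> ?K * (1 - t)"
    using abs_sin_x_le_abs_x[of "?K * t"] abs_sin_x_le_abs_x[of "?K * (1 - t)"] abs_sin_reflect[of "k $ i" t] assms
    by (simp_all add: sines_def abs_mult)
  have one: "\<bar>(?M * deriv flat (?M * s - 1)) * sines k i t\<bar> \<le> 3 * ?K"
    if s: "0 < s" "\<bar>sines k i t\<bar> \<le> ?K * s" for s
  proof -
    have "\<bar>(?M * deriv flat (?M * s - 1)) * sines k i t\<bar> \<le> (?M * deriv flat (?M * s - 1)) * (?K * s)"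
      unfolding abs_mult using s deriv_flat_bound(1)[of "?M * s - 1"] by (intro mult_mono) auto
    also have "\<dots> = ((?M * s - 1 + 1) * deriv flat (?M * s - 1)) * ?K" by simp
    also have "\<dots> \<le> 3 * ?K" by (intro mult_right_mono deriv_flat_bound) auto
    finally show ?thesis .
  qed
  have dc: "deriv (cut (Suc m)) t = ?M * deriv flat (?M * t - 1) * flat (?M * (1 - t) - 1)
      - flat (?M * t - 1) * (?M * deriv flat (?M * (1 - t) - 1))"
    by (rule DERIV_imp_deriv[OF deriv_cut])
  have A: "\<bar>flat (?M * (1 - t) - 1) * ((?M * deriv flat (?M * t - 1)) * sines k i t)\<bar> \<le> 1 * (3 * ?K)"
    unfolding abs_mult[of "flat _"] using flat_bounds one[OF assms(1) abs_le(1)] by (intro mult_mono) auto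
  have B: "\<bar>flat (?M * t - 1) * ((?M * deriv flat (?M * (1 - t) - 1)) * sines k i t)\<bar> \<le> 1 * (3 * ?K)"
    unfolding abs_mult[of "flat _"] using flat_bounds one[OF _ abs_le(2)] assms by (intro mult_mono) auto
  have C: "\<bar>cut (Suc m) t * deriv (sines k i) t\<bar> \<le> 1 * ?K"
  proof -
    have "\<bar>deriv (sines k i) t\<bar> \<le> ?K * 1"
      by (simp add: deriv_sines abs_mult mult_left_le)
    then show ?thesis unfolding abs_mult using cut_bounds[of "Suc m" t] by (intro mult_mono) auto
  qed
  have "deriv (cut_sines m k i) t = flat (?M * (1 - t) - 1) * ((?M * deriv flat (?M * t - 1)) * sines k i t)
     - flat (?M * t - 1) * ((?M * deriv flat (?M * (1 - t) - 1)) * sines k i t) + cut (Suc m) t * deriv (sines k i) t"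
    unfolding deriv_cut_sines dc by (simp add: algebra_simps)
  then show ?thesis using A B C by linarith
qed

lemma deriv_cut_tendsto:
  assumes "0 < t" "t < 1"
  shows "(\<lambda>m. deriv (cut (Suc m)) t) \<longlonglongrightarrow> 0"
proof -
  let ?d = "\<lambda>s m. real m * deriv flat (real m * s - 1)"
  have "(\<lambda>m. deriv (cut m) t) \<longlonglongrightarrow> 0"
  proof (rule Lim_null_comparison)
    show "(\<lambda>m. ?d t m + ?d (1 - t) m) \<longlonglongrightarrow> 0"
      using tendsto_add[OF deriv_flat_scaled_tendsto[of t] deriv_flat_scaled_tendsto[of "1 - t"]] assms by simp
    have "norm (deriv (cut m) t) \<le> ?d t m + ?d (1 - t) m" for m
    proof -
      have "deriv (cut m) t = ?d t m * flat (real m * (1 - t) - 1) - flat (real m * t - 1) * ?d (1 - t) m"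
        using DERIV_imp_deriv[OF deriv_cut[of m t]] by simp
      also have "norm \<dots> \<le> norm (?d t m * flat (real m * (1 - t) - 1)) + norm (flat (real m * t - 1) * ?d (1 - t) m)"
        by (rule norm_triangle_ineq4)
      also have "\<dots> \<le> ?d t m + ?d (1 - t) m"
        using deriv_flat_bound(1) flat_bounds
        by (intro add_mono) (auto simp: abs_mult intro!: mult_right_le_one_le mult_left_le_one_le)
      finally show ?thesis .
    qed
    then show "\<forall>\<^sub>F m in sequentially. norm (deriv (cut m) t) \<le> ?d t m + ?d (1 - t) m" by simp
  qed
  then show ?thesis by (rule LIMSEQ_Suc)
qed

lemma cut_sines_test:
  fixes k :: "nat ^ 'n::finite"
  shows "(\<lambda>x. c * separable (cut_sines m k) x) \<in> test_functions"
proof (rule test_functionsI)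
  let ?K = "cbox (\<chi> i. 1 / real (Suc m)) (\<chi> i. 1 - 1 / real (Suc m)) :: (real^'n) set"
  show "Ck l (\<lambda>x. c * separable (cut_sines m k) x)" for l by (intro Ck_cmult Ck_separable smooth_cut_sines)
  show "compact ?K" by (rule compact_cbox)
  show "?K \<subseteq> Omega"
  proof
    fix x :: "real^'n" assume x: "x \<in> ?K"
    have "0 < x $ i \<and> x $ i < 1" for i
    proof -
      have "1 / real (Suc m) \<le> x $ i" "x $ i \<le> 1 - 1 / real (Suc m)" "1 / real (Suc m) > 0"
        using x by (auto simp: mem_box_cart)
      then show ?thesis by linarith
    qed
    then show "x \<in> Omega" by (simp add: Omega_def)
  qed
  show "c * separable (cut_sines m k) x = 0" if outside: "x \<notin> ?K" for x
  proof -
    obtain i where "x $ i < 1 / real (Suc m) \<or> 1 - 1 / real (Suc m) < x $ i"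
      using outside by (auto simp: mem_box_cart not_le)
    then have "cut (Suc m) (x $ i) = 0" using cut_eq_0[of "Suc m" "x $ i"] by fastforce
    then have "cut_sines m k i (x $ i) = 0" by (simp add: cut_sines_def)
    then have "(\<Prod>i\<in>UNIV. cut_sines m k i (x $ i)) = 0" by (intro prod_zero) auto
    then show ?thesis by (simp add: separable_def)
  qed
qed

text \<open>
  Because the sines vanish at the end points, the derivatives of the cut-off sines stay bounded and
  converge pointwise on the open cube; for other boundary values they would blow up near the faces.
\<close>

lemma eigfun_test_approximation:
  fixes k :: "nat ^ 'n::finite"
  obtains f where "\<And>m. f m \<in> test_functions"
    "(\<lambda>m. L2norm (\<lambda>x. f m x - eigfun k x)) \<longlonglongrightarrow> 0"
    "\<And>j. (\<lambda>m. L2norm (\<lambda>x. pderiv_at j (f m) x - pderiv_at j (eigfun k) x)) \<longlonglongrightarrow> 0"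
proof
  let ?c = "eig_const TYPE('n)"
  let ?f = "\<lambda>m x. ?c * separable (cut_sines m k) x"
  have sm: "separable c \<in> L2" if "\<And>i. smooth (c i)" for c :: "'n \<Rightarrow> real \<Rightarrow> real"
    by (intro continuous_L2 Ck_Suc_continuous[OF Ck_separable] that)
  show "?f m \<in> test_functions" for m by (rule cut_sines_test)
  have b0: "\<exists>B. \<forall>m t. 0 < t \<longrightarrow> t < 1 \<longrightarrow> \<bar>cut_sines m k i t\<bar> \<le> B" for i
  proof (intro exI allI impI)
    fix m t
    show "\<bar>cut_sines m k i t\<bar> \<le> 1 * 1"
      unfolding cut_sines_def abs_mult using cut_bounds[of "Suc m" t]
      by (intro mult_mono) (auto simp: sines_def)
  qed
  have l0: "(\<lambda>m. cut_sines m k i t) \<longlonglongrightarrow> sines k i t" if "0 < t" "t < 1" for i t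
    unfolding cut_sines_def using tendsto_mult[OF LIMSEQ_Suc[OF cut_tendsto[OF that]] tendsto_const] by simp
  have "(\<lambda>m. L2norm (\<lambda>x. separable (cut_sines m k) x - separable (sines k) x)) \<longlonglongrightarrow> 0"
    by (intro separable_L2_tendsto smooth_continuous smooth_cut_sines smooth_sines b0 l0)
  from tendsto_mult_right_zero[OF this, of "cmod ?c"]
  show "(\<lambda>m. L2norm (\<lambda>x. ?f m x - eigfun k x)) \<longlonglongrightarrow> 0"
    by (simp add: L2norm_cmult[symmetric] eigfun_separable right_diff_distrib)
  show "(\<lambda>m. L2norm (\<lambda>x. pderiv_at j (?f m) x - pderiv_at j (eigfun k) x)) \<longlonglongrightarrow> 0" for j
  proof -
    let ?a = "\<lambda>m. (cut_sines m k)(j := deriv (cut_sines m k j))"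
    let ?b = "(sines k)(j := deriv (sines k j))"
    have l1: "(\<lambda>m. deriv (cut_sines m k j) t) \<longlonglongrightarrow> deriv (sines k j) t" if "0 < t" "t < 1" for t
      unfolding deriv_cut_sines
      using tendsto_add[OF tendsto_mult[OF deriv_cut_tendsto[OF that] tendsto_const]
          tendsto_mult[OF LIMSEQ_Suc[OF cut_tendsto[OF that]] tendsto_const], of "sines k j t" "deriv (sines k j) t"]
      by simp
    have "(\<lambda>m. L2norm (\<lambda>x. separable (?a m) x - separable ?b x)) \<longlonglongrightarrow> 0"
    proof (rule separable_L2_tendsto)
      show "continuous_on UNIV (?a m i)" for m i
        by (intro smooth_continuous smooth_upd smooth_cut_sines)
      show "continuous_on UNIV (?b i)" for i
        by (intro smooth_continuous smooth_upd smooth_sines)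
      show "\<exists>B. \<forall>m t. 0 < t \<longrightarrow> t < 1 \<longrightarrow> \<bar>?a m i t\<bar> \<le> B" for i
        using b0[of i] deriv_cut_sines_bound[of _ _ k j]
        by (cases "i = j") (auto intro!: exI[of _ "7 * (real (k $ j) * pi)"])
      show "(\<lambda>m. ?a m i t) \<longlonglongrightarrow> ?b i t" if "0 < t" "t < 1" for i t
        using l0[OF that] l1[OF that] by (cases "i = j") auto
    qed
    from tendsto_mult_right_zero[OF this, of "cmod ?c"] show ?thesis
      unfolding pderiv_at_cmult[OF Ck_separable[OF smooth_cut_sines]] pderiv_separable[OF smooth_cut_sines] pderiv_eigfun
      by (simp only: L2norm_cmult[symmetric] right_diff_distrib)
  qed
qed

section \<open>Completeness of the sine products\<close>

text \<open>
  Here \<open>k\<close> ranges over all multi-indices, also those with a zero entry, whose sine product vanishes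
  identically. This makes the step from \<open>k\<close> to \<open>k - 1\<close> in one coordinate always admissible.
\<close>

definition sine_orthogonal :: "'n::finite cfun set" where
  "sine_orthogonal = {h \<in> L2. \<forall>k. (LINT x|lebesgue_on Omega. h x * eigfun k x) = 0}"

lemma eigfun_zero_index: "k $ j = 0 \<Longrightarrow> eigfun k x = 0"
proof -
  assume "k $ j = 0"
  then have "(\<Prod>i\<in>UNIV. sin (real (k $ i) * pi * x $ i)) = 0"
    by (intro prod_zero) (auto intro!: exI[of _ j])
  then show ?thesis by (simp add: eigfun_def)
qed

lemma cos_mult_eigfun:
  fixes k :: "nat ^ 'n::finite"
  assumes "k $ j \<noteq> 0"
  shows "of_real (cos (pi * x $ j)) * eigfun k x =
    (1/2) * (eigfun (\<chi> i. if i = j then Suc (k $ i) else k $ i) x +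
       eigfun (\<chi> i. if i = j then k $ i - 1 else k $ i) x)"
proof -
  let ?P = "\<Prod>i\<in>UNIV - {j}. sin (real (k $ i) * pi * x $ i)"
  have E: "eigfun (\<chi> i. if i = j then q else k $ i) x = eig_const TYPE('n) * of_real (sin (real q * pi * x $ j) * ?P)" for q
  proof -
    have "(\<Prod>i\<in>UNIV. sin (real ((\<chi> i. if i = j then q else k $ i) $ i) * pi * x $ i)) = sin (real q * pi * x $ j) * ?P"
      by (subst prod.remove[of _ j]) (auto intro!: prod.cong)
    then show ?thesis by (simp only: eigfun_def eig_const_def of_real_mult)
  qed
  have u: "(\<chi> i. if i = j then k $ j else k $ i) = k" by (simp add: vec_eq_iff)
  have v: "(\<chi> i. if i = j then g (k $ i) else k $ i) = (\<chi> i. if i = j then g (k $ j) else k $ i)" for g :: "nat \<Rightarrow> nat"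
    by (simp add: vec_eq_iff)
  have c0: "cos (pi * x $ j) * sin (real (k $ j) * pi * x $ j) =
     (sin (real (Suc (k $ j)) * pi * x $ j) + sin (real (k $ j - 1) * pi * x $ j)) / 2"
    using assms sin_times_cos[of "real (k $ j) * pi * x $ j" "pi * x $ j"]
    by (simp add: of_nat_diff algebra_simps)
  have t: "cos (pi * x $ j) * (sin (real (k $ j) * pi * x $ j) * ?P) =
     (1/2) * (sin (real (Suc (k $ j)) * pi * x $ j) * ?P + sin (real (k $ j - 1) * pi * x $ j) * ?P)"
    by (simp only: mult.assoc[symmetric, of "cos _"] c0) (simp add: distrib_right add_divide_distrib)
  have "of_real (cos (pi * x $ j)) * eigfun k x =
      eig_const TYPE('n) * of_real (cos (pi * x $ j) * (sin (real (k $ j) * pi * x $ j) * ?P))"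
    unfolding E[of "k $ j", unfolded u] by (simp add: mult_ac)
  also have "\<dots> = (1/2) * (eigfun (\<chi> i. if i = j then Suc (k $ j) else k $ i) x +
       eigfun (\<chi> i. if i = j then k $ j - 1 else k $ i) x)"
    unfolding t E by (simp add: algebra_simps)
  finally show ?thesis by (simp only: v[of Suc] v[of "\<lambda>x. x - 1"])
qed

lemma sine_orthogonal_cos:
  assumes "h \<in> sine_orthogonal"
  shows "(\<lambda>x. of_real (cos (pi * x $ j)) * h x) \<in> sine_orthogonal"
  unfolding sine_orthogonal_def
proof (intro CollectI conjI allI)
  have hL: "h \<in> L2" and h: "\<And>k. (LINT x|lebesgue_on Omega. h x * eigfun k x) = 0"
    using assms by (auto simp: sine_orthogonal_def)
  show "(\<lambda>x. of_real (cos (pi * x $ j)) * h x) \<in> L2"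
    by (intro L2_mult_continuous hL continuous_intros)
  fix k
  show "(LINT x|lebesgue_on Omega. of_real (cos (pi * x $ j)) * h x * eigfun k x) = 0"
  proof (cases "k $ j = 0")
    case True
    then show ?thesis by (simp add: eigfun_zero_index)
  next
    case False
    let ?p = "\<chi> i. if i = j then Suc (k $ i) else k $ i" and ?q = "\<chi> i. if i = j then k $ i - 1 else k $ i"
    have "(LINT x|lebesgue_on Omega. of_real (cos (pi * x $ j)) * h x * eigfun k x) =
        (LINT x|lebesgue_on Omega. (1/2) * (h x * eigfun ?p x) + (1/2) * (h x * eigfun ?q x))"
    proof (intro Bochner_Integration.integral_cong refl)
      fix x
      have "of_real (cos (pi * x $ j)) * h x * eigfun k x = h x * (of_real (cos (pi * x $ j)) * eigfun k x)"
        by (simp add: mult_ac)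
      then show "of_real (cos (pi * x $ j)) * h x * eigfun k x = (1/2) * (h x * eigfun ?p x) + (1/2) * (h x * eigfun ?q x)"
        unfolding cos_mult_eigfun[OF False] by (simp add: algebra_simps)
    qed
    also have "\<dots> = (1/2) * (LINT x|lebesgue_on Omega. h x * eigfun ?p x) + (1/2) * (LINT x|lebesgue_on Omega. h x * eigfun ?q x)"
      by (subst Bochner_Integration.integral_add) (auto intro!: L2_mult_integrable hL eigfun_L2)
    finally show ?thesis by (simp add: h)
  qed
qed

lemma sine_orthogonal_add:
  assumes "g \<in> sine_orthogonal" "h \<in> sine_orthogonal"
  shows "(\<lambda>x. g x + h x) \<in> sine_orthogonal"
  using assms by (auto simp: sine_orthogonal_def distrib_right L2_mult_integrable eigfun_L2 intro: L2_add)

lemma sine_orthogonal_cmult: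
  assumes "h \<in> sine_orthogonal"
  shows "(\<lambda>x. c * h x) \<in> sine_orthogonal"
  using assms by (auto simp: sine_orthogonal_def mult.assoc intro: L2_cmult)

text \<open>
  The continuous multipliers that preserve \<open>sine_orthogonal\<close> form an algebra; it contains the constants
  and the functions \<open>cos (pi * x $ j)\<close>, which separate the points of the closed cube since the cosine is
  injective on \<open>[0, pi]\<close>. Hence Stone-Weierstrass applies, and uniform limits of multipliers are
  multipliers.
\<close>

lemma sine_orthogonal_continuous:
  fixes h :: "'n::finite cfun" and f :: "real^'n \<Rightarrow> real"
  assumes h: "h \<in> sine_orthogonal" and f: "continuous_on UNIV f"
  shows "(\<lambda>x. of_real (f x) * h x) \<in> sine_orthogonal"
proof -
  \<comment> \<open>Continuity on the whole space, rather than on the closed cube, makes measurability immediate.\<close>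
  define R where "R = {p :: real^'n \<Rightarrow> real. continuous_on UNIV p \<and>
    (\<forall>g\<in>sine_orthogonal. (\<lambda>x. of_real (p x) * g x) \<in> sine_orthogonal)}"
  interpret function_ring_on R "cbox 0 1"
  proof
    show "compact (cbox 0 (1::real^'n))" by (rule compact_cbox)
    show "continuous_on (cbox 0 1) p" if "p \<in> R" for p
      using that by (auto simp: R_def intro: continuous_on_subset)
    show "(\<lambda>x. p x + q x) \<in> R" if "p \<in> R" "q \<in> R" for p q
      using that by (auto simp: R_def distrib_right intro!: continuous_intros sine_orthogonal_add)
    show "(\<lambda>x. p x * q x) \<in> R" if "p \<in> R" "q \<in> R" for p q
      using that by (auto simp: R_def mult.assoc intro!: continuous_intros)
    show "(\<lambda>_. c) \<in> R" for c
      by (auto simp: R_def intro: sine_orthogonal_cmult)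
    fix x y :: "real^'n" assume xy: "x \<in> cbox 0 1" "y \<in> cbox 0 1" "x \<noteq> y"
    then obtain j where j: "x $ j \<noteq> y $ j" by (auto simp: vec_eq_iff)
    have "0 \<le> x $ j" "x $ j \<le> 1" "0 \<le> y $ j" "y $ j \<le> 1" using xy by (auto simp: mem_box_cart)
    then have "cos (pi * x $ j) \<noteq> cos (pi * y $ j)"
      using j cos_inj_pi[of "pi * x $ j" "pi * y $ j"] by (auto simp: mult_left_le)
    moreover have "(\<lambda>x. cos (pi * x $ j)) \<in> R"
      by (auto simp: R_def intro!: sine_orthogonal_cos continuous_intros)
    ultimately show "\<exists>f\<in>R. f x \<noteq> f y" by (auto intro!: bexI[of _ "\<lambda>x. cos (pi * x $ j)"])
  qed
  have hL: "h \<in> L2" using h by (simp add: sine_orthogonal_def)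
  have mulL: "(\<lambda>x. of_real (p x) * h x) \<in> L2" if "continuous_on UNIV p" for p :: "real^'n \<Rightarrow> real"
    by (intro L2_mult_continuous hL continuous_intros that)
  have "(LINT x|lebesgue_on Omega. of_real (f x) * h x * eigfun k x) = 0" for k
  proof -
    let ?J = "LINT x|lebesgue_on Omega. cmod (h x * eigfun k x)"
    have int: "integrable (lebesgue_on Omega) (\<lambda>x. h x * eigfun k x)"
      by (intro L2_mult_integrable hL eigfun_L2)
    have bd: "cmod (LINT x|lebesgue_on Omega. of_real (f x) * h x * eigfun k x) \<le> e * ?J" if "e > 0" for e
    proof -
      obtain p where p: "p \<in> R" "\<And>x. x \<in> cbox 0 1 \<Longrightarrow> \<bar>f x - p x\<bar> < e"
        using Stone_Weierstrass_basic[OF continuous_on_subset[OF f], of e] \<open>e > 0\<close> by auto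
      have pc: "continuous_on UNIV p" and p0: "(\<lambda>x. of_real (p x) * h x) \<in> sine_orthogonal"
        using p(1) h by (auto simp: R_def)
      have i1: "integrable (lebesgue_on Omega) (\<lambda>x. of_real (f x) * h x * eigfun k x)"
        and i2: "integrable (lebesgue_on Omega) (\<lambda>x. of_real (p x) * h x * eigfun k x)"
        by (intro L2_mult_integrable mulL f pc eigfun_L2)+
      have "(LINT x|lebesgue_on Omega. of_real (p x) * h x * eigfun k x) = 0"
        using p0 by (simp add: sine_orthogonal_def)
      then have "(LINT x|lebesgue_on Omega. of_real (f x) * h x * eigfun k x) =
          (LINT x|lebesgue_on Omega. of_real (f x) * h x * eigfun k x - of_real (p x) * h x * eigfun k x)"
        using i1 i2 by simp
      also have "cmod \<dots> \<le> (LINT x|lebesgue_on Omega. cmod (of_real (f x) * h x * eigfun k x - of_real (p x) * h x * eigfun k x))"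
        by (rule integral_norm_bound)
      also have "\<dots> \<le> (LINT x|lebesgue_on Omega. e * cmod (h x * eigfun k x))"
      proof (rule integral_mono)
        fix x :: "real^'n" assume "x \<in> space (lebesgue_on Omega)"
        then have "x \<in> cbox 0 1" using Omega_subset_cbox by auto
        then have "\<bar>f x - p x\<bar> * cmod (h x * eigfun k x) \<le> e * cmod (h x * eigfun k x)"
          using p(2) by (intro mult_right_mono) (auto simp: less_imp_le)
        moreover have "of_real (f x) * h x * eigfun k x - of_real (p x) * h x * eigfun k x = of_real (f x - p x) * (h x * eigfun k x)"
          by (simp add: algebra_simps)
        ultimately show "cmod (of_real (f x) * h x * eigfun k x - of_real (p x) * h x * eigfun k x) \<le> e * cmod (h x * eigfun k x)"
          by (simp only: norm_mult[of "of_real _"] norm_of_real)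
      qed (use i1 i2 int in \<open>auto simp del: norm_mult intro!: integrable_norm Bochner_Integration.integrable_diff\<close>)
      finally show ?thesis by simp
    qed
    have "(\<lambda>m. 1 / real (Suc m)) \<longlonglongrightarrow> 0" by real_asymp
    from tendsto_mult[OF this tendsto_const]
    have "(\<lambda>m. (1 / real (Suc m)) * ?J) \<longlonglongrightarrow> 0 * ?J" .
    then have "cmod (LINT x|lebesgue_on Omega. of_real (f x) * h x * eigfun k x) \<le> 0 * ?J"
      by (rule LIMSEQ_le_const) (intro exI[of _ 0] allI impI bd, simp)
    then show ?thesis by simp
  qed
  with mulL[OF f] show ?thesis by (auto simp: sine_orthogonal_def)
qed

text \<open>
  Positivity of the ground state allows it to be divided out at the end of the completeness proof.
\<close>

lemma eigfun_one_pos: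
  assumes "x \<in> (Omega :: (real^'n::finite) set)"
  shows "\<exists>r>0. eigfun (\<chi> i. 1) x = complex_of_real r"
proof -
  have "0 < sin (pi * x $ i)" for i
    using assms by (intro sin_gt_zero) (auto simp: Omega_def)
  then have "0 < 2 powr (real CARD('n) / 2) * (\<Prod>i\<in>UNIV. sin (real ((\<chi> i. 1) $ i) * pi * x $ i))"
    by (intro mult_pos_pos prod_pos) auto
  then show ?thesis unfolding eigfun_def by blast
qed

text \<open>
  Let \<open>G = h e\<close> with the positive ground state \<open>e\<close>. Then \<open>\<integral> f G = 0\<close> for all continuous \<open>f\<close>, and by
  dominated convergence for all bounded almost everywhere limits of such \<open>f\<close>, in particular for
  \<open>w = Re G / (1 + \<bar>Re G\<bar>)\<close>. But \<open>w Re G\<close> is nonnegative.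
\<close>

lemma sine_orthogonal_Re_zero:
  fixes h :: "'n::finite cfun"
  assumes h: "h \<in> sine_orthogonal"
  shows "AE x in lebesgue_on Omega. Re (h x) = 0"
proof -
  let ?M = "lebesgue_on (Omega :: (real^'n) set)"
  define G where "G x = h x * eigfun (\<chi> i. 1) x" for x
  have hL: "h \<in> L2" using h by (simp add: sine_orthogonal_def)
  have GL: "integrable ?M G" unfolding G_def by (intro L2_mult_integrable hL eigfun_L2)
  then have [measurable]: "G \<in> borel_measurable ?M" by simp
  \<comment> \<open>A bounded measurable function with the sign of \<open>Re G\<close>.\<close>
  define w where "w x = Re (G x) / (1 + \<bar>Re (G x)\<bar>)" for x
  have w1: "\<bar>w x\<bar> \<le> 1" for x by (simp add: w_def divide_le_eq)
  have [measurable]: "w \<in> borel_measurable ?M" unfolding w_def[abs_def] by measurable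
  then have "w measurable_on Omega" by (simp add: measurable_on_iff_borel_measurable)
  then obtain N p where N: "negligible N" and p: "\<And>n. continuous_on UNIV (p n)"
    and lim: "\<And>x. x \<notin> N \<Longrightarrow> (\<lambda>n. p n x) \<longlonglongrightarrow> (if x \<in> Omega then w x else 0)"
    unfolding measurable_on_def by blast
  \<comment> \<open>Truncation provides the bound for dominated convergence and leaves the limit \<open>w\<close> unchanged.\<close>
  define f where "f n x = max (-1) (min 1 (p n x))" for n x
  have fc: "continuous_on UNIV (f n)" for n unfolding f_def[abs_def] by (intro continuous_intros p)
  have f0: "(LINT x|?M. of_real (f n x) * G x) = 0" for n
    using sine_orthogonal_continuous[OF h fc, of n] by (simp add: sine_orthogonal_def G_def mult.assoc)
  have [measurable]: "f n \<in> borel_measurable ?M" for n by (rule continuous_imp_Omega_measurable[OF fc])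
  have "AE x in ?M. x \<notin> N"
  proof -
    have "AE x in lebesgue. x \<notin> N" using N by (simp add: negligible_iff_null_sets AE_not_in)
    then show ?thesis by (subst AE_restrict_space_iff) (auto elim: eventually_mono)
  qed
  then have fl: "AE x in ?M. (\<lambda>n. f n x) \<longlonglongrightarrow> w x"
  proof (rule AE_mp, intro AE_I2 impI)
    fix x assume "x \<in> space ?M" "x \<notin> N"
    then have "(\<lambda>n. p n x) \<longlonglongrightarrow> w x" using lim[of x] by simp
    then have "(\<lambda>n. f n x) \<longlonglongrightarrow> max (-1) (min 1 (w x))" unfolding f_def by (intro tendsto_intros)
    also have "max (-1) (min 1 (w x)) = w x" using w1[of x] by (auto simp: max_def min_def)
    finally show "(\<lambda>n. f n x) \<longlonglongrightarrow> w x" .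
  qed
  have bnd: "cmod (of_real r * G x) \<le> cmod (G x)" if "\<bar>r\<bar> \<le> 1" for r x
    using that by (simp add: norm_mult mult_left_le_one_le)
  have "(\<lambda>n. LINT x|?M. of_real (f n x) * G x) \<longlonglongrightarrow> (LINT x|?M. of_real (w x) * G x)"
  proof (rule integral_dominated_convergence[where w="\<lambda>x. cmod (G x)"])
    show "integrable ?M (\<lambda>x. cmod (G x))" using GL by simp
    show "AE x in ?M. (\<lambda>n. of_real (f n x) * G x) \<longlonglongrightarrow> of_real (w x) * G x"
      using fl by eventually_elim (intro tendsto_intros)
    show "AE x in ?M. norm (of_real (f n x) * G x) \<le> cmod (G x)" for n
      by (intro AE_I2 bnd) (auto simp: f_def)
  qed auto
  then have w0: "(LINT x|?M. of_real (w x) * G x) = 0" by (simp add: f0 LIMSEQ_const_iff)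
  have wi: "integrable ?M (\<lambda>x. of_real (w x) * G x)"
    by (rule Bochner_Integration.integrable_bound[OF GL]) (auto intro!: AE_I2 bnd w1)
  have "(LINT x|?M. w x * Re (G x)) = 0"
    using integral_Re[OF wi] w0 by simp
  moreover have "integrable ?M (\<lambda>x. w x * Re (G x))"
    using integrable_Re[OF wi] by simp
  moreover have "w x * Re (G x) \<ge> 0" for x
    by (simp add: w_def)
  ultimately have "AE x in ?M. w x * Re (G x) = 0"
    by (simp add: integral_nonneg_eq_0_iff_AE)
  then show ?thesis
  proof (rule AE_mp, intro AE_I2 impI)
    fix x assume "x \<in> space ?M" and z: "w x * Re (G x) = 0"
    then have "x \<in> Omega" by simp
    then obtain r where r: "r > 0" "eigfun (\<chi> i. 1) x = complex_of_real r"
      using eigfun_one_pos by blast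
    have "Re (G x) = 0" using z by (auto simp: w_def add_pos_nonneg)
    then show "Re (h x) = 0" using r by (simp add: G_def)
  qed
qed

theorem sines_complete:
  fixes g :: "'n::finite cfun"
  assumes g: "g \<in> L2" and orth: "\<And>k. (\<forall>i. 1 \<le> k $ i) \<Longrightarrow> (LINT x|lebesgue_on Omega. g x * eigfun k x) = 0"
  shows "AE x in lebesgue_on Omega. g x = 0"
proof -
  have gs: "g \<in> sine_orthogonal"
    unfolding sine_orthogonal_def
  proof (intro CollectI conjI allI g)
    fix k :: "nat^'n"
    show "(LINT x|lebesgue_on Omega. g x * eigfun k x) = 0"
    proof (cases "\<forall>i. 1 \<le> k $ i")
      case False
      then obtain i where "k $ i = 0" by (metis not_less_eq_eq One_nat_def le_zero_eq)
      then show ?thesis by (simp add: eigfun_zero_index)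
    qed (rule orth)
  qed
  have "AE x in lebesgue_on Omega. Re (\<i> * g x) = 0"
    by (rule sine_orthogonal_Re_zero[OF sine_orthogonal_cmult[OF gs]])
  with sine_orthogonal_Re_zero[OF gs] show ?thesis
    by eventually_elim (simp add: complex_eq_iff)
qed

text \<open>
  Sine products are \<open>L2\<close>-limits of test functions, so a function orthogonal to all test functions is
  orthogonal to all sine products. In particular weak derivatives are unique.
\<close>

corollary test_functions_separate:
  fixes g :: "'n::finite cfun"
  assumes g: "g \<in> L2" and orth: "\<And>f. f \<in> test_functions \<Longrightarrow> (LINT x|lebesgue_on Omega. g x * f x) = 0"
  shows "AE x in lebesgue_on Omega. g x = 0"
proof (rule sines_complete[OF g])
  fix k :: "nat^'n"
  obtain f where f: "\<And>m. f m \<in> test_functions" "(\<lambda>m. L2norm (\<lambda>x. f m x - eigfun k x)) \<longlonglongrightarrow> 0"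
    by (rule eigfun_test_approximation[of k]) (rule that)
  have "(\<lambda>m. LINT x|lebesgue_on Omega. f m x * g x) \<longlonglongrightarrow> (LINT x|lebesgue_on Omega. eigfun k x * g x)"
    by (rule L2_integral_tendsto[OF test_L2[OF f(1)] eigfun_L2 g f(2)])
  moreover have "(LINT x|lebesgue_on Omega. f m x * g x) = 0" for m
    using orth[OF f(1)] by (simp add: mult.commute)
  ultimately show "(LINT x|lebesgue_on Omega. g x * eigfun k x) = 0"
    by (simp add: LIMSEQ_const_iff mult.commute)
qed

section \<open>Weak derivatives and H10\<close>

lemma L2norm_cong_L2:
  "u \<in> L2 \<Longrightarrow> v \<in> L2 \<Longrightarrow> AE x in lebesgue_on Omega. u x = v x \<Longrightarrow> L2norm u = L2norm v"
  by (rule L2norm_cong_AE[OF L2D(1) L2D(1)])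

lemma weak_pderivD:
  assumes "weak_pderiv i u g"
  shows "u \<in> L2" "g \<in> L2"
    "f \<in> test_functions \<Longrightarrow>
       (LINT x|lebesgue_on Omega. u x * pderiv_at i f x) = - (LINT x|lebesgue_on Omega. g x * f x)"
  using assms by (auto simp: weak_pderiv_def)

lemma weak_pderiv_unique:
  assumes "weak_pderiv i u g" "weak_pderiv i u h"
  shows "AE x in lebesgue_on Omega. g x = h x"
proof -
  note L = weak_pderivD(2)[OF assms(1)] weak_pderivD(2)[OF assms(2)]
  have "AE x in lebesgue_on Omega. g x - h x = 0"
  proof (rule test_functions_separate[OF L2_diff[OF L]])
    fix f :: "'a cfun" assume f: "f \<in> test_functions"
    show "(LINT x|lebesgue_on Omega. (g x - h x) * f x) = 0"
      using weak_pderivD(3)[OF assms(1) f] weak_pderivD(3)[OF assms(2) f]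
      by (simp add: left_diff_distrib L2_mult_integrable L test_L2 f)
  qed
  then show ?thesis by simp
qed

lemma weak_pderiv_axpy:
  assumes "weak_pderiv i u g" "weak_pderiv i v h"
  shows "weak_pderiv i (\<lambda>x. c * u x + v x) (\<lambda>x. c * g x + h x)"
  unfolding weak_pderiv_def
proof (intro conjI ballI)
  note L = weak_pderivD(1,2)[OF assms(1)] weak_pderivD(1,2)[OF assms(2)]
  show "(\<lambda>x. c * u x + v x) \<in> L2" "(\<lambda>x. c * g x + h x) \<in> L2"
    by (intro L2_add L2_cmult L)+
  fix f :: "'a cfun" assume f: "f \<in> test_functions"
  show "(LINT x|lebesgue_on Omega. (c * u x + v x) * pderiv_at i f x) =
      - (LINT x|lebesgue_on Omega. (c * g x + h x) * f x)"
    using weak_pderivD(3)[OF assms(1) f] weak_pderivD(3)[OF assms(2) f]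
    by (simp add: distrib_right mult.assoc L2_mult_integrable L test_L2 test_pderiv_L2 f)
qed

lemma weak_pderiv_C1:
  assumes "Ck (Suc 0) g" shows "weak_pderiv i g (pderiv_at i g)"
  unfolding weak_pderiv_def
proof (intro conjI ballI integration_by_parts assms)
  show "g \<in> L2" "pderiv_at i g \<in> L2"
    using Ck_Suc_continuous[OF assms] assms by (auto intro: continuous_L2)
qed

lemma weak_pderiv_limit:
  assumes "\<And>m. weak_pderiv i (u m) (g m)" "U \<in> L2" "G \<in> L2"
    "(\<lambda>m. L2norm (\<lambda>x. u m x - U x)) \<longlonglongrightarrow> 0" "(\<lambda>m. L2norm (\<lambda>x. g m x - G x)) \<longlonglongrightarrow> 0"
  shows "weak_pderiv i U G"
  unfolding weak_pderiv_def
proof (intro conjI ballI assms(2,3))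
  fix f :: "'a cfun" assume f: "f \<in> test_functions"
  have "(\<lambda>m. LINT x|lebesgue_on Omega. u m x * pderiv_at i f x) \<longlonglongrightarrow> (LINT x|lebesgue_on Omega. U x * pderiv_at i f x)"
    by (rule L2_integral_tendsto[OF weak_pderivD(1)[OF assms(1)] assms(2) test_pderiv_L2[OF f] assms(4)])
  moreover have "(\<lambda>m. LINT x|lebesgue_on Omega. u m x * pderiv_at i f x) \<longlonglongrightarrow> - (LINT x|lebesgue_on Omega. G x * f x)"
    unfolding weak_pderivD(3)[OF assms(1) f]
    by (intro tendsto_minus L2_integral_tendsto[OF weak_pderivD(2)[OF assms(1)] assms(3) test_L2[OF f] assms(5)])
  ultimately show "(LINT x|lebesgue_on Omega. U x * pderiv_at i f x) = - (LINT x|lebesgue_on Omega. G x * f x)"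
    by (rule LIMSEQ_unique)
qed

lemma H1I: "(\<And>i. weak_pderiv i u (g i)) \<Longrightarrow> u \<in> H1"
  using weak_pderivD(1) by (auto simp: H1_def)

lemma wD_weak_pderiv: "u \<in> H1 \<Longrightarrow> weak_pderiv i u (wD i u)"
  unfolding wD_def H1_def by (metis (mono_tags, lifting) mem_Collect_eq someI_ex)

lemma H1_L2: "u \<in> H1 \<Longrightarrow> u \<in> L2" by (simp add: H1_def)

lemma wD_L2: "u \<in> H1 \<Longrightarrow> wD i u \<in> L2"
  by (rule weak_pderivD(2)[OF wD_weak_pderiv])

lemma wD_AE: "weak_pderiv i u g \<Longrightarrow> AE x in lebesgue_on Omega. wD i u x = g x"
  unfolding wD_def by (rule weak_pderiv_unique[OF someI[of _ g]])

lemma C1_H1: "Ck (Suc 0) g \<Longrightarrow> g \<in> H1"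
  by (rule H1I[OF weak_pderiv_C1])

lemma wD_C1: "Ck (Suc 0) g \<Longrightarrow> AE x in lebesgue_on Omega. wD i g x = pderiv_at i g x"
  by (rule wD_AE[OF weak_pderiv_C1])

lemma test_H1: "f \<in> test_functions \<Longrightarrow> f \<in> H1"
  by (rule C1_H1[OF test_Ck])

lemma H1_axpy: "u \<in> H1 \<Longrightarrow> v \<in> H1 \<Longrightarrow> (\<lambda>x. c * u x + v x) \<in> H1"
  by (rule H1I[OF weak_pderiv_axpy[OF wD_weak_pderiv wD_weak_pderiv]])

lemma wD_axpy:
  "u \<in> H1 \<Longrightarrow> v \<in> H1 \<Longrightarrow> AE x in lebesgue_on Omega. wD i (\<lambda>x. c * u x + v x) x = c * wD i u x + wD i v x"
  by (rule wD_AE[OF weak_pderiv_axpy[OF wD_weak_pderiv wD_weak_pderiv]])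

lemma H1_diff: "u \<in> H1 \<Longrightarrow> v \<in> H1 \<Longrightarrow> (\<lambda>x. u x - v x) \<in> H1"
  using H1_axpy[of v u "-1"] by simp

lemma L2norm_wD_diff:
  assumes "u \<in> H1" "v \<in> H1"
  shows "L2norm (wD i (\<lambda>x. u x - v x)) = L2norm (\<lambda>x. wD i u x - wD i v x)"
proof (rule L2norm_cong_L2)
  show "wD i (\<lambda>x. u x - v x) \<in> L2" "(\<lambda>x. wD i u x - wD i v x) \<in> L2"
    by (intro wD_L2 H1_diff L2_diff assms)+
  show "AE x in lebesgue_on Omega. wD i (\<lambda>x. u x - v x) x = wD i u x - wD i v x"
    using wD_axpy[OF assms(2,1), of i "-1"] by simp
qed

text \<open>
  The representative \<open>wD i u\<close> is arbitrary within its class; this replaces it by any explicit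
  weak derivative inside a norm.
\<close>

lemma L2norm_diff_wD_cong:
  assumes "u \<in> H1" "g \<in> L2" "h \<in> L2" "AE x in lebesgue_on Omega. wD i u x = g x"
  shows "L2norm (\<lambda>x. wD i u x - h x) = L2norm (\<lambda>x. g x - h x)"
    "L2norm (\<lambda>x. h x - wD i u x) = L2norm (\<lambda>x. h x - g x)"
proof -
  show "L2norm (\<lambda>x. wD i u x - h x) = L2norm (\<lambda>x. g x - h x)"
    by (rule L2norm_cong_L2) (use assms in \<open>auto intro!: L2_diff wD_L2\<close>)
  then show "L2norm (\<lambda>x. h x - wD i u x) = L2norm (\<lambda>x. h x - g x)"
    by (metis L2norm_minus_commute)
qed

lemma H1_norm_eq: "H1_norm u = sqrt ((L2norm u)\<^sup>2 + (\<Sum>i\<in>UNIV. (L2norm (wD i u))\<^sup>2))"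
  by (simp add: H1_norm_def L2norm_sq)

lemma H1_norm_tendsto_0_iff:
  "(\<lambda>m. H1_norm (u m)) \<longlonglongrightarrow> 0 \<longleftrightarrow>
    (\<lambda>m. L2norm (u m)) \<longlonglongrightarrow> 0 \<and> (\<forall>i. (\<lambda>m. L2norm (wD i (u m))) \<longlonglongrightarrow> 0)"
proof
  have le: "L2norm v \<le> H1_norm v" "L2norm (wD i v) \<le> H1_norm v" for v :: "'a cfun" and i
  proof -
    have "(L2norm (wD i v))\<^sup>2 \<le> (\<Sum>i\<in>UNIV. (L2norm (wD i v))\<^sup>2)"
      by (rule member_le_sum) auto
    then show "L2norm (wD i v) \<le> H1_norm v"
      unfolding H1_norm_eq by (intro real_le_rsqrt) (simp add: add_increasing)
    show "L2norm v \<le> H1_norm v"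
      unfolding H1_norm_eq by (intro real_le_rsqrt) (simp add: sum_nonneg)
  qed
  assume *: "(\<lambda>m. H1_norm (u m)) \<longlonglongrightarrow> 0"
  show "(\<lambda>m. L2norm (u m)) \<longlonglongrightarrow> 0 \<and> (\<forall>i. (\<lambda>m. L2norm (wD i (u m))) \<longlonglongrightarrow> 0)"
    by (intro conjI allI; rule Lim_null_comparison[OF _ *]) (simp_all add: le)
next
  assume *: "(\<lambda>m. L2norm (u m)) \<longlonglongrightarrow> 0 \<and> (\<forall>i. (\<lambda>m. L2norm (wD i (u m))) \<longlonglongrightarrow> 0)"
  have "(\<lambda>m. sqrt ((L2norm (u m))\<^sup>2 + (\<Sum>i\<in>UNIV. (L2norm (wD i (u m)))\<^sup>2))) \<longlonglongrightarrow> sqrt (0\<^sup>2 + (\<Sum>i\<in>(UNIV::'a set). 0\<^sup>2))"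
    by (intro tendsto_intros) (use * in auto)
  then show "(\<lambda>m. H1_norm (u m)) \<longlonglongrightarrow> 0" by (simp add: H1_norm_eq)
qed

text \<open>
  Uniqueness of weak derivatives turns the norm of the chosen representative \<open>wD i (f m - u)\<close>
  into the distance between the classical derivative of \<open>f m\<close> and \<open>wD i u\<close>.
\<close>

lemma H10_iff:
  "u \<in> H10 \<longleftrightarrow> u \<in> H1 \<and> (\<exists>f. (\<forall>m. f m \<in> test_functions) \<and> (\<lambda>m. L2norm (\<lambda>x. f m x - u x)) \<longlonglongrightarrow> 0 \<and>
     (\<forall>i. (\<lambda>m. L2norm (\<lambda>x. pderiv_at i (f m) x - wD i u x)) \<longlonglongrightarrow> 0))"
proof -
  have "L2norm (wD i (\<lambda>x. f x - u x)) = L2norm (\<lambda>x. pderiv_at i f x - wD i u x)"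
    if "u \<in> H1" "f \<in> test_functions" for f i
    using L2norm_wD_diff[OF test_H1[OF that(2)] that(1)]
      L2norm_diff_wD_cong(1)[OF test_H1[OF that(2)] test_pderiv_L2[OF that(2)] wD_L2[OF that(1)] wD_C1[OF test_Ck[OF that(2)]]]
    by simp
  then show ?thesis
    unfolding H10_def H1_norm_tendsto_0_iff by (auto; force)
qed

lemma H10_H1: "u \<in> H10 \<Longrightarrow> u \<in> H1" by (simp add: H10_def)

lemma H10E:
  assumes "u \<in> H10"
  obtains f where "\<And>m. f m \<in> test_functions" "(\<lambda>m. L2norm (\<lambda>x. f m x - u x)) \<longlonglongrightarrow> 0"
    "\<And>i. (\<lambda>m. L2norm (\<lambda>x. pderiv_at i (f m) x - wD i u x)) \<longlonglongrightarrow> 0"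
  using assms unfolding H10_iff by blast

lemma L2norm_axpy_tendsto_0:
  assumes "\<And>m. u m \<in> L2" "\<And>m. v m \<in> L2"
    "(\<lambda>m. L2norm (u m)) \<longlonglongrightarrow> 0" "(\<lambda>m. L2norm (v m)) \<longlonglongrightarrow> 0"
  shows "(\<lambda>m. L2norm (\<lambda>x. c * u m x + v m x)) \<longlonglongrightarrow> 0"
proof (rule Lim_null_comparison)
  show "(\<lambda>m. cmod c * L2norm (u m) + L2norm (v m)) \<longlonglongrightarrow> 0"
    using tendsto_add[OF tendsto_mult[OF tendsto_const assms(3)] assms(4)] by simp
  show "\<forall>\<^sub>F m in sequentially. norm (L2norm (\<lambda>x. c * u m x + v m x)) \<le> cmod c * L2norm (u m) + L2norm (v m)"
    using L2norm_triangle[OF L2_cmult[OF assms(1)] assms(2)] by (simp add: L2norm_cmult)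
qed

lemma H10_axpy:
  assumes "u \<in> H10" "v \<in> H10"
  shows "(\<lambda>x. c * u x + v x) \<in> H10"
proof -
  note u1 = H10_H1[OF assms(1)] and v1 = H10_H1[OF assms(2)]
  obtain f where f: "\<And>m. f m \<in> test_functions" "(\<lambda>m. L2norm (\<lambda>x. f m x - u x)) \<longlonglongrightarrow> 0"
    "\<And>i. (\<lambda>m. L2norm (\<lambda>x. pderiv_at i (f m) x - wD i u x)) \<longlonglongrightarrow> 0"
    by (rule H10E[OF assms(1)]) (rule that)
  obtain g where g: "\<And>m. g m \<in> test_functions" "(\<lambda>m. L2norm (\<lambda>x. g m x - v x)) \<longlonglongrightarrow> 0"
    "\<And>i. (\<lambda>m. L2norm (\<lambda>x. pderiv_at i (g m) x - wD i v x)) \<longlonglongrightarrow> 0"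
    by (rule H10E[OF assms(2)]) (rule that)
  have "(\<lambda>m. L2norm (\<lambda>x. c * f m x + g m x - (c * u x + v x))) \<longlonglongrightarrow> 0"
    using L2norm_axpy_tendsto_0[of "\<lambda>m x. f m x - u x" "\<lambda>m x. g m x - v x" c] f g
    by (simp add: L2_diff test_L2 H1_L2 u1 v1 algebra_simps)
  moreover have "(\<lambda>m. L2norm (\<lambda>x. pderiv_at i (\<lambda>x. c * f m x + g m x) x - wD i (\<lambda>x. c * u x + v x) x)) \<longlonglongrightarrow> 0" for i
  proof -
    have "L2norm (\<lambda>x. pderiv_at i (\<lambda>x. c * f m x + g m x) x - wD i (\<lambda>x. c * u x + v x) x) =
       L2norm (\<lambda>x. c * (pderiv_at i (f m) x - wD i u x) + (pderiv_at i (g m) x - wD i v x))" for m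
    proof -
      have 1: "pderiv_at i (\<lambda>x. c * f m x + g m x) = (\<lambda>x. c * pderiv_at i (f m) x + pderiv_at i (g m) x)"
        unfolding pderiv_at_add[OF Ck_cmult[OF test_Ck[OF f(1)]] test_Ck[OF g(1)]]
          pderiv_at_cmult[OF test_Ck[OF f(1)]] ..
      have "L2norm (\<lambda>x. pderiv_at i (\<lambda>x. c * f m x + g m x) x - wD i (\<lambda>x. c * u x + v x) x) =
          L2norm (\<lambda>x. pderiv_at i (\<lambda>x. c * f m x + g m x) x - (c * wD i u x + wD i v x))"
        by (rule L2norm_diff_wD_cong(2)[OF H1_axpy[OF u1 v1] _ _ wD_axpy[OF u1 v1]])
           (intro L2_add L2_cmult wD_L2 u1 v1 test_pderiv_L2 test_add test_cmult f g)+
      then show ?thesis unfolding 1 by (simp add: algebra_simps)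
    qed
    then show ?thesis
      using L2norm_axpy_tendsto_0[of "\<lambda>m x. pderiv_at i (f m) x - wD i u x" "\<lambda>m x. pderiv_at i (g m) x - wD i v x" c] f g
      by (simp add: L2_diff test_pderiv_L2 wD_L2 u1 v1)
  qed
  ultimately show ?thesis
    unfolding H10_iff using H1_axpy[OF u1 v1] test_add[OF test_cmult[OF f(1)] g(1)]
    by (intro conjI exI[of _ "\<lambda>m x. c * f m x + g m x"]) auto
qed

lemma H10_diff: "u \<in> H10 \<Longrightarrow> v \<in> H10 \<Longrightarrow> (\<lambda>x. u x - v x) \<in> H10"
  using H10_axpy[of v u "-1"] by simp

lemma eigfun_H10: "eigfun k \<in> H10"
proof -
  obtain f where f: "\<And>m. f m \<in> test_functions"
    "(\<lambda>m. L2norm (\<lambda>x. f m x - eigfun k x)) \<longlonglongrightarrow> 0"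
    "\<And>j. (\<lambda>m. L2norm (\<lambda>x. pderiv_at j (f m) x - pderiv_at j (eigfun k) x)) \<longlonglongrightarrow> 0"
    by (rule eigfun_test_approximation[of k]) (rule that)
  have "(\<lambda>m. L2norm (\<lambda>x. pderiv_at j (f m) x - wD j (eigfun k) x)) \<longlonglongrightarrow> 0" for j
    using f(3)[of j] L2norm_diff_wD_cong(2)[OF C1_H1[OF eigfun_Ck] pderiv_eigfun_L2 test_pderiv_L2[OF f(1)] wD_C1[OF eigfun_Ck]]
    by simp
  then show ?thesis unfolding H10_iff using f C1_H1[OF eigfun_Ck] by blast
qed

lemma zero_H10: "(\<lambda>x. 0) \<in> H10"
  using H10_diff[OF eigfun_H10 eigfun_H10, of undefined undefined] by simp

lemma H10_closed:
  fixes U :: "'n::finite cfun"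
  assumes s: "\<And>m. s m \<in> H10" and U: "U \<in> H1"
    and lim: "(\<lambda>m. L2norm (\<lambda>x. s m x - U x)) \<longlonglongrightarrow> 0"
      "\<And>i. (\<lambda>m. L2norm (\<lambda>x. wD i (s m) x - wD i U x)) \<longlonglongrightarrow> 0"
  shows "U \<in> H10"
proof -
  have s1: "s m \<in> H1" for m by (rule H10_H1[OF s])
  let ?close = "\<lambda>m f. L2norm (\<lambda>x. f x - s m x) < 1 / real (Suc m) \<and>
      (\<forall>i. L2norm (\<lambda>x. pderiv_at i f x - wD i (s m) x) < 1 / real (Suc m))"
  have "\<exists>f. f \<in> test_functions \<and> ?close m f" for m
  proof -
    obtain f where f: "\<And>l. f l \<in> test_functions" "(\<lambda>l. L2norm (\<lambda>x. f l x - s m x)) \<longlonglongrightarrow> 0"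
      "\<And>i. (\<lambda>l. L2norm (\<lambda>x. pderiv_at i (f l) x - wD i (s m) x)) \<longlonglongrightarrow> 0"
      by (rule H10E[OF s[of m]]) (rule that)
    have "\<forall>\<^sub>F l in sequentially. ?close m (f l)"
      by (intro eventually_conj eventually_all_finite order_tendstoD(2)[OF f(2)] order_tendstoD(2)[OF f(3)]) auto
    then obtain l where "?close m (f l)" by (auto simp: eventually_sequentially)
    with f(1) show ?thesis by blast
  qed
  then obtain f where f: "\<And>m. f m \<in> test_functions" "\<And>m. ?close m (f m)" by metis
  have inv: "(\<lambda>m. 1 / real (Suc m)) \<longlonglongrightarrow> 0" by real_asymp
  have "(\<lambda>m. L2norm (\<lambda>x. f m x - U x)) \<longlonglongrightarrow> 0"
  proof (rule Lim_null_comparison)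
    show "(\<lambda>m. 1 / real (Suc m) + L2norm (\<lambda>x. s m x - U x)) \<longlonglongrightarrow> 0"
      using tendsto_add[OF inv lim(1)] by simp
    have "L2norm (\<lambda>x. f m x - U x) \<le> 1 / real (Suc m) + L2norm (\<lambda>x. s m x - U x)" for m
      using L2norm_triangle_diff[OF test_L2[OF f(1)[of m]] H1_L2[OF s1[of m]] H1_L2[OF U]] conjunct1[OF f(2)[of m]] by linarith
    then show "\<forall>\<^sub>F m in sequentially. norm (L2norm (\<lambda>x. f m x - U x)) \<le> 1 / real (Suc m) + L2norm (\<lambda>x. s m x - U x)"
      by simp
  qed
  moreover have "(\<lambda>m. L2norm (\<lambda>x. pderiv_at i (f m) x - wD i U x)) \<longlonglongrightarrow> 0" for i
  proof (rule Lim_null_comparison)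
    show "(\<lambda>m. 1 / real (Suc m) + L2norm (\<lambda>x. wD i (s m) x - wD i U x)) \<longlonglongrightarrow> 0"
      using tendsto_add[OF inv lim(2)] by simp
    have "L2norm (\<lambda>x. pderiv_at i (f m) x - wD i U x) \<le> 1 / real (Suc m) + L2norm (\<lambda>x. wD i (s m) x - wD i U x)" for m
      using L2norm_triangle_diff[OF test_pderiv_L2[OF f(1)[of m], of i] wD_L2[OF s1[of m], of i] wD_L2[OF U, of i]]
        spec[OF conjunct2[OF f(2)[of m]], of i]
      by linarith
    then show "\<forall>\<^sub>F m in sequentially. norm (L2norm (\<lambda>x. pderiv_at i (f m) x - wD i U x)) \<le>
        1 / real (Suc m) + L2norm (\<lambda>x. wD i (s m) x - wD i U x)"
      by simp
  qed
  ultimately show ?thesis unfolding H10_iff using U f(1) by blast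
qed

lemma H10_integration_by_parts:
  assumes u: "u \<in> H10" and g: "Ck (Suc 0) g"
  shows "(LINT x|lebesgue_on Omega. wD i u x * g x) = - (LINT x|lebesgue_on Omega. u x * pderiv_at i g x)"
proof -
  obtain f where f: "\<And>m. f m \<in> test_functions" "(\<lambda>m. L2norm (\<lambda>x. f m x - u x)) \<longlonglongrightarrow> 0"
    "\<And>i. (\<lambda>m. L2norm (\<lambda>x. pderiv_at i (f m) x - wD i u x)) \<longlonglongrightarrow> 0"
    by (rule H10E[OF u]) (rule that)
  have gL: "g \<in> L2" "pderiv_at i g \<in> L2"
    using Ck_Suc_continuous[OF g] g by (auto intro: continuous_L2)
  have "(\<lambda>m. LINT x|lebesgue_on Omega. pderiv_at i (f m) x * g x) \<longlonglongrightarrow> (LINT x|lebesgue_on Omega. wD i u x * g x)"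
    by (rule L2_integral_tendsto[OF test_pderiv_L2[OF f(1)] wD_L2[OF H10_H1[OF u]] gL(1) f(3)])
  moreover have "(LINT x|lebesgue_on Omega. pderiv_at i (f m) x * g x) = - (LINT x|lebesgue_on Omega. f m x * pderiv_at i g x)" for m
    using integration_by_parts[OF g f(1)] by (simp add: mult.commute)
  moreover have "(\<lambda>m. - (LINT x|lebesgue_on Omega. f m x * pderiv_at i g x)) \<longlonglongrightarrow> - (LINT x|lebesgue_on Omega. u x * pderiv_at i g x)"
    by (intro tendsto_minus L2_integral_tendsto[OF test_L2[OF f(1)] H1_L2[OF H10_H1[OF u]] gL(2) f(2)])
  ultimately show ?thesis by (simp add: LIMSEQ_unique)
qed

text \<open>
  Since \<open>\<partial>\<^sub>i x\<^sub>i = 1\<close>, integrating \<open>\<bar>f\<bar>\<^sup>2\<close> by parts in direction \<open>i\<close> against \<open>x\<^sub>i\<close> gives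
  \<open>\<integral> \<bar>f\<bar>\<^sup>2 = - 2 Re \<integral> x\<^sub>i cnj f \<partial>\<^sub>i f\<close>, and \<open>x\<^sub>i\<close> is bounded by 1 on the cube.
\<close>

lemma Poincare_test:
  fixes f :: "'n::finite cfun"
  assumes f: "f \<in> test_functions"
  shows "L2norm f \<le> 2 * L2norm (pderiv_at i f)"
proof -
  let ?c = "\<lambda>x::real^'n. complex_of_real (x $ i)" and ?M = "lebesgue_on (Omega :: (real^'n) set)"
  have der: "(?c has_derivative (\<lambda>h. of_real (h $ i))) (at x)" for x
    by (intro has_derivative_of_real bounded_linear.has_derivative[OF bounded_linear_vec_nth has_derivative_ident])
  have c1: "Ck (Suc 0) ?c"
    by (rule Ck_SucI[OF der]) simp
  have cd: "pderiv_at i ?c = (\<lambda>x. 1)" by (simp add: pderiv_at_eq[OF der])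
  note fC = test_Ck[OF f, of "Suc 0"]
  note g1 = C1_mult[OF c1 C1_cnj[OF fC]]
  have fL: "f \<in> L2" and dL: "pderiv_at i f \<in> L2" by (intro test_L2 test_pderiv_L2 f)+
  have cb: "cmod (?c x) \<le> 1" if "x \<in> Omega" for x
    using that by (simp add: Omega_def abs_le_iff less_imp_le)
  have cm: "?c \<in> borel_measurable ?M"
    by (rule continuous_imp_Omega_measurable[OF Ck_Suc_continuous[OF c1]])
  have bd: "cmod (LINT x|?M. ?c x * u x * v x) \<le> L2norm u * L2norm v" if uv: "u \<in> L2" "v \<in> L2" for u v
  proof -
    have cu: "(\<lambda>x. ?c x * u x) \<in> L2" by (rule L2_mult_bounded[OF uv(1) cm cb])
    have "cmod (LINT x|?M. ?c x * u x * v x) \<le> L2norm (\<lambda>x. ?c x * u x) * L2norm v"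
      by (rule L2_Cauchy_Schwarz[OF cu uv(2)])
    also have "L2norm (\<lambda>x. ?c x * u x) \<le> L2norm u"
      unfolding L2norm_def
    proof (intro real_sqrt_le_mono integral_mono L2D(2)[OF cu] L2D(2)[OF uv(1)])
      fix x :: "real^'n" assume "x \<in> space ?M"
      then have "cmod (?c x) \<le> 1" using cb by simp
      then show "(cmod (?c x * u x))\<^sup>2 \<le> (cmod (u x))\<^sup>2"
        by (intro power_mono) (auto simp: norm_mult mult_left_le_one_le)
    qed
    finally show ?thesis by (simp add: mult_right_mono)
  qed
  have cn: "(\<lambda>x. cnj (f x)) \<in> L2" "(\<lambda>x. cnj (pderiv_at i f x)) \<in> L2"
    by (intro L2_cnj fL dL)+
  have cnL: "L2norm (\<lambda>x. cnj (u x)) = L2norm u" for u :: "'n cfun" by (simp add: L2norm_def)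
  have ints: "integrable ?M (\<lambda>x. ?c x * cnj (pderiv_at i f x) * f x)" "integrable ?M (\<lambda>x. cnj (f x) * f x)"
    by (intro L2_mult_integrable[OF L2_mult_bounded[OF cn(2) cm cb] fL], assumption)
       (rule L2_mult_integrable[OF cn(1) fL])
  have "(LINT x|?M. ?c x * cnj (f x) * pderiv_at i f x) =
     - (LINT x|?M. (?c x * cnj (pderiv_at i f x) + cnj (f x)) * f x)"
    using integration_by_parts[OF g1 f, of i]
    unfolding pderiv_at_mult[OF c1 C1_cnj[OF fC]] pderiv_at_cnj[OF fC] cd by simp
  also have "\<dots> = - (LINT x|?M. ?c x * cnj (pderiv_at i f x) * f x) - (LINT x|?M. cnj (f x) * f x)"
    using ints by (simp add: distrib_right)
  finally have eq: "(LINT x|?M. cnj (f x) * f x) =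
     - (LINT x|?M. ?c x * cnj (pderiv_at i f x) * f x) - (LINT x|?M. ?c x * cnj (f x) * pderiv_at i f x)"
    by (simp add: algebra_simps)
  have "cnj z * z = of_real ((cmod z)\<^sup>2)" for z
    by (metis complex_norm_square mult.commute)
  then have "(LINT x|?M. cnj (f x) * f x) = of_real ((L2norm f)\<^sup>2)"
    unfolding L2norm_sq by (simp flip: integral_complex_of_real)
  then have "(L2norm f)\<^sup>2 = cmod (LINT x|?M. cnj (f x) * f x)" by (simp add: norm_power)
  also have "\<dots> \<le> cmod (LINT x|?M. ?c x * cnj (pderiv_at i f x) * f x) + cmod (LINT x|?M. ?c x * cnj (f x) * pderiv_at i f x)"
    unfolding eq by (rule order_trans[OF norm_triangle_ineq4]) simp
  also have "\<dots> \<le> L2norm (pderiv_at i f) * L2norm f + L2norm f * L2norm (pderiv_at i f)"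
    using bd[OF cn(2) fL] bd[OF cn(1) dL] unfolding cnL by (rule add_mono)
  finally have "L2norm f * L2norm f \<le> (2 * L2norm (pderiv_at i f)) * L2norm f"
    by (simp add: power2_eq_square mult.commute)
  then show ?thesis
    by (cases "L2norm f = 0") (auto simp: less_le)
qed

lemma Poincare:
  assumes u: "u \<in> H10"
  shows "L2norm u \<le> 2 * L2norm (wD i u)"
proof -
  obtain f where f: "\<And>m. f m \<in> test_functions" "(\<lambda>m. L2norm (\<lambda>x. f m x - u x)) \<longlonglongrightarrow> 0"
    "\<And>i. (\<lambda>m. L2norm (\<lambda>x. pderiv_at i (f m) x - wD i u x)) \<longlonglongrightarrow> 0"
    by (rule H10E[OF u]) (rule that)
  have "(\<lambda>m. L2norm (f m)) \<longlonglongrightarrow> L2norm u"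
    by (rule L2norm_tendsto[OF test_L2[OF f(1)] H1_L2[OF H10_H1[OF u]] f(2)])
  moreover have "(\<lambda>m. 2 * L2norm (pderiv_at i (f m))) \<longlonglongrightarrow> 2 * L2norm (wD i u)"
    by (intro tendsto_intros L2norm_tendsto[OF test_pderiv_L2[OF f(1)] wD_L2[OF H10_H1[OF u]] f(3)])
  ultimately show ?thesis
    by (rule LIMSEQ_le) (use Poincare_test[OF f(1)] in blast)
qed

text \<open>
  Only the gradients are assumed to be Cauchy: the Poincare inequality supplies the rest. This is
  what the energy norm controls when \<open>\<alpha> = 0\<close>.
\<close>

lemma H10_complete:
  fixes s :: "nat \<Rightarrow> 'n::finite cfun"
  assumes s: "\<And>m. s m \<in> H10"
    and C: "\<And>i e. e > 0 \<Longrightarrow> \<exists>K. \<forall>m\<ge>K. \<forall>l\<ge>K. L2norm (\<lambda>x. wD i (s m) x - wD i (s l) x) < e"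
  obtains U where "U \<in> H10" "\<And>i. (\<lambda>m. L2norm (\<lambda>x. wD i (s m) x - wD i U x)) \<longlonglongrightarrow> 0"
proof -
  have s1: "s m \<in> H1" for m by (rule H10_H1[OF s])
  have "\<exists>v\<in>L2. (\<lambda>m. L2norm (\<lambda>x. wD i (s m) x - v x)) \<longlonglongrightarrow> 0" for i
    by (rule L2_complete[OF wD_L2[OF s1] C])
  then obtain G where G: "\<And>i. G i \<in> L2" "\<And>i. (\<lambda>m. L2norm (\<lambda>x. wD i (s m) x - G i x)) \<longlonglongrightarrow> 0"
    by metis
  have "\<exists>K. \<forall>m\<ge>K. \<forall>l\<ge>K. L2norm (\<lambda>x. s m x - s l x) < e" if e: "e > 0" for e
  proof -
    obtain K where K: "\<forall>m\<ge>K. \<forall>l\<ge>K. L2norm (\<lambda>x. wD undefined (s m) x - wD undefined (s l) x) < e / 2"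
      using C[OF half_gt_zero[OF e], of undefined] by blast
    have "L2norm (\<lambda>x. s m x - s l x) < e" if "m \<ge> K" "l \<ge> K" for m l
      using K that Poincare[OF H10_diff[OF s s], of m l undefined] by (force simp: L2norm_wD_diff s1)
    then show ?thesis by blast
  qed
  then have "\<exists>v\<in>L2. (\<lambda>m. L2norm (\<lambda>x. s m x - v x)) \<longlonglongrightarrow> 0"
    by (rule L2_complete[OF H1_L2[OF s1]])
  then obtain U where U: "U \<in> L2" "(\<lambda>m. L2norm (\<lambda>x. s m x - U x)) \<longlonglongrightarrow> 0"
    by (rule bexE)
  have wU: "weak_pderiv i U (G i)" for i
    by (rule weak_pderiv_limit[OF wD_weak_pderiv[OF s1] U(1) G(1) U(2) G(2)])
  have U1: "U \<in> H1" by (rule H1I[OF wU])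
  have lim: "(\<lambda>m. L2norm (\<lambda>x. wD i (s m) x - wD i U x)) \<longlonglongrightarrow> 0" for i
    unfolding L2norm_diff_wD_cong(2)[OF U1 G(1) wD_L2[OF s1] wD_AE[OF wU]] by (rule G(2))
  show thesis by (rule that[OF H10_closed[OF s U1 U(2) lim] lim])
qed

section \<open>Orthonormality of the sine products\<close>

lemma nn_integral_sin_sq:
  assumes "1 \<le> (k::nat)"
  shows "(\<integral>\<^sup>+t. ennreal (2 * (sin (real k * pi * t))\<^sup>2) * indicator {0<..<1} t \<partial>lborel) = 1"
proof -
  let ?F = "\<lambda>t. t - sin (2 * (real k * pi * t)) / (2 * real k * pi)"
  have F1: "?F 1 = 1"
    using sin_npi[of "2 * k"] by (simp add: mult.assoc)
  have "(\<integral>\<^sup>+t. ennreal (2 * (sin (real k * pi * t))\<^sup>2) * indicator {0<..<1} t \<partial>lborel)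
      = (\<integral>\<^sup>+t. ennreal (2 * (sin (real k * pi * t))\<^sup>2) * indicator {0..1} t \<partial>lborel)"
    using AE_lborel_singleton[of "0::real"] AE_lborel_singleton[of "1::real"]
    by (intro nn_integral_cong_AE) (auto simp: indicator_def)
  also have "\<dots> = ennreal (?F 1 - ?F 0)"
  proof (rule nn_integral_FTC_Icc[where F="?F"])
    fix t :: real
    have "(?F has_real_derivative 1 - cos (2 * (real k * pi * t))) (at t)"
      using assms by (auto intro!: derivative_eq_intros)
    then show "(?F has_real_derivative 2 * (sin (real k * pi * t))\<^sup>2) (at t)"
      by (simp add: cos_double_sin)
  qed auto
  finally show ?thesis using F1 by simp
qed

lemma prod_Basis_vec:
  "(\<Prod>b\<in>(Basis :: (real^'n::finite) set). f b) = (\<Prod>i\<in>UNIV. f (axis i 1))"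
proof -
  have B: "(Basis :: (real^'n) set) = range (\<lambda>i. axis i 1)"
    by (auto simp: Basis_vec_def)
  have I: "inj (\<lambda>i::'n. axis i (1::real))" by (auto simp: inj_on_def axis_eq_axis)
  show ?thesis unfolding B by (subst prod.reindex[OF I]) simp
qed

text \<open>
  The square of \<open>eigfun k\<close> is the product over the coordinates of \<open>2 (sin (k\<^sub>i \<pi> x\<^sub>i))\<^sup>2\<close>, and Lebesgue
  measure is a product measure; each factor integrates to 1.
\<close>

lemma L2norm_eigfun:
  fixes k :: "nat ^ 'n::finite"
  assumes k: "\<And>i. 1 \<le> k $ i"
  shows "L2norm (eigfun k) = 1"
proof -
  let ?f = "\<lambda>(b::real^'n) t. ennreal (2 * (sin (real (k $ axis_index b) * pi * t))\<^sup>2) * indicator {0<..<1} t"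
  have sq: "(cmod (eigfun k x))\<^sup>2 = (\<Prod>i\<in>UNIV. 2 * (sin (real (k $ i) * pi * x $ i))\<^sup>2)" for x
  proof -
    have "(cmod (eigfun k x))\<^sup>2 = (2 powr (real CARD('n) / 2))\<^sup>2 * (\<Prod>i\<in>UNIV. (sin (real (k $ i) * pi * x $ i))\<^sup>2)"
      unfolding eigfun_def norm_of_real by (simp add: power_mult_distrib prod_power_distrib)
    also have "(2 powr (real CARD('n) / 2))\<^sup>2 = (\<Prod>i\<in>(UNIV::'n set). (2::real))"
      by (simp add: powr_realpow[symmetric] powr_powr[symmetric] power2_eq_square powr_add[symmetric])
    finally show ?thesis by (simp only: prod.distrib)
  qed
  have "ennreal ((L2norm (eigfun k))\<^sup>2) = (\<integral>\<^sup>+x. ennreal ((cmod (eigfun k x))\<^sup>2) \<partial>lebesgue_on Omega)"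
    using L2norm_nn[OF eigfun_L2, of k] by (simp add: ennreal_power)
  also have "\<dots> = (\<integral>\<^sup>+x. ennreal ((cmod (eigfun k x))\<^sup>2) * indicator Omega x \<partial>lebesgue)"
    by (rule nn_integral_restrict_space) simp
  also have "\<dots> = (\<integral>\<^sup>+x. ennreal ((cmod (eigfun k x))\<^sup>2) * indicator Omega x \<partial>lborel)"
    by (rule nn_integral_completion)
  also have "\<dots> = (\<integral>\<^sup>+x. (\<Prod>b\<in>Basis. ?f b (x \<bullet> b)) \<partial>lborel)"
  proof (rule nn_integral_cong)
    fix x :: "real^'n"
    have "(\<Prod>b\<in>Basis. ?f b (x \<bullet> b)) = (\<Prod>i\<in>UNIV. ennreal (2 * (sin (real (k $ i) * pi * x $ i))\<^sup>2) * indicator {0<..<1} (x $ i))"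
      by (simp add: prod_Basis_vec inner_axis)
    also have "\<dots> = ennreal ((cmod (eigfun k x))\<^sup>2) * (\<Prod>i\<in>UNIV. indicator {0<..<1} (x $ i))"
      unfolding sq by (simp add: prod.distrib prod_ennreal)
    also have "(\<Prod>i\<in>UNIV. indicator {0<..<1} (x $ i)) = (indicator Omega x :: ennreal)"
      by (auto simp: indicator_def Omega_def intro!: prod_zero)
    finally show "ennreal ((cmod (eigfun k x))\<^sup>2) * indicator Omega x = (\<Prod>b\<in>Basis. ?f b (x \<bullet> b))" by simp
  qed
  also have "\<dots> = (\<Prod>b\<in>Basis. (\<integral>\<^sup>+t. ?f b t \<partial>lborel))"
    by (rule nn_integral_lborel_prod) auto
  also have "\<dots> = 1" by (intro prod.neutral ballI nn_integral_sin_sq k)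
  finally have "(L2norm (eigfun k))\<^sup>2 = 1\<^sup>2" by simp
  then show ?thesis by (rule power2_eq_imp_eq) simp_all
qed

lemma L2_mult_measurable:
  "u \<in> L2 \<Longrightarrow> v \<in> L2 \<Longrightarrow> (\<lambda>x. u x * v x) \<in> borel_measurable (lebesgue_on Omega)"
  by (intro borel_measurable_times L2D(1))

lemma H10_eigfun_by_parts:
  assumes "u \<in> H10"
  shows "(LINT x|lebesgue_on Omega. wD j u x * pderiv_at j (eigfun l) x) =
     of_real ((pi * real (l $ j))\<^sup>2) * (LINT x|lebesgue_on Omega. u x * eigfun l x)"
proof -
  have "(LINT x|lebesgue_on Omega. wD j u x * pderiv_at j (eigfun l) x) =
      - (LINT x|lebesgue_on Omega. - of_real ((pi * real (l $ j))\<^sup>2) * (u x * eigfun l x))"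
    unfolding H10_integration_by_parts[OF assms pderiv_eigfun_Ck] pderiv_pderiv_eigfun
    by (simp add: mult_ac)
  then show ?thesis by simp
qed

text \<open>
  Two sine products with \<open>k $ j \<noteq> l $ j\<close> are eigenfunctions of the symmetric operator \<open>\<partial>\<^sub>j\<^sup>2\<close> for
  different eigenvalues.
\<close>

lemma eigfun_orthonormal:
  fixes k l :: "nat ^ 'n::finite"
  assumes "\<And>i. 1 \<le> k $ i"
  shows "(LINT x|lebesgue_on Omega. eigfun k x * eigfun l x) = (if k = l then 1 else 0)"
proof (cases "k = l")
  case True
  have "eigfun k x * eigfun k x = of_real ((cmod (eigfun k x))\<^sup>2)" for x
    by (metis complex_norm_square eigfun_real of_real_power)
  then have "(LINT x|lebesgue_on Omega. eigfun k x * eigfun k x) = of_real ((L2norm (eigfun k))\<^sup>2)"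
    unfolding L2norm_sq by (simp flip: integral_complex_of_real)
  then show ?thesis using True L2norm_eigfun[OF assms] by simp
next
  case False
  then obtain j where j: "k $ j \<noteq> l $ j" by (auto simp: vec_eq_iff)
  let ?I = "LINT x|lebesgue_on Omega. eigfun k x * eigfun l x"
  have eq: "(LINT x|lebesgue_on Omega. pderiv_at j (eigfun p) x * pderiv_at j (eigfun q) x) =
      of_real ((pi * real (q $ j))\<^sup>2) * (LINT x|lebesgue_on Omega. eigfun p x * eigfun q x)" for p q :: "nat^'n"
  proof -
    have "(LINT x|lebesgue_on Omega. pderiv_at j (eigfun p) x * pderiv_at j (eigfun q) x) =
       (LINT x|lebesgue_on Omega. wD j (eigfun p) x * pderiv_at j (eigfun q) x)"
      using wD_C1[OF eigfun_Ck, of j p]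
      by (intro integral_cong_AE)
         (auto intro!: L2_mult_measurable wD_L2 H10_H1 eigfun_H10 pderiv_eigfun_L2)
    then show ?thesis by (simp only: H10_eigfun_by_parts[OF eigfun_H10])
  qed
  have "of_real ((pi * real (l $ j))\<^sup>2) * ?I = of_real ((pi * real (k $ j))\<^sup>2) * ?I"
    using eq[of k l] eq[of l k] by (simp add: mult.commute)
  then have "?I = 0 \<or> (pi * real (l $ j))\<^sup>2 = (pi * real (k $ j))\<^sup>2"
    unfolding mult_cancel_right of_real_eq_iff by blast
  moreover have "(pi * real (l $ j))\<^sup>2 \<noteq> (pi * real (k $ j))\<^sup>2"
    using j by (simp add: power_mult_distrib)
  ultimately show ?thesis using False by simp
qed

section \<open>The energy inner product\<close>

definition axpy :: "complex \<Rightarrow> 'n::finite state \<Rightarrow> 'n state \<Rightarrow> 'n state" where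
  "axpy c \<Phi> \<Psi> = ((\<lambda>x. c * fst \<Phi> x + fst \<Psi> x), (\<lambda>x. c * snd \<Phi> x + snd \<Psi> x))"

lemma energy_spaceD:
  assumes "\<Phi> \<in> energy_space"
  shows "fst \<Phi> \<in> H10" "fst \<Phi> \<in> H1" "fst \<Phi> \<in> L2" "wD i (fst \<Phi>) \<in> L2" "snd \<Phi> \<in> L2"
  using assms by (auto simp: energy_space_def H10_H1 H1_L2 wD_L2)

lemma axpy_energy: "\<Phi> \<in> energy_space \<Longrightarrow> \<Psi> \<in> energy_space \<Longrightarrow> axpy c \<Phi> \<Psi> \<in> energy_space"
  by (auto simp: energy_space_def axpy_def intro: H10_axpy intro!: L2_add L2_cmult)

lemma inner_E_split:
  assumes "\<Phi> \<in> energy_space" "\<Psi> \<in> energy_space"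
  shows "inner_E \<alpha> \<Phi> \<Psi> =
    (\<Sum>i\<in>UNIV. LINT x|lebesgue_on Omega. wD i (fst \<Phi>) x * cnj (wD i (fst \<Psi>) x)) +
    of_real \<alpha> * (LINT x|lebesgue_on Omega. fst \<Phi> x * cnj (fst \<Psi> x)) +
    (LINT x|lebesgue_on Omega. snd \<Phi> x * cnj (snd \<Psi> x))"
proof -
  have i: "integrable (lebesgue_on Omega) (\<lambda>x. wD i (fst \<Phi>) x * cnj (wD i (fst \<Psi>) x))" for i
    by (intro L2_mult_integrable L2_cnj energy_spaceD assms)
  have f: "integrable (lebesgue_on Omega) (\<lambda>x. fst \<Phi> x * cnj (fst \<Psi> x))"
    by (intro L2_mult_integrable L2_cnj energy_spaceD assms)
  show ?thesis unfolding inner_E_def by (simp add: i f mult.assoc)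
qed

lemma inner_E_axpy:
  assumes "\<Phi> \<in> energy_space" "\<Psi> \<in> energy_space" "\<Theta> \<in> energy_space"
  shows "inner_E \<alpha> (axpy c \<Phi> \<Psi>) \<Theta> = c * inner_E \<alpha> \<Phi> \<Theta> + inner_E \<alpha> \<Psi> \<Theta>"
proof -
  have lin: "(LINT x|lebesgue_on Omega. (c * u x + v x) * w x) =
     c * (LINT x|lebesgue_on Omega. u x * w x) + (LINT x|lebesgue_on Omega. v x * w x)"
    if "u \<in> L2" "v \<in> L2" "w \<in> L2" for u v w :: "'a cfun"
    using that by (simp add: distrib_right mult.assoc L2_mult_integrable)
  have "(LINT x|lebesgue_on Omega. wD i (fst (axpy c \<Phi> \<Psi>)) x * cnj (wD i (fst \<Theta>) x)) =
     (LINT x|lebesgue_on Omega. (c * wD i (fst \<Phi>) x + wD i (fst \<Psi>) x) * cnj (wD i (fst \<Theta>) x))" for i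
  proof (rule integral_cong_AE)
    show "AE x in lebesgue_on Omega. wD i (fst (axpy c \<Phi> \<Psi>)) x * cnj (wD i (fst \<Theta>) x) =
       (c * wD i (fst \<Phi>) x + wD i (fst \<Psi>) x) * cnj (wD i (fst \<Theta>) x)"
      using wD_axpy[OF energy_spaceD(2)[OF assms(1)] energy_spaceD(2)[OF assms(2)], of i c]
      by (auto simp: axpy_def)
  qed (intro L2_mult_measurable L2_cnj L2_add L2_cmult energy_spaceD axpy_energy assms)+
  moreover have "(LINT x|lebesgue_on Omega. (c * wD i (fst \<Phi>) x + wD i (fst \<Psi>) x) * cnj (wD i (fst \<Theta>) x)) = c * (LINT x|lebesgue_on Omega. wD i (fst \<Phi>) x * cnj (wD i (fst \<Theta>) x)) +
      (LINT x|lebesgue_on Omega. wD i (fst \<Psi>) x * cnj (wD i (fst \<Theta>) x))" for i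
    by (intro lin L2_cnj energy_spaceD assms)
  ultimately have grad: "(LINT x|lebesgue_on Omega. wD i (fst (axpy c \<Phi> \<Psi>)) x * cnj (wD i (fst \<Theta>) x)) =
      c * (LINT x|lebesgue_on Omega. wD i (fst \<Phi>) x * cnj (wD i (fst \<Theta>) x)) +
      (LINT x|lebesgue_on Omega. wD i (fst \<Psi>) x * cnj (wD i (fst \<Theta>) x))" for i
    by simp
  have f: "(LINT x|lebesgue_on Omega. fst (axpy c \<Phi> \<Psi>) x * cnj (fst \<Theta> x)) =
      c * (LINT x|lebesgue_on Omega. fst \<Phi> x * cnj (fst \<Theta> x)) + (LINT x|lebesgue_on Omega. fst \<Psi> x * cnj (fst \<Theta> x))"
    unfolding axpy_def fst_conv by (intro lin L2_cnj energy_spaceD assms)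
  have s: "(LINT x|lebesgue_on Omega. snd (axpy c \<Phi> \<Psi>) x * cnj (snd \<Theta> x)) =
      c * (LINT x|lebesgue_on Omega. snd \<Phi> x * cnj (snd \<Theta> x)) + (LINT x|lebesgue_on Omega. snd \<Psi> x * cnj (snd \<Theta> x))"
    unfolding axpy_def snd_conv by (intro lin L2_cnj energy_spaceD assms)
  show ?thesis
    unfolding inner_E_split[OF axpy_energy[OF assms(1,2)] assms(3)] inner_E_split[OF assms(1,3)] inner_E_split[OF assms(2,3)]
      grad f s
    by (simp add: sum.distrib sum_distrib_left distrib_left mult_ac)
qed

lemma inner_E_commute: "inner_E \<alpha> \<Psi> \<Phi> = cnj (inner_E \<alpha> \<Phi> \<Psi>)"
  unfolding inner_E_def by (simp add: mult_ac flip: Bochner_Integration.integral_cnj)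

lemma norm_E_sq:
  assumes "\<alpha> \<ge> 0" "\<Phi> \<in> energy_space"
  shows "(norm_E \<alpha> \<Phi>)\<^sup>2 = (\<Sum>i\<in>UNIV. (L2norm (wD i (fst \<Phi>)))\<^sup>2) + \<alpha> * (L2norm (fst \<Phi>))\<^sup>2 + (L2norm (snd \<Phi>))\<^sup>2"
    "inner_E \<alpha> \<Phi> \<Phi> = of_real ((norm_E \<alpha> \<Phi>)\<^sup>2)"
proof -
  have L: "(LINT x|lebesgue_on Omega. u x * cnj (u x)) = of_real ((L2norm u)\<^sup>2)" for u :: "'a cfun"
    unfolding L2norm_sq by (simp only: complex_norm_square[symmetric] integral_complex_of_real)
  have eq: "inner_E \<alpha> \<Phi> \<Phi> = of_real ((\<Sum>i\<in>UNIV. (L2norm (wD i (fst \<Phi>)))\<^sup>2) + \<alpha> * (L2norm (fst \<Phi>))\<^sup>2 + (L2norm (snd \<Phi>))\<^sup>2)"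
    unfolding inner_E_split[OF assms(2,2)] L by simp
  have nn: "0 \<le> (\<Sum>i\<in>UNIV. (L2norm (wD i (fst \<Phi>)))\<^sup>2) + \<alpha> * (L2norm (fst \<Phi>))\<^sup>2 + (L2norm (snd \<Phi>))\<^sup>2"
    using assms(1) by (intro add_nonneg_nonneg sum_nonneg) auto
  show 1: "(norm_E \<alpha> \<Phi>)\<^sup>2 = (\<Sum>i\<in>UNIV. (L2norm (wD i (fst \<Phi>)))\<^sup>2) + \<alpha> * (L2norm (fst \<Phi>))\<^sup>2 + (L2norm (snd \<Phi>))\<^sup>2"
    unfolding norm_E_def eq Re_complex_of_real using nn by (rule real_sqrt_pow2)
  show "inner_E \<alpha> \<Phi> \<Phi> = of_real ((norm_E \<alpha> \<Phi>)\<^sup>2)" unfolding 1 by (rule eq)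
qed

section \<open>Fourier coefficients of states\<close>

lemma mode_omega_sq:
  "\<alpha> \<ge> 0 \<Longrightarrow> (mode_omega \<alpha> p)\<^sup>2 = pi\<^sup>2 * real (sqsum (fst p)) + \<alpha>"
  by (simp add: mode_omega_def power_mult_distrib add_nonneg_nonneg)

lemma sqsum_pos:
  fixes k :: "nat ^ 'n::finite"
  assumes "\<And>i. 1 \<le> k $ i" shows "0 < sqsum k"
  unfolding sqsum_def using assms by (intro sum_pos) (auto simp: Suc_le_eq)

lemma mode_omega_nonzero:
  assumes "\<alpha> \<ge> 0" "p \<in> modes" shows "mode_omega \<alpha> p \<noteq> 0"
proof -
  have "0 < sqsum (fst p)" by (rule sqsum_pos) (use assms(2) in \<open>auto simp: modes_def\<close>)
  then have "(mode_omega \<alpha> p)\<^sup>2 > 0" using assms(1) by (simp add: mode_omega_sq add_pos_nonneg)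
  then show ?thesis by auto
qed

lemma mode_state_energy: "mode_state \<alpha> p \<in> energy_space"
proof -
  have "(\<lambda>x. c * eigfun k x) \<in> H10" for c and k :: "nat^'a"
    using H10_axpy[OF eigfun_H10 zero_H10] by simp
  from this[of "1 / (of_real (sqrt 2) * (\<i> * of_real (mode_omega \<alpha> p)))"]
  have "fst (mode_state \<alpha> p) \<in> H10" by (simp add: mode_state_def)
  moreover have "snd (mode_state \<alpha> p) \<in> L2"
    unfolding mode_state_def snd_conv by (intro L2_cmult L2_uminus eigfun_L2)
  ultimately show ?thesis by (simp add: energy_space_def mem_Times_iff)
qed

text \<open>
  Integration by parts turns the energy product with the first component of the mode into
  \<open>(\<pi>\<^sup>2 sqsum k + \<alpha>) \<integral> u e\<^sub>k\<close> times \<open>cnj (1 / (\<i> \<omega> sqrt 2))\<close>, and the bracket is \<open>\<omega>\<^sup>2\<close>.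
\<close>

lemma inner_E_mode:
  assumes a: "\<alpha> \<ge> 0" and p: "p \<in> modes" and \<Phi>: "\<Phi> \<in> energy_space"
  shows "inner_E \<alpha> \<Phi> (mode_state \<alpha> p) = of_real (1 / sqrt 2) *
    (\<i> * of_real (mode_omega \<alpha> p) * (LINT x|lebesgue_on Omega. fst \<Phi> x * eigfun (fst p) x)
      - (LINT x|lebesgue_on Omega. snd \<Phi> x * eigfun (fst p) x))"
proof -
  let ?M = "lebesgue_on (Omega :: (real^'a) set)" and ?k = "fst p" and ?w = "mode_omega \<alpha> p"
  let ?U = "LINT x|?M. fst \<Phi> x * eigfun ?k x"
  define c where "c = of_real (1 / sqrt 2) / (\<i> * complex_of_real ?w)"
  have w0: "?w \<noteq> 0" by (rule mode_omega_nonzero[OF a p])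
  have cc: "cnj c = of_real (1 / sqrt 2) * \<i> / of_real ?w"
    using w0 by (simp add: c_def field_simps)
  have f: "fst (mode_state \<alpha> p) = (\<lambda>x. c * eigfun ?k x)"
    by (simp add: mode_state_def c_def)
  note uD = energy_spaceD[OF \<Phi>]
  have "(LINT x|?M. wD i (fst \<Phi>) x * cnj (wD i (fst (mode_state \<alpha> p)) x)) = cnj c * (of_real ((pi * real (?k $ i))\<^sup>2) * ?U)" for i
  proof -
    have "AE x in ?M. wD i (fst (mode_state \<alpha> p)) x = c * pderiv_at i (eigfun ?k) x"
      unfolding f using wD_C1[OF Ck_cmult[OF eigfun_Ck]] by (simp add: pderiv_at_cmult[OF eigfun_Ck])
    then have "(LINT x|?M. wD i (fst \<Phi>) x * cnj (wD i (fst (mode_state \<alpha> p)) x)) =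
        (LINT x|?M. wD i (fst \<Phi>) x * (cnj c * pderiv_at i (eigfun ?k) x))"
      by (intro integral_cong_AE)
         (auto simp: pderiv_eigfun_real intro!: L2_mult_measurable L2_cnj L2_cmult uD energy_spaceD[OF mode_state_energy] pderiv_eigfun_L2)
    then show ?thesis
      by (simp only: mult.left_commute[of _ "cnj c"] integral_mult_right_zero H10_eigfun_by_parts[OF uD(1)])
  qed
  moreover have "(LINT x|?M. fst \<Phi> x * cnj (fst (mode_state \<alpha> p) x)) = cnj c * ?U"
  proof -
    have "(\<lambda>x. fst \<Phi> x * cnj (fst (mode_state \<alpha> p) x)) = (\<lambda>x. cnj c * (fst \<Phi> x * eigfun ?k x))"
      unfolding f by (simp add: eigfun_real mult_ac)
    then show ?thesis by (simp only: integral_mult_right_zero)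
  qed
  moreover have "(LINT x|?M. snd \<Phi> x * cnj (snd (mode_state \<alpha> p) x)) = of_real (- (1 / sqrt 2)) * (LINT x|?M. snd \<Phi> x * eigfun ?k x)"
  proof -
    have "(\<lambda>x. snd \<Phi> x * cnj (snd (mode_state \<alpha> p) x)) = (\<lambda>x. of_real (- (1 / sqrt 2)) * (snd \<Phi> x * eigfun ?k x))"
      by (auto simp: mode_state_def eigfun_real)
    then show ?thesis by (simp only: integral_mult_right_zero)
  qed
  ultimately have "inner_E \<alpha> \<Phi> (mode_state \<alpha> p) =
     (\<Sum>i\<in>UNIV. cnj c * (of_real ((pi * real (?k $ i))\<^sup>2) * ?U)) + of_real \<alpha> * (cnj c * ?U)
      + of_real (- (1 / sqrt 2)) * (LINT x|?M. snd \<Phi> x * eigfun ?k x)"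
    unfolding inner_E_split[OF \<Phi> mode_state_energy] by simp
  also have "(\<Sum>i\<in>UNIV. cnj c * (of_real ((pi * real (?k $ i))\<^sup>2) * ?U)) = cnj c * (of_real (pi\<^sup>2 * real (sqsum ?k)) * ?U)"
    by (simp add: sqsum_def sum_distrib_left sum_distrib_right power_mult_distrib mult_ac)
  also have "cnj c * (of_real (pi\<^sup>2 * real (sqsum ?k)) * ?U) + of_real \<alpha> * (cnj c * ?U) = cnj c * of_real (?w\<^sup>2) * ?U"
    unfolding mode_omega_sq[OF a] by (simp add: algebra_simps)
  also have "cnj c * of_real (?w\<^sup>2) = of_real (1 / sqrt 2) * (\<i> * of_real ?w)"
    unfolding cc using w0 by (simp add: power2_eq_square)
  finally show ?thesis by (simp add: algebra_simps)
qed

text \<open>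
  For equal multi-indices the product is \<open>(\<omega>\<^sub>p / \<omega>\<^sub>q + 1) / 2\<close>, which is 1 for equal and 0 for
  opposite signs.
\<close>

lemma mode_states_orthonormal:
  assumes a: "\<alpha> \<ge> 0" and p: "p \<in> modes" and q: "q \<in> modes"
  shows "inner_E \<alpha> (mode_state \<alpha> q) (mode_state \<alpha> p) = (if q = p then 1 else 0)"
proof -
  let ?M = "lebesgue_on (Omega :: (real^'a) set)"
  let ?I = "LINT x|?M. eigfun (fst q) x * eigfun (fst p) x"
  let ?wp = "complex_of_real (mode_omega \<alpha> p)" and ?wq = "complex_of_real (mode_omega \<alpha> q)"
  have I: "?I = (if fst q = fst p then 1 else 0)"
    by (rule eigfun_orthonormal) (use q in \<open>auto simp: modes_def\<close>)
  have w0: "?wp \<noteq> 0" "?wq \<noteq> 0" using mode_omega_nonzero[OF a p] mode_omega_nonzero[OF a q] by auto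
  have s: "complex_of_real (sqrt 2) * complex_of_real (sqrt 2) = 2"
    by (simp flip: of_real_mult)
  have f: "(LINT x|?M. fst (mode_state \<alpha> q) x * eigfun (fst p) x) = of_real (1 / sqrt 2) / (\<i> * ?wq) * ?I"
  proof -
    have "(\<lambda>x. fst (mode_state \<alpha> q) x * eigfun (fst p) x) = (\<lambda>x. of_real (1 / sqrt 2) / (\<i> * ?wq) * (eigfun (fst q) x * eigfun (fst p) x))"
      by (auto simp: mode_state_def)
    then show ?thesis by (simp only: integral_mult_right_zero)
  qed
  have g: "(LINT x|?M. snd (mode_state \<alpha> q) x * eigfun (fst p) x) = of_real (- (1 / sqrt 2)) * ?I"
  proof -
    have "(\<lambda>x. snd (mode_state \<alpha> q) x * eigfun (fst p) x) = (\<lambda>x. of_real (- (1 / sqrt 2)) * (eigfun (fst q) x * eigfun (fst p) x))"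
      by (auto simp: mode_state_def)
    then show ?thesis by (simp only: integral_mult_right_zero)
  qed
  have "inner_E \<alpha> (mode_state \<alpha> q) (mode_state \<alpha> p) = of_real (1 / sqrt 2) *
      (\<i> * ?wp * (of_real (1 / sqrt 2) / (\<i> * ?wq) * ?I) - of_real (- (1 / sqrt 2)) * ?I)"
    by (simp only: inner_E_mode[OF a p mode_state_energy] f g)
  also have "\<dots> = (1/2) * (?wp / ?wq + 1) * ?I"
    using w0 s by (simp add: field_simps)
  finally have eq: "inner_E \<alpha> (mode_state \<alpha> q) (mode_state \<alpha> p) = (1/2) * (?wp / ?wq + 1) * ?I" .
  consider "q = p" | "fst q \<noteq> fst p" | "fst q = fst p" "snd q \<noteq> snd p" by (auto simp: prod_eq_iff)
  then show ?thesis
  proof cases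
    case 3
    then have "mode_omega \<alpha> q = - mode_omega \<alpha> p" by (auto simp: mode_omega_def)
    then show ?thesis using eq w0 3 by auto
  qed (use eq I w0 in auto)
qed

text \<open>
  The two signs of a multi-index \<open>k\<close> give \<open>\<plusminus> \<i> \<omega> \<integral> u e\<^sub>k = \<integral> z e\<^sub>k\<close>, so both integrals vanish
  and completeness of the sine products applies to \<open>u\<close> and to \<open>z\<close>.
\<close>

lemma zero_E_of_coefficients:
  fixes \<Phi> :: "'n::finite state"
  assumes a: "\<alpha> \<ge> 0" and \<Phi>: "\<Phi> \<in> energy_space"
    and z: "\<And>p. p \<in> modes \<Longrightarrow> inner_E \<alpha> \<Phi> (mode_state \<alpha> p) = 0"
  shows "zero_E \<Phi>"
proof -
  have *: "(LINT x|lebesgue_on Omega. fst \<Phi> x * eigfun k x) = 0 \<and> (LINT x|lebesgue_on Omega. snd \<Phi> x * eigfun k x) = 0"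
    if k: "\<forall>i. 1 \<le> k $ i" for k :: "nat^'n"
  proof -
    let ?U = "LINT x|lebesgue_on Omega. fst \<Phi> x * eigfun k x" and ?Z = "LINT x|lebesgue_on Omega. snd \<Phi> x * eigfun k x"
    have m: "(k, s) \<in> modes" for s using k by (simp add: modes_def)
    define w where "w = mode_omega \<alpha> (k, True)"
    have w: "mode_omega \<alpha> (k, False) = - w" "w \<noteq> 0"
      using mode_omega_nonzero[OF a m[of True]] by (auto simp: w_def mode_omega_def)
    have "\<i> * of_real w * ?U - ?Z = 0" "\<i> * of_real (- w) * ?U - ?Z = 0"
      using z[OF m[of True]] z[OF m[of False]]
      unfolding inner_E_mode[OF a m \<Phi>] w(1) by (simp_all add: w_def)
    then show ?thesis using w(2) by (auto simp: algebra_simps) 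
  qed
  have "AE x in lebesgue_on Omega. fst \<Phi> x = 0" "AE x in lebesgue_on Omega. snd \<Phi> x = 0"
    by (rule sines_complete; use energy_spaceD[OF \<Phi>] * in blast)+
  then show ?thesis unfolding zero_E_def by eventually_elim simp
qed

section \<open>Enumeration of the modes\<close>

lemma lex_less_irrefl: "\<not> lex_less k k"
  by (simp add: lex_less_def)

lemma lex_less_trans: "lex_less k l \<Longrightarrow> lex_less l m \<Longrightarrow> lex_less k m"
proof -
  assume "lex_less k l" "lex_less l m"
  then obtain i j where i: "k $ i < l $ i" "\<forall>r<i. k $ r = l $ r" and j: "l $ j < m $ j" "\<forall>r<j. l $ r = m $ r"
    unfolding lex_less_def by blast
  have "k $ min i j < m $ min i j \<and> (\<forall>r<min i j. k $ r = m $ r)"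
    using i j by (cases i j rule: linorder_cases) (auto simp: min_def)
  then show "lex_less k m" unfolding lex_less_def by blast
qed

lemma lex_less_total: "k \<noteq> l \<Longrightarrow> lex_less k l \<or> lex_less l k"
proof -
  assume "k \<noteq> l"
  then have ne: "{i. k $ i \<noteq> l $ i} \<noteq> {}" by (auto simp: vec_eq_iff)
  \<comment> \<open>The first index at which the two multi-indices differ decides.\<close>
  define i where "i = Min {i. k $ i \<noteq> l $ i}"
  have "k $ i \<noteq> l $ i" using Min_in[OF _ ne] by (simp add: i_def)
  moreover have "k $ j = l $ j" if "j < i" for j
  proof (rule ccontr)
    assume "k $ j \<noteq> l $ j"
    then have "i \<le> j" unfolding i_def by (intro Min_le) auto
    with that show False by simp
  qed
  ultimately show ?thesis unfolding lex_less_def by (metis linorder_neqE_nat)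
qed

lemma mode_less_irrefl: "\<not> mode_less p p"
  by (simp add: mode_less_def lex_less_irrefl)

lemma mode_less_trans: "mode_less p q \<Longrightarrow> mode_less q r \<Longrightarrow> mode_less p r"
  unfolding mode_less_def using lex_less_trans[of "fst p" "fst q" "fst r"] by auto

lemma mode_less_total: "p \<noteq> q \<Longrightarrow> mode_less p q \<or> mode_less q p"
  unfolding mode_less_def using lex_less_total[of "fst p" "fst q"] by (auto simp: prod_eq_iff)

lemma finite_modes_le: "finite {p :: 'n::finite mode. sqsum (fst p) \<le> B}"
proof -
  have "finite (vec_lambda ` (PiE (UNIV::'n set) (\<lambda>_. {..B})) \<times> (UNIV :: bool set))"
    by (intro finite_cartesian_product finite_imageI finite_PiE) auto
  moreover have "{p :: 'n mode. sqsum (fst p) \<le> B} \<subseteq> vec_lambda ` (PiE (UNIV::'n set) (\<lambda>_. {..B})) \<times> UNIV"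
  proof
    fix p :: "'n mode" assume "p \<in> {p. sqsum (fst p) \<le> B}"
    then have B: "sqsum (fst p) \<le> B" by simp
    have "fst p $ i \<le> B" for i
    proof -
      have "fst p $ i \<le> (fst p $ i)\<^sup>2" by (cases "fst p $ i") (auto simp: power2_eq_square)
      also have "\<dots> \<le> sqsum (fst p)" unfolding sqsum_def by (rule member_le_sum) auto
      finally show ?thesis using B by simp
    qed
    then have "vec_nth (fst p) \<in> PiE UNIV (\<lambda>_. {..B})" by auto
    then have "vec_lambda (vec_nth (fst p)) \<in> vec_lambda ` PiE UNIV (\<lambda>_. {..B})" by (rule imageI)
    then show "p \<in> vec_lambda ` (PiE (UNIV::'n set) (\<lambda>_. {..B})) \<times> UNIV" by (simp add: mem_Times_iff)
  qed
  ultimately show ?thesis by (rule finite_subset[rotated])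
qed

definition mode_rank :: "'n::{finite,linorder} mode \<Rightarrow> nat" where
  "mode_rank p = card {q \<in> modes. mode_less q p}"

lemma finite_mode_predecessors: "finite {q \<in> modes. mode_less q p}"
  by (rule finite_subset[OF _ finite_modes_le[of "sqsum (fst p)"]]) (auto simp: mode_less_def)

lemma mode_rank_mono:
  assumes "mode_less p q" "p \<in> modes" shows "mode_rank p < mode_rank q"
proof -
  have "{r \<in> modes. mode_less r p} \<subseteq> {r \<in> modes. mode_less r q}"
    using mode_less_trans[OF _ assms(1)] by blast
  moreover have "p \<in> {r \<in> modes. mode_less r q}" "p \<notin> {r \<in> modes. mode_less r p}"
    using assms by (auto simp: mode_less_irrefl)
  ultimately have "{r \<in> modes. mode_less r p} \<subset> {r \<in> modes. mode_less r q}" by blast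
  then show ?thesis unfolding mode_rank_def by (rule psubset_card_mono[OF finite_mode_predecessors])
qed

lemma mode_rank_inj: "inj_on mode_rank modes"
proof (rule inj_onI, rule ccontr)
  fix p q :: "'a mode" assume "p \<in> modes" "q \<in> modes" "mode_rank p = mode_rank q" "p \<noteq> q"
  then show False using mode_less_total[of p q] mode_rank_mono[of p q] mode_rank_mono[of q p] by auto
qed

lemma diagonal_mode: "((\<chi> i. Suc m), s) \<in> modes"
  by (simp add: modes_def)

lemma infinite_modes: "infinite (modes :: 'n::finite mode set)"
proof -
  have "inj (\<lambda>m. ((\<chi> i::'n. Suc m), True))" by (auto simp: inj_def vec_eq_iff)
  moreover have "range (\<lambda>m. ((\<chi> i::'n. Suc m), True)) \<subseteq> modes" by (auto intro: diagonal_mode)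
  ultimately show ?thesis using finite_subset range_inj_infinite by blast
qed

text \<open>
  The predecessors of \<open>p\<close> are \<open>mode_rank p\<close> many modes of smaller rank, so they exhaust the smaller
  ranks: the set of ranks is downward closed. Being infinite, it contains all natural numbers.
\<close>

lemma mode_rank_surj:
  obtains p :: "'n::{finite,linorder} mode" where "p \<in> modes" "mode_rank p = n"
proof -
  have "infinite (mode_rank ` (modes :: 'n mode set))"
    using infinite_modes mode_rank_inj by (auto dest: finite_imageD)
  then obtain p :: "'n mode" where p: "p \<in> modes" "n < mode_rank p"
    unfolding infinite_nat_iff_unbounded by blast
  let ?P = "{q \<in> modes. mode_less q p}"
  have "mode_rank ` ?P \<subseteq> {..<mode_rank p}" by (auto intro: mode_rank_mono)
  moreover have "card (mode_rank ` ?P) = card {..<mode_rank p}"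
    by (subst card_image) (auto intro: inj_on_subset[OF mode_rank_inj] simp: mode_rank_def)
  ultimately have "mode_rank ` ?P = {..<mode_rank p}" by (intro card_subset_eq) auto
  with p show thesis using that by (metis (no_types, lifting) imageE lessThan_iff mem_Collect_eq)
qed

lemma nth_mode_rank:
  assumes "p \<in> modes" shows "nth_mode (Suc (mode_rank p)) = p"
  unfolding nth_mode_def
proof (rule the_equality)
  show "p \<in> modes \<and> card {q \<in> modes. mode_less q p} + 1 = Suc (mode_rank p)"
    using assms by (simp add: mode_rank_def)
  show "q = p" if "q \<in> modes \<and> card {r \<in> modes. mode_less r q} + 1 = Suc (mode_rank p)" for q
    using that assms mode_rank_inj by (auto simp: inj_on_def mode_rank_def)
qed

lemma nth_mode_Suc:
  shows "nth_mode (Suc j) \<in> (modes :: 'n::{finite,linorder} mode set)"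
    and "mode_rank (nth_mode (Suc j) :: 'n mode) = j"
proof -
  obtain p :: "'n mode" where "p \<in> modes" "mode_rank p = j" by (rule mode_rank_surj)
  with nth_mode_rank[of p] show "nth_mode (Suc j) \<in> (modes :: 'n mode set)" "mode_rank (nth_mode (Suc j) :: 'n mode) = j"
    by auto
qed

lemma nth_mode_eq_iff: "(nth_mode (Suc j) :: 'n::{finite,linorder} mode) = nth_mode (Suc l) \<longleftrightarrow> j = l"
  by (metis nth_mode_Suc(2))

lemma omega_unbounded:
  assumes "\<alpha> \<ge> 0"
  obtains j where "r < (omega \<alpha> TYPE('n::{finite,linorder}) (Suc j))\<^sup>2"
proof -
  obtain m :: nat where m: "r < real m" using reals_Archimedean2 by blast
  define p :: "'n mode" where "p = ((\<chi> i. Suc m), True)"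
  have p: "p \<in> modes" unfolding p_def by (rule diagonal_mode)
  have "m \<le> (Suc m)\<^sup>2" by (simp add: power2_eq_square)
  also have "(Suc m)\<^sup>2 \<le> sqsum (fst p)"
    unfolding sqsum_def p_def by (simp add: Suc_leI)
  finally have "real m \<le> 1 * real (sqsum (fst p))" by simp
  also have "\<dots> \<le> pi\<^sup>2 * real (sqsum (fst p))"
    using pi_ge_two by (intro mult_right_mono) (auto simp: power2_eq_square intro: order_trans[OF _ mult_mono[of 1 pi 1 pi]])
  also have "\<dots> \<le> (mode_omega \<alpha> p)\<^sup>2" using assms by (simp add: mode_omega_sq)
  finally have "r < (omega \<alpha> TYPE('n) (Suc (mode_rank p)))\<^sup>2"
    using m nth_mode_rank[OF p] by (simp add: omega_def)
  then show thesis by (rule that)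
qed

section \<open>Orthogonal series in the energy space\<close>

lemma phi_energy: "phi \<alpha> j \<in> energy_space"
  by (simp add: phi_def mode_state_energy)

lemma phi_orthonormal:
  assumes "\<alpha> \<ge> 0"
  shows "inner_E \<alpha> (phi \<alpha> (Suc j)) (phi \<alpha> (Suc l) :: 'n::{finite,linorder} state) = (if j = l then 1 else 0)"
  unfolding phi_def mode_states_orthonormal[OF assms nth_mode_Suc(1) nth_mode_Suc(1)] nth_mode_eq_iff ..

lemma phi_complete:
  fixes \<Phi> :: "'n::{finite,linorder} state"
  assumes "\<alpha> \<ge> 0" "\<Phi> \<in> energy_space" "\<not> zero_E \<Phi>"
  obtains j where "inner_E \<alpha> \<Phi> (phi \<alpha> (Suc j)) \<noteq> 0"
proof -
  obtain p where p: "p \<in> modes" "inner_E \<alpha> \<Phi> (mode_state \<alpha> p) \<noteq> 0"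
    using zero_E_of_coefficients[OF assms(1,2)] assms(3) by blast
  then show thesis using that[of "mode_rank p"] by (simp add: phi_def nth_mode_rank)
qed

definition partial_sum :: "real \<Rightarrow> (nat \<Rightarrow> complex) \<Rightarrow> nat \<Rightarrow> 'n::{finite,linorder} state" where
  "partial_sum \<alpha> a m = ((\<lambda>x. \<Sum>j=1..m. a j * fst (phi \<alpha> j) x), (\<lambda>x. \<Sum>j=1..m. a j * snd (phi \<alpha> j) x))"

lemma partial_sum_Suc:
  "partial_sum \<alpha> a (Suc m) = axpy (a (Suc m)) (phi \<alpha> (Suc m)) (partial_sum \<alpha> a m)"
  by (simp add: partial_sum_def axpy_def add.commute)

lemma partial_sum_energy: "partial_sum \<alpha> a m \<in> energy_space"
proof (induction m)
  case 0
  have "(\<lambda>x. 0) \<in> L2" by (rule H1_L2[OF H10_H1[OF zero_H10]])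
  then show ?case by (simp add: partial_sum_def energy_space_def zero_H10)
qed (simp add: partial_sum_Suc axpy_energy phi_energy)

lemma inner_E_partial_sum:
  assumes "\<Theta> \<in> energy_space"
  shows "inner_E \<alpha> (partial_sum \<alpha> a m) \<Theta> = (\<Sum>j=1..m. a j * inner_E \<alpha> (phi \<alpha> j) \<Theta>)"
proof (induction m)
  case 0
  let ?z = "partial_sum \<alpha> a 0"
  have "?z = axpy 1 ?z ?z" by (simp add: axpy_def partial_sum_def)
  then have "inner_E \<alpha> ?z \<Theta> = inner_E \<alpha> (axpy 1 ?z ?z) \<Theta>" by (rule arg_cong[where f="\<lambda>z. inner_E \<alpha> z \<Theta>"])
  also have "\<dots> = 1 * inner_E \<alpha> ?z \<Theta> + inner_E \<alpha> ?z \<Theta>"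
    by (rule inner_E_axpy[OF partial_sum_energy partial_sum_energy assms])
  finally show ?case by simp
next
  case (Suc m)
  then show ?case
    by (simp add: partial_sum_Suc inner_E_axpy[OF phi_energy partial_sum_energy assms])
qed

lemma inner_E_partial_sum_phi:
  assumes "\<alpha> \<ge> 0" "1 \<le> l"
  shows "inner_E \<alpha> (partial_sum \<alpha> a m) (phi \<alpha> l :: 'n::{finite,linorder} state) = (if l \<le> m then a l else 0)"
proof -
  have o: "inner_E \<alpha> (phi \<alpha> j) (phi \<alpha> l :: 'n state) = (if j = l then 1 else 0)" if "1 \<le> j" for j
    using phi_orthonormal[OF assms(1), of "j - 1" "l - 1"] that assms(2) by (auto simp: eq_diff_iff)
  have "(\<Sum>j=1..m. a j * inner_E \<alpha> (phi \<alpha> j) (phi \<alpha> l :: 'n state)) = (\<Sum>j=1..m. if j = l then a j else 0)"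
    by (intro sum.cong refl) (simp add: o)
  then show ?thesis using assms(2) by (simp add: inner_E_partial_sum phi_energy)
qed

lemma norm_E_partial_sum:
  assumes "\<alpha> \<ge> 0"
  shows "(norm_E \<alpha> (partial_sum \<alpha> a m :: 'n::{finite,linorder} state))\<^sup>2 = (\<Sum>j=1..m. (cmod (a j))\<^sup>2)"
proof -
  let ?P = "partial_sum \<alpha> a m :: 'n state"
  have "inner_E \<alpha> ?P ?P = (\<Sum>j=1..m. a j * inner_E \<alpha> (phi \<alpha> j) ?P)"
    by (rule inner_E_partial_sum[OF partial_sum_energy])
  also have "\<dots> = (\<Sum>j=1..m. of_real ((cmod (a j))\<^sup>2))"
  proof (rule sum.cong[OF refl])
    fix j assume "j \<in> {1..m}"
    then show "a j * inner_E \<alpha> (phi \<alpha> j) ?P = of_real ((cmod (a j))\<^sup>2)"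
      by (subst inner_E_commute) (simp add: inner_E_partial_sum_phi[OF assms] complex_norm_square del: of_real_power)
  qed
  finally have "complex_of_real ((norm_E \<alpha> ?P)\<^sup>2) = of_real (\<Sum>j=1..m. (cmod (a j))\<^sup>2)"
    unfolding norm_E_sq(2)[OF assms partial_sum_energy] by simp
  then show ?thesis unfolding of_real_eq_iff .
qed

lemma sum_Icc_split:
  "m \<le> l \<Longrightarrow> sum f {1..l} = sum f {1..m} + sum f {Suc m..l}" for m l :: nat
  using sum.ub_add_nat[of 1 m f "l - m"] by simp

lemma norm_E_partial_sum_diff:
  assumes "\<alpha> \<ge> 0" "m \<le> l"
  shows "(norm_E \<alpha> (axpy (-1) (partial_sum \<alpha> a m) (partial_sum \<alpha> a l :: 'n::{finite,linorder} state)))\<^sup>2 =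
    (\<Sum>j=1..l. (cmod (a j))\<^sup>2) - (\<Sum>j=1..m. (cmod (a j))\<^sup>2)"
proof -
  \<comment> \<open>The difference is itself a partial sum, with the first \<open>m\<close> coefficients removed.\<close>
  let ?b = "\<lambda>j. if j \<le> m then 0 else a j"
  have low: "(\<Sum>j=1..m. ?b j * f j) = 0" for f by (intro sum.neutral) auto
  have high: "(\<Sum>j=Suc m..l. ?b j * f j) = (\<Sum>j=Suc m..l. a j * f j)" for f by (intro sum.cong) auto
  have "axpy (-1) (partial_sum \<alpha> a m) (partial_sum \<alpha> a l) = (partial_sum \<alpha> ?b l :: 'n state)"
    unfolding axpy_def partial_sum_def sum_Icc_split[OF assms(2)] low high by simp
  moreover have "(\<Sum>j=1..l. (cmod (?b j))\<^sup>2) = (\<Sum>j=Suc m..l. (cmod (a j))\<^sup>2)"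
  proof -
    have "(\<Sum>j=1..m. (cmod (?b j))\<^sup>2) = 0" by (intro sum.neutral) auto
    moreover have "(\<Sum>j=Suc m..l. (cmod (?b j))\<^sup>2) = (\<Sum>j=Suc m..l. (cmod (a j))\<^sup>2)"
      by (intro sum.cong) auto
    ultimately show ?thesis unfolding sum_Icc_split[OF assms(2)] by linarith
  qed
  ultimately show ?thesis
    using sum_Icc_split[OF assms(2), of "\<lambda>j. (cmod (a j))\<^sup>2"] by (simp only: norm_E_partial_sum[OF assms(1)])
qed

lemma norm_E_nonneg:
  assumes "\<alpha> \<ge> 0" "\<Phi> \<in> energy_space" shows "0 \<le> norm_E \<alpha> \<Phi>"
proof -
  have "Re (inner_E \<alpha> \<Phi> \<Phi>) \<ge> 0" unfolding norm_E_sq(2)[OF assms] by simp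
  then show ?thesis by (simp add: norm_E_def)
qed

lemma energy_components_le:
  assumes "\<alpha> \<ge> 0" "\<Phi> \<in> energy_space"
  shows "L2norm (wD i (fst \<Phi>)) \<le> norm_E \<alpha> \<Phi>" "L2norm (snd \<Phi>) \<le> norm_E \<alpha> \<Phi>"
proof -
  have 1: "(L2norm (wD i (fst \<Phi>)))\<^sup>2 \<le> (\<Sum>i\<in>UNIV. (L2norm (wD i (fst \<Phi>)))\<^sup>2)"
    by (rule member_le_sum) auto
  have 2: "0 \<le> \<alpha> * (L2norm (fst \<Phi>))\<^sup>2" using assms(1) by simp
  have "(L2norm (wD i (fst \<Phi>)))\<^sup>2 \<le> (norm_E \<alpha> \<Phi>)\<^sup>2"
    unfolding norm_E_sq(1)[OF assms] using 1 2 zero_le_power2[of "L2norm (snd \<Phi>)"] by linarith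
  then show "L2norm (wD i (fst \<Phi>)) \<le> norm_E \<alpha> \<Phi>"
    by (rule power2_le_imp_le[OF _ norm_E_nonneg[OF assms]])
  have "(L2norm (snd \<Phi>))\<^sup>2 \<le> (norm_E \<alpha> \<Phi>)\<^sup>2"
    unfolding norm_E_sq(1)[OF assms]
    using 2 sum_nonneg[of UNIV "\<lambda>i. (L2norm (wD i (fst \<Phi>)))\<^sup>2"] by simp
  then show "L2norm (snd \<Phi>) \<le> norm_E \<alpha> \<Phi>"
    by (rule power2_le_imp_le[OF _ norm_E_nonneg[OF assms]])
qed

text \<open>
  The \<open>\<alpha>\<close>-term of the energy does not show on the right because the gradient part dominates the
  first component, by the Poincare inequality.
\<close>

lemma energy_tendsto_iff:
  fixes S :: "'n::{finite,linorder} state"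
  assumes a: "\<alpha> \<ge> 0" and P: "\<And>m. P m \<in> energy_space" and S: "S \<in> energy_space"
  shows "(\<lambda>m. norm_E \<alpha> (axpy (-1) S (P m))) \<longlonglongrightarrow> 0 \<longleftrightarrow>
    (\<forall>i. (\<lambda>m. L2norm (\<lambda>x. wD i (fst (P m)) x - wD i (fst S) x)) \<longlonglongrightarrow> 0) \<and>
    (\<lambda>m. L2norm (\<lambda>x. snd (P m) x - snd S x)) \<longlonglongrightarrow> 0" (is "?L \<longleftrightarrow> (\<forall>i. ?G i) \<and> ?Z")
proof -
  let ?Q = "\<lambda>m. axpy (-1) S (P m)"
  have QE: "?Q m \<in> energy_space" for m by (intro axpy_energy P S)
  have G: "L2norm (wD i (fst (?Q m))) = L2norm (\<lambda>x. wD i (fst (P m)) x - wD i (fst S) x)" for i m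
    using L2norm_wD_diff[OF energy_spaceD(2)[OF P] energy_spaceD(2)[OF S], of i m] by (simp add: axpy_def)
  have Z: "L2norm (snd (?Q m)) = L2norm (\<lambda>x. snd (P m) x - snd S x)" for m
    by (simp add: axpy_def)
  show ?thesis unfolding G[symmetric] Z[symmetric]
  proof
    assume L: ?L
    show "(\<forall>i. (\<lambda>m. L2norm (wD i (fst (?Q m)))) \<longlonglongrightarrow> 0) \<and> (\<lambda>m. L2norm (snd (?Q m))) \<longlonglongrightarrow> 0"
      by (intro conjI allI; rule Lim_null_comparison[OF _ L]) (simp_all add: energy_components_le[OF a QE])
  next
    assume R: "(\<forall>i. (\<lambda>m. L2norm (wD i (fst (?Q m)))) \<longlonglongrightarrow> 0) \<and> (\<lambda>m. L2norm (snd (?Q m))) \<longlonglongrightarrow> 0"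
    have F: "(\<lambda>m. L2norm (fst (?Q m))) \<longlonglongrightarrow> 0"
    proof (rule Lim_null_comparison)
      show "(\<lambda>m. 2 * L2norm (wD undefined (fst (?Q m)))) \<longlonglongrightarrow> 0"
        using tendsto_mult_right_zero[of _ _ 2] R by blast
      show "\<forall>\<^sub>F m in sequentially. norm (L2norm (fst (?Q m))) \<le> 2 * L2norm (wD undefined (fst (?Q m)))"
        using Poincare[OF energy_spaceD(1)[OF QE]] by simp
    qed
    have "(\<lambda>m. (norm_E \<alpha> (?Q m))\<^sup>2) \<longlonglongrightarrow> (\<Sum>i\<in>(UNIV::'n set). 0\<^sup>2) + \<alpha> * 0\<^sup>2 + 0\<^sup>2"
      unfolding norm_E_sq(1)[OF a QE] by (intro tendsto_intros F) (use R in auto)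
    then have "(\<lambda>m. sqrt ((norm_E \<alpha> (?Q m))\<^sup>2)) \<longlonglongrightarrow> sqrt 0" by (intro tendsto_real_sqrt) simp
    then show ?L using norm_E_nonneg[OF a QE] by simp
  qed
qed

lemma norm_E_sq_tendsto:
  fixes S :: "'n::{finite,linorder} state"
  assumes a: "\<alpha> \<ge> 0" and P: "\<And>m. P m \<in> energy_space" and S: "S \<in> energy_space"
    and lim: "(\<lambda>m. norm_E \<alpha> (axpy (-1) S (P m))) \<longlonglongrightarrow> 0"
  shows "(\<lambda>m. (norm_E \<alpha> (P m))\<^sup>2) \<longlonglongrightarrow> (norm_E \<alpha> S)\<^sup>2"
proof -
  have G: "(\<lambda>m. L2norm (\<lambda>x. wD i (fst (P m)) x - wD i (fst S) x)) \<longlonglongrightarrow> 0"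
    and Z: "(\<lambda>m. L2norm (\<lambda>x. snd (P m) x - snd S x)) \<longlonglongrightarrow> 0" for i
    using lim unfolding energy_tendsto_iff[OF a P S] by blast+
  have F: "(\<lambda>m. L2norm (\<lambda>x. fst (P m) x - fst S x)) \<longlonglongrightarrow> 0"
  proof (rule Lim_null_comparison)
    show "(\<lambda>m. 2 * L2norm (\<lambda>x. wD undefined (fst (P m)) x - wD undefined (fst S) x)) \<longlonglongrightarrow> 0"
      by (rule tendsto_mult_right_zero[OF G])
    show "\<forall>\<^sub>F m in sequentially. norm (L2norm (\<lambda>x. fst (P m) x - fst S x)) \<le>
        2 * L2norm (\<lambda>x. wD undefined (fst (P m)) x - wD undefined (fst S) x)"
      using Poincare[OF H10_diff[OF energy_spaceD(1)[OF P] energy_spaceD(1)[OF S]]]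
      by (simp add: L2norm_wD_diff energy_spaceD(2) P S)
  qed
  show ?thesis
    unfolding norm_E_sq(1)[OF a P] norm_E_sq(1)[OF a S]
    by (intro tendsto_intros L2norm_tendsto[OF _ _ G] L2norm_tendsto[OF _ _ F] L2norm_tendsto[OF _ _ Z] energy_spaceD P S)
qed

text \<open>
  The Riesz-Fischer theorem in the energy space: the partial sums are Cauchy in energy norm, hence
  gradient and second component are Cauchy in \<open>L2\<close>.
\<close>

lemma partial_sums_converge:
  fixes a :: "nat \<Rightarrow> complex"
  assumes \<alpha>: "\<alpha> \<ge> 0" and sm: "summable (\<lambda>j. (cmod (a (Suc j)))\<^sup>2)"
  obtains S :: "'n::{finite,linorder} state"
    where "S \<in> energy_space" "(\<lambda>m. norm_E \<alpha> (axpy (-1) S (partial_sum \<alpha> a m))) \<longlonglongrightarrow> 0"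
proof -
  let ?P = "\<lambda>m. partial_sum \<alpha> a m :: 'n state"
  let ?s = "\<lambda>m. \<Sum>j=1..m. (cmod (a j))\<^sup>2"
  have PE: "?P m \<in> energy_space" for m by (rule partial_sum_energy)
  have "?s = (\<lambda>m. \<Sum>j<m. (cmod (a (Suc j)))\<^sup>2)"
    by (simp add: sum.atLeast1_atMost_eq)
  then have "Cauchy ?s" using sm by (simp add: summable_iff_convergent convergent_Cauchy)
  have key: "\<exists>K. \<forall>m\<ge>K. \<forall>l\<ge>K. norm_E \<alpha> (axpy (-1) (?P m) (?P l)) < e \<or> norm_E \<alpha> (axpy (-1) (?P l) (?P m)) < e"
    if e: "e > 0" for e
  proof -
    obtain K where K: "\<And>m l. m \<ge> K \<Longrightarrow> l \<ge> K \<Longrightarrow> norm (?s m - ?s l) < e\<^sup>2"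
      using CauchyD[OF \<open>Cauchy ?s\<close>, of "e\<^sup>2"] e by auto
    have one: "norm_E \<alpha> (axpy (-1) (?P m) (?P l)) < e" if "m \<ge> K" "l \<ge> K" "m \<le> l" for m l
    proof -
      have "(norm_E \<alpha> (axpy (-1) (?P m) (?P l)))\<^sup>2 < e\<^sup>2"
        unfolding norm_E_partial_sum_diff[OF \<alpha> that(3)] using K[OF that(2,1)] by simp
      then show ?thesis by (rule power_less_imp_less_base) (use e in simp)
    qed
    show ?thesis using one by (meson nle_le)
  qed
  have diff: "L2norm (\<lambda>x. wD i (fst (?P m)) x - wD i (fst (?P l)) x) \<le> norm_E \<alpha> (axpy (-1) (?P l) (?P m))"
    "L2norm (\<lambda>x. snd (?P m) x - snd (?P l) x) \<le> norm_E \<alpha> (axpy (-1) (?P l) (?P m))" for i m l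
    using energy_components_le(1)[OF \<alpha> axpy_energy[OF PE[of l] PE[of m]], of i "-1"]
      energy_components_le(2)[OF \<alpha> axpy_energy[OF PE[of l] PE[of m]], of "-1"]
      L2norm_wD_diff[OF energy_spaceD(2)[OF PE[of m]] energy_spaceD(2)[OF PE[of l]], of i]
    by (simp_all add: axpy_def)
  have small: "L2norm (\<lambda>x. wD i (fst (?P m)) x - wD i (fst (?P l)) x) < e \<and> L2norm (\<lambda>x. snd (?P m) x - snd (?P l) x) < e"
    if "norm_E \<alpha> (axpy (-1) (?P m) (?P l)) < e \<or> norm_E \<alpha> (axpy (-1) (?P l) (?P m)) < e" for i m l e
    using that
  proof
    assume "norm_E \<alpha> (axpy (-1) (?P l) (?P m)) < e"
    then show ?thesis using diff(1)[of i m l] diff(2)[of m l] by linarith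
  next
    assume *: "norm_E \<alpha> (axpy (-1) (?P m) (?P l)) < e"
    have "L2norm (\<lambda>x. wD i (fst (?P m)) x - wD i (fst (?P l)) x) = L2norm (\<lambda>x. wD i (fst (?P l)) x - wD i (fst (?P m)) x)"
      "L2norm (\<lambda>x. snd (?P m) x - snd (?P l) x) = L2norm (\<lambda>x. snd (?P l) x - snd (?P m) x)"
      by (rule L2norm_minus_commute)+
    then show ?thesis using * diff(1)[of i l m] diff(2)[of l m] by linarith
  qed
  obtain U where U: "U \<in> H10" "\<And>i. (\<lambda>m. L2norm (\<lambda>x. wD i (fst (?P m)) x - wD i U x)) \<longlonglongrightarrow> 0"
  proof (rule H10_complete[OF energy_spaceD(1)[OF PE]])
    show "\<exists>K. \<forall>m\<ge>K. \<forall>l\<ge>K. L2norm (\<lambda>x. wD i (fst (?P m)) x - wD i (fst (?P l)) x) < e" if "e > 0" for i e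
      using key[OF that] small by meson
  qed (rule that)
  have "\<exists>Z\<in>L2. (\<lambda>m. L2norm (\<lambda>x. snd (?P m) x - Z x)) \<longlonglongrightarrow> 0"
  proof (rule L2_complete[OF energy_spaceD(5)[OF PE]])
    show "\<exists>K. \<forall>m\<ge>K. \<forall>l\<ge>K. L2norm (\<lambda>x. snd (?P m) x - snd (?P l) x) < e" if "e > 0" for e
      using key[OF that] small by meson
  qed
  then obtain Z where Z: "Z \<in> L2" "(\<lambda>m. L2norm (\<lambda>x. snd (?P m) x - Z x)) \<longlonglongrightarrow> 0" by (rule bexE)
  have SE: "(U, Z) \<in> energy_space" using U(1) Z(1) by (simp add: energy_space_def)
  show thesis
    by (rule that[OF SE]) (use U(2) Z(2) in \<open>simp add: energy_tendsto_iff[OF \<alpha> PE SE]\<close>)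
qed

section \<open>Functional calculus and the Euler propagator\<close>

lemma fc_sums_iff:
  "fc_sums \<alpha> h \<Psi> S \<longleftrightarrow> S \<in> energy_space \<and>
    (\<lambda>m. norm_E \<alpha> (axpy (-1) S (partial_sum \<alpha> (\<lambda>j. h (lam \<alpha> TYPE('n::{finite,linorder}) j) * inner_E \<alpha> \<Psi> (phi \<alpha> j)) m))) \<longlonglongrightarrow> 0"
  for \<Psi> :: "'n::{finite,linorder} state"
  by (simp add: fc_sums_def axpy_def partial_sum_def)

text \<open>
  Parseval's identity. The state \<open>fc \<alpha> h \<Psi>\<close> is an arbitrary limit of the series, but any two such limits
  have the same energy norm.
\<close>

lemma norm_E_fc:
  fixes \<Psi> :: "'n::{finite,linorder} state"
  assumes \<alpha>: "\<alpha> \<ge> 0" and \<Psi>: "\<Psi> \<in> fc_domain \<alpha> h"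
  shows "(norm_E \<alpha> (fc \<alpha> h \<Psi>))\<^sup>2 =
    (\<Sum>k. (cmod (h (lam \<alpha> TYPE('n) (Suc k))))\<^sup>2 * (cmod (inner_E \<alpha> \<Psi> (phi \<alpha> (Suc k))))\<^sup>2)"
    and "fc \<alpha> h \<Psi> \<in> energy_space"
proof -
  define a where "a j = h (lam \<alpha> TYPE('n) j) * inner_E \<alpha> \<Psi> (phi \<alpha> j)" for j
  have sq: "(cmod (a j))\<^sup>2 = (cmod (h (lam \<alpha> TYPE('n) j)))\<^sup>2 * (cmod (inner_E \<alpha> \<Psi> (phi \<alpha> j)))\<^sup>2" for j
    by (simp add: a_def norm_mult power_mult_distrib)
  have sm: "summable (\<lambda>j. (cmod (a (Suc j)))\<^sup>2)"
    using \<Psi> by (simp add: fc_domain_def sq)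
  obtain S0 :: "'n state" where S0: "S0 \<in> energy_space" "(\<lambda>m. norm_E \<alpha> (axpy (-1) S0 (partial_sum \<alpha> a m))) \<longlonglongrightarrow> 0"
    by (rule partial_sums_converge[OF \<alpha> sm]) (rule that)
  then have "fc_sums \<alpha> h \<Psi> S0" unfolding fc_sums_iff a_def[abs_def] by blast
  then have "fc_sums \<alpha> h \<Psi> (fc \<alpha> h \<Psi>)" unfolding fc_def by (rule someI)
  then have S: "fc \<alpha> h \<Psi> \<in> energy_space" "(\<lambda>m. norm_E \<alpha> (axpy (-1) (fc \<alpha> h \<Psi>) (partial_sum \<alpha> a m))) \<longlonglongrightarrow> 0"
    unfolding fc_sums_iff a_def[abs_def] by blast+
  show "fc \<alpha> h \<Psi> \<in> energy_space" by (rule S(1))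
  have "(\<lambda>m. \<Sum>j=1..m. (cmod (a j))\<^sup>2) \<longlonglongrightarrow> (norm_E \<alpha> (fc \<alpha> h \<Psi>))\<^sup>2"
    using norm_E_sq_tendsto[OF \<alpha> partial_sum_energy S] by (simp add: norm_E_partial_sum[OF \<alpha>])
  then have "(\<lambda>j. (cmod (a (Suc j)))\<^sup>2) sums (norm_E \<alpha> (fc \<alpha> h \<Psi>))\<^sup>2"
    by (simp add: sums_def sum.atLeast1_atMost_eq)
  then show "(norm_E \<alpha> (fc \<alpha> h \<Psi>))\<^sup>2 =
    (\<Sum>k. (cmod (h (lam \<alpha> TYPE('n) (Suc k))))\<^sup>2 * (cmod (inner_E \<alpha> \<Psi> (phi \<alpha> (Suc k))))\<^sup>2)"
    by (simp add: sums_iff sq)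
qed

lemma fc_norm_sq:
  fixes \<Psi> :: "'n::{finite,linorder} state"
  assumes \<alpha>: "\<alpha> \<ge> 0" and \<Psi>: "\<Psi> \<in> energy_space"
  shows "(fc_norm \<alpha> h \<Psi>)\<^sup>2 =
    (\<Sum>k. ennreal ((cmod (h (lam \<alpha> TYPE('n) (Suc k))))\<^sup>2 * (cmod (inner_E \<alpha> \<Psi> (phi \<alpha> (Suc k))))\<^sup>2))"
proof (cases "\<Psi> \<in> fc_domain \<alpha> h")
  case True
  then show ?thesis
    using norm_E_fc[OF \<alpha> True] norm_E_nonneg[OF \<alpha> norm_E_fc(2)[OF \<alpha> True]]
    by (subst suminf_ennreal2) (auto simp: fc_norm_def fc_domain_def ennreal_power)
next
  case False
  let ?f = "\<lambda>k. (cmod (h (lam \<alpha> TYPE('n) (Suc k))))\<^sup>2 * (cmod (inner_E \<alpha> \<Psi> (phi \<alpha> (Suc k))))\<^sup>2"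
  have "(\<Sum>k. ennreal (?f k)) = top"
  proof (rule ccontr)
    assume *: "(\<Sum>k. ennreal (?f k)) \<noteq> top"
    have "summable ?f" by (rule summable_suminf_not_top[OF _ *]) simp
    with False \<Psi> show False by (simp add: fc_domain_def)
  qed
  moreover have "fc_norm \<alpha> h \<Psi> = top" using False by (simp add: fc_norm_def)
  ultimately show ?thesis by (simp add: power2_eq_square)
qed

lemma norm_E_phi: "\<alpha> \<ge> 0 \<Longrightarrow> norm_E \<alpha> (phi \<alpha> (Suc j)) = 1"
  by (simp add: norm_E_def phi_orthonormal)

lemma norm_E_fc_phi:
  assumes \<alpha>: "\<alpha> \<ge> 0"
  shows "(phi \<alpha> (Suc j) :: 'n::{finite,linorder} state) \<in> fc_domain \<alpha> h"
    "norm_E \<alpha> (fc \<alpha> h (phi \<alpha> (Suc j) :: 'n state)) = cmod (h (lam \<alpha> TYPE('n) (Suc j)))"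
proof -
  let ?\<Psi> = "phi \<alpha> (Suc j) :: 'n state"
  have "(\<lambda>k. (cmod (h (lam \<alpha> TYPE('n) (Suc k))))\<^sup>2 * (cmod (inner_E \<alpha> ?\<Psi> (phi \<alpha> (Suc k))))\<^sup>2) =
      (\<lambda>k. if k = j then (cmod (h (lam \<alpha> TYPE('n) (Suc k))))\<^sup>2 else 0)"
    by (auto simp: phi_orthonormal[OF \<alpha>])
  then have sums: "(\<lambda>k. (cmod (h (lam \<alpha> TYPE('n) (Suc k))))\<^sup>2 * (cmod (inner_E \<alpha> ?\<Psi> (phi \<alpha> (Suc k))))\<^sup>2)
      sums (cmod (h (lam \<alpha> TYPE('n) (Suc j))))\<^sup>2"
    using sums_single[of j "\<lambda>k. (cmod (h (lam \<alpha> TYPE('n) (Suc k))))\<^sup>2"] by simp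
  then show dom: "?\<Psi> \<in> fc_domain \<alpha> h"
    by (simp add: fc_domain_def phi_energy sums_iff)
  have "(norm_E \<alpha> (fc \<alpha> h ?\<Psi>))\<^sup>2 = (cmod (h (lam \<alpha> TYPE('n) (Suc j))))\<^sup>2"
    using norm_E_fc(1)[OF \<alpha> dom] sums by (simp add: sums_iff)
  then show "norm_E \<alpha> (fc \<alpha> h ?\<Psi>) = cmod (h (lam \<alpha> TYPE('n) (Suc j)))"
    by (rule power2_eq_imp_eq) (simp_all add: norm_E_nonneg[OF \<alpha> norm_E_fc(2)[OF \<alpha> dom]])
qed

lemma euler_lam:
  "(cmod (euler dt n (lam \<alpha> N j)))\<^sup>2 = (1 + (omega \<alpha> N j)\<^sup>2 * dt\<^sup>2) ^ n"
proof -
  have "(cmod (1 - of_real dt * lam \<alpha> N j))\<^sup>2 = 1 + (omega \<alpha> N j)\<^sup>2 * dt\<^sup>2"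
    by (simp add: lam_def cmod_power2 power_mult_distrib)
  moreover have "(c ^ n)\<^sup>2 = (c\<^sup>2) ^ n" for c :: real
    by (simp only: power_mult[symmetric] mult.commute)
  ultimately show ?thesis by (simp add: euler_def norm_power)
qed

lemma euler_unbounded:
  assumes \<alpha>: "\<alpha> \<ge> 0" and n: "n \<ge> 1" and dt: "dt > 0"
  obtains j where "r < cmod (euler dt n (lam \<alpha> TYPE('n::{finite,linorder}) (Suc j)))"
proof -
  obtain j where j: "r\<^sup>2 / dt\<^sup>2 < (omega \<alpha> TYPE('n) (Suc j))\<^sup>2" by (rule omega_unbounded[OF \<alpha>]) (rule that)
  let ?q = "1 + (omega \<alpha> TYPE('n) (Suc j))\<^sup>2 * dt\<^sup>2"
  have "r\<^sup>2 < ?q" using j dt by (simp add: field_simps)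
  also have "?q \<le> ?q ^ n" using n by (intro self_le_power) auto
  finally have "r\<^sup>2 < (cmod (euler dt n (lam \<alpha> TYPE('n) (Suc j))))\<^sup>2" by (simp add: euler_lam)
  then have "r < cmod (euler dt n (lam \<alpha> TYPE('n) (Suc j)))" by (rule power_less_imp_less_base) simp
  then show thesis by (rule that)
qed

text \<open>
  A single mode with nonzero coefficient contributes \<open>(1 + \<omega>\<^sup>2 dt\<^sup>2) ^ n\<close> times a positive constant.
\<close>

lemma euler_energy_growth:
  fixes \<Phi> :: "'n::{finite,linorder} state"
  assumes \<alpha>: "\<alpha> \<ge> 0" and \<Phi>: "\<Phi> \<in> energy_space" "\<not> zero_E \<Phi>" and dt: "dt > 0"
  shows "(\<lambda>n. fc_norm \<alpha> (euler dt n) \<Phi>) \<longlonglongrightarrow> \<infinity>"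
proof -
  obtain j where j: "inner_E \<alpha> \<Phi> (phi \<alpha> (Suc j)) \<noteq> 0" by (rule phi_complete[OF \<alpha> \<Phi>]) (rule that)
  let ?q = "1 + (omega \<alpha> TYPE('n) (Suc j))\<^sup>2 * dt\<^sup>2" and ?c = "(cmod (inner_E \<alpha> \<Phi> (phi \<alpha> (Suc j))))\<^sup>2"
  have "(omega \<alpha> TYPE('n) (Suc j))\<^sup>2 > 0"
    using mode_omega_nonzero[OF \<alpha> nth_mode_Suc(1)] by (simp add: omega_def)
  then have q: "?q > 1" using dt by simp
  have c: "?c > 0" using j by simp
  have low: "ennreal (?q ^ n * ?c) \<le> (fc_norm \<alpha> (euler dt n) \<Phi>)\<^sup>2" for n
  proof -
    let ?f = "\<lambda>k. ennreal ((1 + (omega \<alpha> TYPE('n) (Suc k))\<^sup>2 * dt\<^sup>2) ^ n * (cmod (inner_E \<alpha> \<Phi> (phi \<alpha> (Suc k))))\<^sup>2)"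
    have "sum ?f {j} \<le> suminf ?f" by (rule sum_le_suminf) (auto intro: summableI)
    then show ?thesis unfolding fc_norm_sq[OF \<alpha> \<Phi>(1)] euler_lam by simp
  qed
  have "\<forall>\<^sub>F n in sequentially. ennreal l < fc_norm \<alpha> (euler dt n) \<Phi>" if l: "l \<ge> 0" for l
  proof -
    obtain N where N: "l\<^sup>2 / ?c < ?q ^ N" using real_arch_pow[OF q] by blast
    have "l\<^sup>2 / ?c < ?q ^ n" if "n \<ge> N" for n
      using N power_increasing[OF that, of ?q] q by linarith
    then have "\<forall>\<^sub>F n in sequentially. l\<^sup>2 / ?c < ?q ^ n"
      unfolding eventually_sequentially by blast
    then show ?thesis
    proof eventually_elim
      case (elim n)
      then have "ennreal (l\<^sup>2) < ennreal (?q ^ n * ?c)" using c by (simp add: field_simps ennreal_less_iff)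
      then have "(ennreal l)\<^sup>2 < (fc_norm \<alpha> (euler dt n) \<Phi>)\<^sup>2" using low[of n] l by (simp add: ennreal_power)
      then show ?case by (meson not_le power_mono zero_le)
    qed
  qed
  then show ?thesis by (simp add: tendsto_top_iff_ennreal)
qed

theorem proposition17:
  fixes \<alpha> :: real
  assumes "\<alpha> \<ge> 0"
  shows
    "(\<forall>\<Phi>0 :: 'n::{finite,linorder} state. \<Phi>0 \<in> energy_space \<longrightarrow>
        (\<forall>n \<ge> 1. \<forall>dt > 0.
           (fc_norm \<alpha> (euler dt n) \<Phi>0)\<^sup>2 =
           (\<Sum>k. ennreal ((1 + (omega \<alpha> TYPE('n) (Suc k))\<^sup>2 * dt\<^sup>2) ^ n *
                           (cmod (inner_E \<alpha> \<Phi>0 (phi \<alpha> (Suc k))))\<^sup>2)))) \<and>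
     (\<forall>\<Phi>0 :: 'n state. \<Phi>0 \<in> energy_space \<and> \<not> zero_E \<Phi>0 \<longrightarrow>
        (\<forall>dt > 0. (\<lambda>n. fc_norm \<alpha> (euler dt n) \<Phi>0) \<longlonglongrightarrow> \<infinity>)) \<and>
     (\<forall>n \<ge> 1. \<forall>dt > 0.
        fc_opnorm \<alpha> TYPE('n) (euler dt n) = \<infinity> \<and> \<not> fc_bounded \<alpha> TYPE('n) (euler dt n))"
proof (intro conjI allI impI)
  fix \<Phi>0 :: "'n state" and n :: nat and dt :: real
  assume \<Phi>0: "\<Phi>0 \<in> energy_space"
  show "(fc_norm \<alpha> (euler dt n) \<Phi>0)\<^sup>2 =
           (\<Sum>k. ennreal ((1 + (omega \<alpha> TYPE('n) (Suc k))\<^sup>2 * dt\<^sup>2) ^ n *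
                           (cmod (inner_E \<alpha> \<Phi>0 (phi \<alpha> (Suc k))))\<^sup>2))"
    by (simp only: fc_norm_sq[OF assms \<Phi>0] euler_lam)
next
  fix \<Phi>0 :: "'n state" and dt :: real
  assume "\<Phi>0 \<in> energy_space \<and> \<not> zero_E \<Phi>0" "dt > 0"
  then show "(\<lambda>n. fc_norm \<alpha> (euler dt n) \<Phi>0) \<longlonglongrightarrow> \<infinity>"
    using euler_energy_growth[OF assms] by blast
next
  fix n :: nat and dt :: real
  assume n: "n \<ge> 1" and dt: "dt > 0"
  show "fc_opnorm \<alpha> TYPE('n) (euler dt n) = \<infinity>"
  proof (rule ccontr)
    assume "fc_opnorm \<alpha> TYPE('n) (euler dt n) \<noteq> \<infinity>"
    then obtain r where r: "r \<ge> 0" "fc_opnorm \<alpha> TYPE('n) (euler dt n) = ennreal r"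
      by (cases "fc_opnorm \<alpha> TYPE('n) (euler dt n)") auto
    obtain j where j: "r < cmod (euler dt n (lam \<alpha> TYPE('n) (Suc j)))"
      by (rule euler_unbounded[OF assms n dt]) (rule that)
    have "ennreal (cmod (euler dt n (lam \<alpha> TYPE('n) (Suc j)))) \<le> fc_opnorm \<alpha> TYPE('n) (euler dt n)"
      unfolding fc_opnorm_def by (rule SUP_upper) simp
    then show False using r j by (simp add: ennreal_le_iff)
  qed
  show "\<not> fc_bounded \<alpha> TYPE('n) (euler dt n)"
  proof
    assume "fc_bounded \<alpha> TYPE('n) (euler dt n)"
    then obtain C where C: "\<And>\<Psi> :: 'n state. \<Psi> \<in> fc_domain \<alpha> (euler dt n) \<Longrightarrow>
        norm_E \<alpha> (fc \<alpha> (euler dt n) \<Psi>) \<le> C * norm_E \<alpha> \<Psi>"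
      unfolding fc_bounded_def by blast
    obtain j where "C < cmod (euler dt n (lam \<alpha> TYPE('n) (Suc j)))"
      by (rule euler_unbounded[OF assms n dt]) (rule that)
    then show False
      using C[OF norm_E_fc_phi(1)[OF assms, of j]] norm_E_fc_phi(2)[OF assms, of "euler dt n" j, where 'n='n]
      by (simp add: norm_E_phi[OF assms])
  qed
qed

end
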